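(* There exist a closed conformal symplectic manifold $(M,\eta,\omega)$, a Hamiltonian $H:M\to\mathbb{R}$ and a point $x\in M$ with $H(x)\neq 0$ such that the winding $r_t$ of the Hamiltonian flow of $H$ satisfies $$\limsup_{t\to+\infty} r_t(x)>\liminf_{t\to+\infty}r_t(x)=-\infty .$$
   Context: A conformal symplectic manifold $(M,\eta,\omega)$ is a smooth manifold $M$ of even dimension with a closed 1-form $\eta$ (the Lee form) and a non-degenerate 2-form $\omega$ such that $\mathrm{d}_\eta\omega=0$, where $\mathrm{d}_\eta\alpha:=\mathrm{d}\alpha-\eta\wedge\alpha$. Given a smooth $H:M\to\mathbb{R}$ (the Hamiltonian), its Hamiltonian vector field $X$ is defined by $\iota_X\omega=\mathrm{d}_\eta H=\mathrm{d}H-H\eta$, and $(\varphi_t)$ denotes its flow. The winding is $r_t(x):=\int_0^t\eta(X(\varphi_s(x)))\,\mathrm{d}s$. *)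

theory Defs
  imports "HOL-Analysis.Analysis"
begin

text \<open>
  \<open>\<real>\<^sup>n\<close> is the library's \<^const>\<open>Euclidean_space\<close> \<open>n\<close>: the sequences \<open>nat \<Rightarrow> real\<close> that vanish from
  index \<open>n\<close> on.
\<close>

definition partial :: "nat \<Rightarrow> ((nat \<Rightarrow> real) \<Rightarrow> real) \<Rightarrow> (nat \<Rightarrow> real) \<Rightarrow> real" where
  "partial i f x = deriv (\<lambda>t. f (x(i := t))) (x i)"

fun Ck_on :: "nat \<Rightarrow> nat \<Rightarrow> (nat \<Rightarrow> real) set \<Rightarrow> ((nat \<Rightarrow> real) \<Rightarrow> real) \<Rightarrow> bool" where
  "Ck_on n 0 W f \<longleftrightarrow> continuous_map (subtopology (Euclidean_space n) W) euclideanreal f"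
| "Ck_on n (Suc k) W f \<longleftrightarrow>
     continuous_map (subtopology (Euclidean_space n) W) euclideanreal f \<and>
     (\<forall>i<n. (\<forall>x\<in>W. (\<lambda>t. f (x(i := t))) field_differentiable at (x i)) \<and>
            Ck_on n k W (partial i f))"

definition Cinf_on :: "nat \<Rightarrow> (nat \<Rightarrow> real) set \<Rightarrow> ((nat \<Rightarrow> real) \<Rightarrow> real) \<Rightarrow> bool" where
  "Cinf_on n W f \<longleftrightarrow> (\<forall>k. Ck_on n k W f)"

text \<open>
  An atlas is a set of pairs \<open>(U, c)\<close> of a domain and a coordinate map. It need not be maximal;
  compatible atlases give the same smooth functions. Charts are onto open subsets of \<open>\<real>\<^sup>n\<close>, so the
  manifolds have no boundary.
\<close>

record 'a mfd =
  mtop :: "'a topology"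
  mdim :: nat
  atlas :: "('a set \<times> ('a \<Rightarrow> nat \<Rightarrow> real)) set"

abbreviation points :: "'a mfd \<Rightarrow> 'a set" where
  "points M \<equiv> topspace (mtop M)"

definition chart :: "'a mfd \<Rightarrow> 'a set \<Rightarrow> ('a \<Rightarrow> nat \<Rightarrow> real) \<Rightarrow> bool" where
  "chart M U c \<longleftrightarrow>
     openin (mtop M) U \<and>
     openin (Euclidean_space (mdim M)) (c ` U) \<and>
     homeomorphic_map (subtopology (mtop M) U) (subtopology (Euclidean_space (mdim M)) (c ` U)) c"

definition smooth_manifold :: "'a mfd \<Rightarrow> bool" where
  "smooth_manifold M \<longleftrightarrow>
     Hausdorff_space (mtop M) \<and> second_countable (mtop M) \<and>
     (\<forall>(U, c)\<in>atlas M. chart M U c) \<and>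
     (\<Union>(U, c)\<in>atlas M. U) = points M \<and>
     (\<forall>(U, c)\<in>atlas M. \<forall>(V, d)\<in>atlas M. \<forall>i<mdim M.
        Cinf_on (mdim M) (c ` (U \<inter> V)) (\<lambda>y. d (inv_into U c y) i))"

definition closed_manifold :: "'a mfd \<Rightarrow> bool" where
  "closed_manifold M \<longleftrightarrow> smooth_manifold M \<and> compact_space (mtop M)"

definition smooth_fun :: "'a mfd \<Rightarrow> ('a \<Rightarrow> real) \<Rightarrow> bool" where
  "smooth_fun M f \<longleftrightarrow> (\<forall>(U, c)\<in>atlas M. Cinf_on (mdim M) (c ` U) (\<lambda>y. f (inv_into U c y)))"

text \<open>
  Tangent vectors at \<open>p\<close> are the derivations at \<open>p\<close> of the algebra of smooth functions, with the
  junk value 0 on non-smooth arguments so that two vectors are equal iff they agree on smooth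
  functions. The values of a function outside \<open>points M\<close> are irrelevant: if \<open>f\<close> vanishes on
  \<open>points M\<close> and \<open>e\<close> is the indicator of the complement, then \<open>e\<close> is smooth, \<open>f = f * e\<close>, and the
  Leibniz rule gives \<open>v f = 0\<close>.
  In particular the bracket of vector fields below is again 0 on non-smooth arguments.
\<close>

type_synonym 'a tvec = "('a \<Rightarrow> real) \<Rightarrow> real"

definition tangent_space :: "'a mfd \<Rightarrow> 'a \<Rightarrow> 'a tvec set" where
  "tangent_space M p = {v.
     (\<forall>f. \<not> smooth_fun M f \<longrightarrow> v f = 0) \<and>
     (\<forall>f g. smooth_fun M f \<longrightarrow> smooth_fun M g \<longrightarrow> v (\<lambda>x. f x + g x) = v f + v g) \<and>
     (\<forall>a f. smooth_fun M f \<longrightarrow> v (\<lambda>x. a * f x) = a * v f) \<and>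
     (\<forall>f g. smooth_fun M f \<longrightarrow> smooth_fun M g \<longrightarrow>
        v (\<lambda>x. f x * g x) = f p * v g + g p * v f)}"

definition vector_field :: "'a mfd \<Rightarrow> ('a \<Rightarrow> 'a tvec) \<Rightarrow> bool" where
  "vector_field M X \<longleftrightarrow>
     (\<forall>p\<in>points M. X p \<in> tangent_space M p) \<and>
     (\<forall>f. smooth_fun M f \<longrightarrow> smooth_fun M (\<lambda>p. X p f))"

definition bracket :: "('a \<Rightarrow> 'a tvec) \<Rightarrow> ('a \<Rightarrow> 'a tvec) \<Rightarrow> 'a \<Rightarrow> 'a tvec" where
  "bracket X Y p f = X p (\<lambda>q. Y q f) - Y p (\<lambda>q. X q f)"

type_synonym 'a form1 = "'a \<Rightarrow> 'a tvec \<Rightarrow> real"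
type_synonym 'a form2 = "'a \<Rightarrow> 'a tvec \<Rightarrow> 'a tvec \<Rightarrow> real"

definition linear_on_tangent :: "'a mfd \<Rightarrow> 'a \<Rightarrow> ('a tvec \<Rightarrow> real) \<Rightarrow> bool" where
  "linear_on_tangent M p l \<longleftrightarrow>
     (\<forall>v\<in>tangent_space M p. \<forall>w\<in>tangent_space M p. l (\<lambda>f. v f + w f) = l v + l w) \<and>
     (\<forall>a. \<forall>v\<in>tangent_space M p. l (\<lambda>f. a * v f) = a * l v)"

definition smooth_form1 :: "'a mfd \<Rightarrow> 'a form1 \<Rightarrow> bool" where
  "smooth_form1 M \<alpha> \<longleftrightarrow>
     (\<forall>p\<in>points M. linear_on_tangent M p (\<alpha> p)) \<and>
     (\<forall>X. vector_field M X \<longrightarrow> smooth_fun M (\<lambda>p. \<alpha> p (X p)))"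

definition smooth_form2 :: "'a mfd \<Rightarrow> 'a form2 \<Rightarrow> bool" where
  "smooth_form2 M \<omega> \<longleftrightarrow>
     (\<forall>p\<in>points M. \<forall>v\<in>tangent_space M p.
        linear_on_tangent M p (\<omega> p v) \<and> linear_on_tangent M p (\<lambda>w. \<omega> p w v) \<and> \<omega> p v v = 0) \<and>
     (\<forall>X Y. vector_field M X \<longrightarrow> vector_field M Y \<longrightarrow> smooth_fun M (\<lambda>p. \<omega> p (X p) (Y p)))"

text \<open>
  Exterior derivatives are given by the invariant (Koszul) formula, evaluated on vector fields, in
  the normalisation without factors \<open>1/(k+1)\<close>; the wedge product is the matching one, for which
  \<open>(\<alpha> \<and> \<beta>)(X, Y) = \<alpha>(X) \<beta>(Y) - \<alpha>(Y) \<beta>(X)\<close> on 1-forms.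
\<close>

definition ext_d0 :: "('a \<Rightarrow> real) \<Rightarrow> 'a form1" where
  "ext_d0 f p v = v f"

definition ext_d1 :: "'a form1 \<Rightarrow> ('a \<Rightarrow> 'a tvec) \<Rightarrow> ('a \<Rightarrow> 'a tvec) \<Rightarrow> 'a \<Rightarrow> real" where
  "ext_d1 \<alpha> X Y p =
     X p (\<lambda>q. \<alpha> q (Y q)) - Y p (\<lambda>q. \<alpha> q (X q)) - \<alpha> p (bracket X Y p)"

definition ext_d2 ::
  "'a form2 \<Rightarrow> ('a \<Rightarrow> 'a tvec) \<Rightarrow> ('a \<Rightarrow> 'a tvec) \<Rightarrow> ('a \<Rightarrow> 'a tvec) \<Rightarrow> 'a \<Rightarrow> real" where
  "ext_d2 \<omega> X Y Z p =
     X p (\<lambda>q. \<omega> q (Y q) (Z q)) + Y p (\<lambda>q. \<omega> q (Z q) (X q)) + Z p (\<lambda>q. \<omega> q (X q) (Y q))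
     - \<omega> p (bracket X Y p) (Z p) - \<omega> p (bracket Y Z p) (X p) - \<omega> p (bracket Z X p) (Y p)"

definition wedge12 :: "'a form1 \<Rightarrow> 'a form2 \<Rightarrow> 'a \<Rightarrow> 'a tvec \<Rightarrow> 'a tvec \<Rightarrow> 'a tvec \<Rightarrow> real" where
  "wedge12 \<alpha> \<omega> p u v w = \<alpha> p u * \<omega> p v w + \<alpha> p v * \<omega> p w u + \<alpha> p w * \<omega> p u v"

definition closed_form1 :: "'a mfd \<Rightarrow> 'a form1 \<Rightarrow> bool" where
  "closed_form1 M \<alpha> \<longleftrightarrow>
     (\<forall>X Y. vector_field M X \<longrightarrow> vector_field M Y \<longrightarrow> (\<forall>p\<in>points M. ext_d1 \<alpha> X Y p = 0))"

definition nondegenerate :: "'a mfd \<Rightarrow> 'a form2 \<Rightarrow> bool" where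
  "nondegenerate M \<omega> \<longleftrightarrow>
     (\<forall>p\<in>points M. \<forall>v\<in>tangent_space M p.
        (\<forall>w\<in>tangent_space M p. \<omega> p v w = 0) \<longrightarrow> v = (\<lambda>f. 0))"

text \<open>The twisted differential \<open>d\<^sub>\<eta> \<alpha> = d\<alpha> - \<eta> \<and> \<alpha>\<close> in degrees 0 and 2.\<close>

definition lee_d0 :: "'a form1 \<Rightarrow> ('a \<Rightarrow> real) \<Rightarrow> 'a form1" where
  "lee_d0 \<eta> f p v = ext_d0 f p v - f p * \<eta> p v"

definition lee_d2 ::
  "'a form1 \<Rightarrow> 'a form2 \<Rightarrow> ('a \<Rightarrow> 'a tvec) \<Rightarrow> ('a \<Rightarrow> 'a tvec) \<Rightarrow> ('a \<Rightarrow> 'a tvec) \<Rightarrow> 'a \<Rightarrow> real" where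
  "lee_d2 \<eta> \<omega> X Y Z p = ext_d2 \<omega> X Y Z p - wedge12 \<eta> \<omega> p (X p) (Y p) (Z p)"

definition conformal_symplectic_manifold :: "'a mfd \<Rightarrow> 'a form1 \<Rightarrow> 'a form2 \<Rightarrow> bool" where
  "conformal_symplectic_manifold M \<eta> \<omega> \<longleftrightarrow>
     smooth_manifold M \<and> even (mdim M) \<and>
     smooth_form1 M \<eta> \<and> closed_form1 M \<eta> \<and>
     smooth_form2 M \<omega> \<and> nondegenerate M \<omega> \<and>
     (\<forall>X Y Z. vector_field M X \<longrightarrow> vector_field M Y \<longrightarrow> vector_field M Z \<longrightarrow>
        (\<forall>p\<in>points M. lee_d2 \<eta> \<omega> X Y Z p = 0))"

definition hamiltonian_vector_field ::
  "'a mfd \<Rightarrow> 'a form1 \<Rightarrow> 'a form2 \<Rightarrow> ('a \<Rightarrow> real) \<Rightarrow> ('a \<Rightarrow> 'a tvec) \<Rightarrow> bool" where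
  "hamiltonian_vector_field M \<eta> \<omega> H X \<longleftrightarrow>
     vector_field M X \<and>
     (\<forall>p\<in>points M. \<forall>v\<in>tangent_space M p. \<omega> p (X p) v = lee_d0 \<eta> H p v)"

text \<open>
  The velocity of a curve \<open>\<gamma>\<close> at \<open>t\<close> is the derivation \<open>f \<mapsto> (f \<circ> \<gamma>)'(t)\<close>. On a closed manifold
  every smooth vector field is complete, so its flow is defined for all times.
\<close>

definition integral_curve :: "'a mfd \<Rightarrow> ('a \<Rightarrow> 'a tvec) \<Rightarrow> (real \<Rightarrow> 'a) \<Rightarrow> bool" where
  "integral_curve M X \<gamma> \<longleftrightarrow>
     (\<forall>t. \<gamma> t \<in> points M) \<and>
     (\<forall>f t. smooth_fun M f \<longrightarrow> ((\<lambda>s. f (\<gamma> s)) has_real_derivative X (\<gamma> t) f) (at t))"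

definition is_flow :: "'a mfd \<Rightarrow> ('a \<Rightarrow> 'a tvec) \<Rightarrow> (real \<Rightarrow> 'a \<Rightarrow> 'a) \<Rightarrow> bool" where
  "is_flow M X \<phi> \<longleftrightarrow>
     (\<forall>x\<in>points M. \<phi> 0 x = x \<and> integral_curve M X (\<lambda>t. \<phi> t x))"

definition winding ::
  "'a form1 \<Rightarrow> ('a \<Rightarrow> 'a tvec) \<Rightarrow> (real \<Rightarrow> 'a \<Rightarrow> 'a) \<Rightarrow> real \<Rightarrow> 'a \<Rightarrow> real" where
  "winding \<eta> X \<phi> t x = (LBINT s=0..ereal t. \<eta> (\<phi> s x) (X (\<phi> s x)))"

end

theory Submission
  imports Defs
begin

text \<open>
  Let \<open>\<theta>\<close>, \<open>y\<close> be the angles of the torus \<open>(\<real> / 2\<pi>\<int>)\<^sup>2\<close>, \<open>\<eta> = d\<theta>\<close> and \<open>\<omega> = d\<theta> \<and> dy\<close>. In dimension two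
  \<open>d\<^sub>\<eta> \<omega> = 0\<close> is automatic. Where \<open>\<theta>\<close> is a function, \<open>\<iota>\<^sub>X \<omega> = dH - H \<eta> = e\<^sup>\<theta> dK\<close> with
  \<open>K = e\<^bsup>-\<theta>\<^esup> H\<close>, so \<open>K\<close> is constant along orbits: an orbit on the cover is a piece of a level
  curve of \<open>K\<close>, and its winding is the change of \<open>\<theta>\<close>. What is needed is a Hamiltonian for which one
  level curve \<open>K = 1\<close> runs to \<open>\<theta> = -\<infinity>\<close> but comes back infinitely often. The infinitely many strands
  of such a curve accumulate, and near a regular point of \<open>K\<close> a level set is a single arc; so they
  must accumulate on an arc of critical points of \<open>K\<close>, and \<open>H\<close> has to be built from flat functions.

  Put \<open>z = 1 / (1 - cos y)\<close>, which tends to infinity at the circle \<open>y = 0\<close>, and \<open>s = \<theta> + z\<close>, so that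
  the curves \<open>s = const\<close> spiral into that circle. With \<open>w = 1 / (1 - cos s)\<close> let
  \<open>b(s) = e\<^bsup>-w\<^esup>\<close> (flat at \<open>s = 0\<close>), let \<open>f\<close> have derivative \<open>c b\<close>, \<open>f(0) = 0\<close> and
  \<open>f(s + 2\<pi>) = f(s) + 2\<pi>\<close>, and let \<open>\<zeta>(s) = 2 + w (1 + sin w)\<close>. The Hamiltonian is
    \<open>H = e\<^bsup>-z\<^esup> (e\<^bsup>s - f(s)\<^esup> + b(s) (z - \<zeta>(s)))\<close>.
  It is \<open>2\<pi>\<close>-periodic in \<open>\<theta>\<close>, and flat and therefore smooth at \<open>y = 0\<close>. Moreover
  \<open>K = e\<^bsup>-f(s)\<^esup> + e\<^bsup>-s\<^esup> b(s) (z - \<zeta>(s))\<close>. So \<open>s = 0\<close> consists of critical points with \<open>K = 1\<close>, while for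
  \<open>0 < s < 2\<pi>\<close> the set \<open>K = 1\<close> is the graph \<open>z = \<zeta>(s) + e\<^sup>s (1 - e\<^bsup>-f(s)\<^esup>) / b(s)\<close>
  (\<open>level_set\<close>), whose last term is bounded for \<open>0 < s \<le> \<pi>\<close> because \<open>f(s) \<le> c s b(s)\<close>
  (\<open>branch_bounds\<close>).

  Along the flow \<open>s' = - z\<^sup>2 e\<^bsup>-z\<^esup> sin y b(s)\<close> (\<open>phase_ode\<close>). Hence an orbit that starts on
  this graph with \<open>0 < y < \<pi>\<close> keeps \<open>s > 0\<close>, as \<open>b(s) \<le> L s\<close>, and follows the graph with
  \<open>s \<rightarrow> 0\<close> (\<open>confined\<close>, \<open>s_arbitrarily_small\<close>). Then \<open>\<theta> = s - z\<close> differs by a bounded amount from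
  \<open>- w (1 + sin w)\<close> with \<open>w \<rightarrow> \<infinity>\<close>: it is bounded below at the times when \<open>sin w = -1\<close> and tends to
  \<open>-\<infinity>\<close> along those when \<open>sin w = 1\<close> (\<open>returns\<close>, \<open>escapes\<close>).

  Three general facts support this. A class of continuous functions closed under differentiation up to sums and
  products consists of smooth functions, which gives smoothness of \<open>H\<close> at \<open>y = 0\<close>. Tangent vectors
  are abstract derivations, so all identities between forms are proved from the Leibniz rule, with
  \<open>d\<theta> = cos \<theta> d(sin \<theta>) - sin \<theta> d(cos \<theta>)\<close>; that a derivation is determined by its values on
  \<open>d\<theta>\<close> and \<open>dy\<close> rests on a periodic form of Hadamard's lemma (\<open>hadamard_circle\<close>). Finally,
  the flow comes from the Picard-Lindelof theorem (\<open>picard_global\<close>) on the universal cover, where the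
  Hamiltonian vector field is periodic and hence globally Lipschitz.
\<close>

section \<open>Smooth functions of two variables\<close>

text \<open>
  Coinduction makes smoothness the largest class of continuous functions closed under taking partial
  derivatives. These are derivatives in the whole plane, so \<open>W\<close> is meant to be open.
\<close>
coinductive smooth2_on :: "(real \<times> real) set \<Rightarrow> (real \<Rightarrow> real \<Rightarrow> real) \<Rightarrow> bool"
  for W :: "(real \<times> real) set" where
  intro: "\<lbrakk>continuous_on W (\<lambda>(x, y). F x y);
    \<And>x y. (x, y) \<in> W \<Longrightarrow> ((\<lambda>t. F t y) has_real_derivative F1 x y) (at x);
    \<And>x y. (x, y) \<in> W \<Longrightarrow> ((\<lambda>t. F x t) has_real_derivative F2 x y) (at y);
    smooth2_on W F1; smooth2_on W F2\<rbrakk> \<Longrightarrow> smooth2_on W F"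

abbreviation smooth2 :: "(real \<Rightarrow> real \<Rightarrow> real) \<Rightarrow> bool" where
  "smooth2 \<equiv> smooth2_on UNIV"

inductive_set alg_closure :: "(real \<Rightarrow> real \<Rightarrow> real) set \<Rightarrow> (real \<Rightarrow> real \<Rightarrow> real) set" for B where
  base: "F \<in> B \<Longrightarrow> F \<in> alg_closure B"
| add: "F \<in> alg_closure B \<Longrightarrow> G \<in> alg_closure B \<Longrightarrow> (\<lambda>x y. F x y + G x y) \<in> alg_closure B"
| mult: "F \<in> alg_closure B \<Longrightarrow> G \<in> alg_closure B \<Longrightarrow> (\<lambda>x y. F x y * G x y) \<in> alg_closure B"

definition partials_on where
  "partials_on W F F1 F2 \<longleftrightarrow> (\<forall>x y. (x, y) \<in> W \<longrightarrow>
     ((\<lambda>t. F t y) has_real_derivative F1 x y) (at x) \<and>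
     ((\<lambda>t. F x t) has_real_derivative F2 x y) (at y))"

text \<open>
  The main way to prove smoothness: it is enough that the partial derivatives of each generator are
  polynomials in the generators, because the Leibniz rule extends this to all polynomials.
\<close>
lemma smooth2_on_alg_closure:
  assumes B: "\<And>F. F \<in> B \<Longrightarrow> continuous_on W (\<lambda>(x, y). F x y) \<and>
      (\<exists>F1\<in>alg_closure B. \<exists>F2\<in>alg_closure B. partials_on W F F1 F2)"
    and "F \<in> alg_closure B"
  shows "smooth2_on W F"
proof -
  have *: "continuous_on W (\<lambda>(x, y). F x y) \<and>
      (\<exists>F1\<in>alg_closure B. \<exists>F2\<in>alg_closure B. partials_on W F F1 F2)" if "F \<in> alg_closure B" for F
    using that
  proof induction
    case (base F)
    then show ?case using B by blast
  next
    case (add F G)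
    then obtain F1 F2 G1 G2 where g: "F1 \<in> alg_closure B" "F2 \<in> alg_closure B" "G1 \<in> alg_closure B" "G2 \<in> alg_closure B"
      "partials_on W F F1 F2" "partials_on W G G1 G2" by blast
    have "continuous_on W (\<lambda>p. (\<lambda>(x, y). F x y) p + (\<lambda>(x, y). G x y) p)"
      using add by (intro continuous_on_add) auto
    moreover have "partials_on W (\<lambda>x y. F x y + G x y)
       (\<lambda>x y. F1 x y + G1 x y) (\<lambda>x y. F2 x y + G2 x y)"
      using g(5,6) unfolding partials_on_def by (auto intro!: derivative_intros)
    ultimately show ?case using alg_closure.add g by (fastforce simp: case_prod_unfold)
  next
    case (mult F G)
    then obtain F1 F2 G1 G2 where g: "F1 \<in> alg_closure B" "F2 \<in> alg_closure B" "G1 \<in> alg_closure B" "G2 \<in> alg_closure B"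
      "partials_on W F F1 F2" "partials_on W G G1 G2" by blast
    have "continuous_on W (\<lambda>p. (\<lambda>(x, y). F x y) p * (\<lambda>(x, y). G x y) p)"
      using mult by (intro continuous_on_mult) auto
    moreover have "partials_on W (\<lambda>x y. F x y * G x y)
       (\<lambda>x y. F x y * G1 x y + F1 x y * G x y) (\<lambda>x y. F x y * G2 x y + F2 x y * G x y)"
      using g(5,6) unfolding partials_on_def by (auto intro!: DERIV_mult')
    moreover have "(\<lambda>x y. F x y * G1 x y + F1 x y * G x y) \<in> alg_closure B"
      "(\<lambda>x y. F x y * G2 x y + F2 x y * G x y) \<in> alg_closure B"
      using g mult by (auto intro!: alg_closure.add alg_closure.mult)
    ultimately show ?case by (fastforce simp: case_prod_unfold)
  qed
  show ?thesis using \<open>F \<in> alg_closure B\<close>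
  proof (coinduction arbitrary: F)
    case smooth2_on
    then show ?case using *[of F] unfolding partials_on_def by blast
  qed
qed

lemma smooth2_on_cont: "smooth2_on W F \<Longrightarrow> continuous_on W (\<lambda>(x, y). F x y)"
  by (erule smooth2_on.cases) auto

lemma smooth2_on_partials:
  assumes "smooth2_on W F"
  obtains F1 F2 where "smooth2_on W F1" "smooth2_on W F2" "partials_on W F F1 F2"
  using assms by (cases) (auto simp: partials_on_def)

lemma smooth2_onI:
  "\<lbrakk>continuous_on W (\<lambda>(x, y). F x y); partials_on W F F1 F2; smooth2_on W F1; smooth2_on W F2\<rbrakk>
    \<Longrightarrow> smooth2_on W F"
  unfolding partials_on_def by (rule smooth2_on.intro[where ?F1.0 = F1 and ?F2.0 = F2]) auto

text \<open>
  Known smooth functions may be used as coefficients.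
\<close>
lemma smooth2_on_extend:
  assumes B: "\<And>F. F \<in> B \<Longrightarrow> continuous_on W (\<lambda>(x, y). F x y) \<and>
      (\<exists>F1\<in>alg_closure (B \<union> Collect (smooth2_on W)). \<exists>F2\<in>alg_closure (B \<union> Collect (smooth2_on W)). partials_on W F F1 F2)"
    and "F \<in> alg_closure (B \<union> Collect (smooth2_on W))"
  shows "smooth2_on W F"
proof (rule smooth2_on_alg_closure[OF _ assms(2)])
  fix F assume "F \<in> B \<union> Collect (smooth2_on W)"
  then show "continuous_on W (\<lambda>(x, y). F x y) \<and>
      (\<exists>F1\<in>alg_closure (B \<union> Collect (smooth2_on W)). \<exists>F2\<in>alg_closure (B \<union> Collect (smooth2_on W)). partials_on W F F1 F2)"
  proof
    assume "F \<in> Collect (smooth2_on W)"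
    then have F: "smooth2_on W F" by simp
    then obtain F1 F2 where "smooth2_on W F1" "smooth2_on W F2" "partials_on W F F1 F2"
      by (rule smooth2_on_partials)
    with smooth2_on_cont[OF F] alg_closure.base[of _ "B \<union> Collect (smooth2_on W)"]
    show ?thesis by blast
  qed (rule B)
qed

lemma smooth2_on_add: "smooth2_on W F \<Longrightarrow> smooth2_on W G \<Longrightarrow> smooth2_on W (\<lambda>x y. F x y + G x y)"
  by (rule smooth2_on_extend[of "{}"]) (auto intro: alg_closure.intros)

lemma smooth2_on_mult: "smooth2_on W F \<Longrightarrow> smooth2_on W G \<Longrightarrow> smooth2_on W (\<lambda>x y. F x y * G x y)"
  by (rule smooth2_on_extend[of "{}"]) (auto intro: alg_closure.intros)

lemma smooth2_on_const [simp]: "smooth2_on W (\<lambda>x y. c)"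
proof (coinduction arbitrary: c)
  case smooth2_on
  show ?case
    by (rule exI[of _ "\<lambda>x y. c"], rule exI[of _ "\<lambda>x y. 0"], rule exI[of _ "\<lambda>x y. 0"])
       (auto simp: case_prod_unfold)
qed

lemma smooth2_on_fst [simp]: "smooth2_on W (\<lambda>x y. x)"
  by (rule smooth2_onI[of _ _ "\<lambda>x y. 1" "\<lambda>x y. 0"])
     (auto simp: partials_on_def case_prod_unfold intro!: derivative_eq_intros continuous_intros)

lemma smooth2_on_snd [simp]: "smooth2_on W (\<lambda>x y. y)"
  by (rule smooth2_onI[of _ _ "\<lambda>x y. 0" "\<lambda>x y. 1"])
     (auto simp: partials_on_def case_prod_unfold intro!: derivative_eq_intros continuous_intros)

lemma smooth2_on_minus: "smooth2_on W F \<Longrightarrow> smooth2_on W (\<lambda>x y. - F x y)"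
  using smooth2_on_mult[of W "\<lambda>x y. -1" F] by simp

lemma smooth2_on_diff: "smooth2_on W F \<Longrightarrow> smooth2_on W G \<Longrightarrow> smooth2_on W (\<lambda>x y. F x y - G x y)"
  using smooth2_on_add[of W F "\<lambda>x y. - G x y"] smooth2_on_minus[of W G] by simp

lemma smooth2_on_cont':
  "smooth2_on W F \<Longrightarrow> continuous_on W (\<lambda>p. F (fst p) (snd p))"
  using smooth2_on_cont[of W F] by (simp add: case_prod_unfold)

text \<open>
  The composites of \<open>F\<close> with all the derivatives \<open>\<phi> n\<close> form a closed class by the chain rule.
\<close>
lemma smooth2_on_compose:
  fixes \<phi> :: "nat \<Rightarrow> real \<Rightarrow> real"
  assumes "smooth2_on W F"
    and \<phi>: "\<And>n x y. (x, y) \<in> W \<Longrightarrow> (\<phi> n has_real_derivative \<phi> (Suc n) (F x y)) (at (F x y))"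
  shows "smooth2_on W (\<lambda>x y. \<phi> n (F x y))"
proof -
  obtain F1 F2 where F: "smooth2_on W F1" "smooth2_on W F2" "partials_on W F F1 F2"
    using assms(1) by (rule smooth2_on_partials)
  define B where "B = range (\<lambda>n x y. \<phi> n (F x y))"
  let ?A = "alg_closure (B \<union> Collect (smooth2_on W))"
  show ?thesis
  proof (rule smooth2_on_extend[of B])
    fix G assume "G \<in> B"
    then obtain n where G: "G = (\<lambda>x y. \<phi> n (F x y))" by (auto simp: B_def)
    have "isCont (\<phi> n) (F x y)" if "(x, y) \<in> W" for x y
      using \<phi>[OF that] by (rule DERIV_isCont)
    then have "continuous_on ((\<lambda>p. F (fst p) (snd p)) ` W) (\<phi> n)"
      by (auto intro!: continuous_at_imp_continuous_on)
    from continuous_on_compose[OF smooth2_on_cont'[OF assms(1)] this]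
    have "continuous_on W (\<lambda>(x, y). G x y)"
      by (simp add: G case_prod_unfold o_def)
    moreover have "partials_on W G (\<lambda>x y. \<phi> (Suc n) (F x y) * F1 x y) (\<lambda>x y. \<phi> (Suc n) (F x y) * F2 x y)"
      unfolding G partials_on_def
    proof (intro allI impI conjI)
      fix x y assume W: "(x, y) \<in> W"
      show "((\<lambda>t. \<phi> n (F t y)) has_real_derivative \<phi> (Suc n) (F x y) * F1 x y) (at x)"
        using F(3) W by (intro DERIV_chain2[where f = "\<phi> n"] \<phi>) (auto simp: partials_on_def)
      show "((\<lambda>t. \<phi> n (F x t)) has_real_derivative \<phi> (Suc n) (F x y) * F2 x y) (at y)"
        using F(3) W by (intro DERIV_chain2[where f = "\<phi> n"] \<phi>) (auto simp: partials_on_def)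
    qed
    moreover have "(\<lambda>x y. \<phi> (Suc n) (F x y)) \<in> ?A" "F1 \<in> ?A" "F2 \<in> ?A"
      by (rule alg_closure.base, use F in \<open>auto simp: B_def\<close>)+
    then have "(\<lambda>x y. \<phi> (Suc n) (F x y) * F1 x y) \<in> ?A" "(\<lambda>x y. \<phi> (Suc n) (F x y) * F2 x y) \<in> ?A"
      using alg_closure.mult by blast+
    ultimately show "continuous_on W (\<lambda>(x, y). G x y) \<and> (\<exists>F1\<in>?A. \<exists>F2\<in>?A. partials_on W G F1 F2)"
      by blast
  next
    show "(\<lambda>x y. \<phi> n (F x y)) \<in> ?A"
      by (rule alg_closure.base) (auto simp: B_def)
  qed
qed

lemma smooth2_on_exp: "smooth2_on W F \<Longrightarrow> smooth2_on W (\<lambda>x y. exp (F x y))"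
  by (rule smooth2_on_compose[where \<phi> = "\<lambda>n. exp"]) auto

lemma smooth2_on_sin:
  assumes "smooth2_on W F" shows "smooth2_on W (\<lambda>x y. sin (F x y))"
proof -
  let ?\<phi> = "\<lambda>n x. sin (x + real n * (pi / 2))"
  have "(?\<phi> n has_real_derivative ?\<phi> (Suc n) x) (at x)" for n x
  proof -
    have "?\<phi> (Suc n) x = cos (x + real n * (pi / 2))"
      using sin_add[of "x + real n * (pi / 2)" "pi / 2"] by (simp add: algebra_simps add_divide_distrib)
    then show ?thesis by (auto intro!: derivative_eq_intros)
  qed
  then show ?thesis
    using smooth2_on_compose[OF assms, of ?\<phi> 0] by simp
qed

lemma smooth2_on_cos: "smooth2_on W F \<Longrightarrow> smooth2_on W (\<lambda>x y. cos (F x y))"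
  using smooth2_on_sin[OF smooth2_on_diff[OF smooth2_on_const[of W "pi / 2"]]]
  by (simp add: cos_sin_eq)

lemma smooth2_on_inverse:
  assumes "smooth2_on W F" "\<And>x y. (x, y) \<in> W \<Longrightarrow> F x y \<noteq> 0"
  shows "smooth2_on W (\<lambda>x y. inverse (F x y))"
proof -
  let ?\<phi> = "\<lambda>n x::real. (-1) ^ n * fact n * inverse x ^ Suc n"
  have "(?\<phi> n has_real_derivative ?\<phi> (Suc n) x) (at x)" if "x \<noteq> 0" for x n
    by (rule DERIV_cong[OF DERIV_cmult[OF DERIV_power[OF DERIV_inverse[OF that]]]])
       (simp add: power2_eq_square algebra_simps)
  then show ?thesis
    using smooth2_on_compose[OF assms(1), of ?\<phi> 0] assms(2) by simp
qed

lemmas smooth2_on_intros = smooth2_on_add smooth2_on_mult smooth2_on_const smooth2_on_fst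
  smooth2_on_snd smooth2_on_minus smooth2_on_diff smooth2_on_exp smooth2_on_sin smooth2_on_cos

lemma partials_on_cong:
  assumes "partials_on W F F1 F2" "open W" "\<And>x y. (x, y) \<in> W \<Longrightarrow> F x y = G x y"
  shows "partials_on W G F1 F2"
  unfolding partials_on_def
proof (intro allI impI conjI)
  fix x y assume W: "(x, y) \<in> W"
  have "open ((\<lambda>t. (t, y)) -` W)" "open ((\<lambda>t. (x, t)) -` W)"
    by (intro open_vimage \<open>open W\<close> continuous_on_Pair continuous_on_const continuous_on_id)+
  note o = this
  show "((\<lambda>t. G t y) has_real_derivative F1 x y) (at x)"
    by (rule has_field_derivative_transform_within_open[where f = "\<lambda>t. F t y", OF _ o(1)])
       (use W assms(1,3) in \<open>auto simp: partials_on_def\<close>)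
  show "((\<lambda>t. G x t) has_real_derivative F2 x y) (at y)"
    by (rule has_field_derivative_transform_within_open[where f = "\<lambda>t. F x t", OF _ o(2)])
       (use W assms(1,3) in \<open>auto simp: partials_on_def\<close>)
qed

lemma partials_on_unique:
  assumes "partials_on W F F1 F2" "partials_on W F G1 G2" "(x, y) \<in> W"
  shows "F1 x y = G1 x y" "F2 x y = G2 x y"
proof -
  show "F1 x y = G1 x y"
    by (rule DERIV_unique[of "\<lambda>t. F t y"]) (use assms in \<open>auto simp: partials_on_def\<close>)
  show "F2 x y = G2 x y"
    by (rule DERIV_unique[of "F x"]) (use assms in \<open>auto simp: partials_on_def\<close>)
qed

lemma smooth2_on_closed_class:
  assumes "\<And>F. F \<in> B \<Longrightarrow> continuous_on W (\<lambda>(x, y). F x y) \<and> (\<exists>F1\<in>B. \<exists>F2\<in>B. partials_on W F F1 F2)"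
    and "F \<in> B"
  shows "smooth2_on W F"
  by (rule smooth2_on_alg_closure[of B]) (use assms alg_closure.base in blast)+

text \<open>
  The partial derivatives of a locally smooth function are again locally smooth; the canonical
  candidates \<^const>\<open>deriv\<close> glue the local ones.
\<close>
lemma smooth2_on_local:
  assumes W: "open W"
    and "\<And>p. p \<in> W \<Longrightarrow> \<exists>V F'. open V \<and> p \<in> V \<and> smooth2_on V F' \<and> (\<forall>(x, y)\<in>V. F x y = F' x y)"
  shows "smooth2_on W F"
proof (rule smooth2_on_closed_class)
  let ?loc = "\<lambda>F p. \<exists>V F'. open V \<and> p \<in> V \<and> smooth2_on V F' \<and> (\<forall>(x, y)\<in>V. F x y = F' x y)"
  let ?B = "{F. \<forall>p\<in>W. ?loc F p}"
  show "F \<in> ?B" using assms(2) by blast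
  fix F assume "F \<in> ?B"
  then have loc: "?loc F p" if "p \<in> W" for p using that by blast
  define F1 where "F1 = (\<lambda>x y. deriv (\<lambda>t. F t y) x)"
  define F2 where "F2 = (\<lambda>x y. deriv (\<lambda>t. F x t) y)"
  have *: thesis if pW: "p \<in> W" and
    that: "\<And>V F1' F2'. \<lbrakk>open V; p \<in> V; smooth2_on V F1'; smooth2_on V F2';
      continuous_on V (\<lambda>(x, y). F x y); partials_on V F F1' F2';
      \<And>x y. (x, y) \<in> V \<Longrightarrow> F1 x y = F1' x y; \<And>x y. (x, y) \<in> V \<Longrightarrow> F2 x y = F2' x y\<rbrakk> \<Longrightarrow> thesis"
    for p thesis
  proof -
    obtain V F' where V: "open V" "p \<in> V" "smooth2_on V F'" "\<forall>(x, y)\<in>V. F x y = F' x y"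
      using loc[OF pW] by (elim exE conjE) (rule that)
    obtain F1' F2' where P: "smooth2_on V F1'" "smooth2_on V F2'" "partials_on V F' F1' F2'"
      using V(3) by (rule smooth2_on_partials)
    have c: "continuous_on V (\<lambda>(x, y). F x y)"
      using smooth2_on_cont[OF V(3)] V(4) by (subst continuous_on_cong[OF refl]) auto
    have d: "partials_on V F F1' F2'"
      using P(3) by (rule partials_on_cong) (use V in auto)
    then have e: "F1 x y = F1' x y" "F2 x y = F2' x y" if "(x, y) \<in> V" for x y
      using that unfolding F1_def F2_def partials_on_def by (simp_all add: DERIV_imp_deriv)
    show ?thesis by (rule that[OF V(1,2) P(1,2) c d e])
  qed
  have "isCont (\<lambda>(x, y). F x y) p" if pW: "p \<in> W" for p
    by (rule *[OF pW]) (simp add: continuous_on_eq_continuous_at)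
  then have 1: "continuous_on W (\<lambda>(x, y). F x y)"
    by (simp add: continuous_at_imp_continuous_on)
  have "((\<lambda>t. F t y) has_real_derivative F1 x y) (at x) \<and>
      ((\<lambda>t. F x t) has_real_derivative F2 x y) (at y)" if pW: "(x, y) \<in> W" for x y
    by (rule *[OF pW]) (simp add: partials_on_def)
  then have 2: "partials_on W F F1 F2" by (simp add: partials_on_def)
  have "?loc F1 p" "?loc F2 p" if pW: "p \<in> W" for p
  proof -
    show "?loc F1 p"
    proof (rule *[OF pW])
      fix V F1' assume "open V" "p \<in> V" "smooth2_on V F1'" "\<And>x y. (x, y) \<in> V \<Longrightarrow> F1 x y = F1' x y"
      then show ?thesis by (intro exI[of _ V] exI[of _ F1']) auto
    qed
    show "?loc F2 p"
    proof (rule *[OF pW])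
      fix V F2' assume "open V" "p \<in> V" "smooth2_on V F2'" "\<And>x y. (x, y) \<in> V \<Longrightarrow> F2 x y = F2' x y"
      then show ?thesis by (intro exI[of _ V] exI[of _ F2']) auto
    qed
  qed
  then have "F1 \<in> ?B" "F2 \<in> ?B" by simp_all
  with 1 2 show "continuous_on W (\<lambda>(x, y). F x y) \<and> (\<exists>F1\<in>?B. \<exists>F2\<in>?B. partials_on W F F1 F2)"
    by blast
qed

lemma smooth2_on_cong:
  assumes "smooth2_on W F" "open W" "\<And>x y. (x, y) \<in> W \<Longrightarrow> F x y = G x y"
  shows "smooth2_on W G"
proof (rule smooth2_on_local[OF assms(2)])
  fix p assume "p \<in> W"
  then show "\<exists>V F'. open V \<and> p \<in> V \<and> smooth2_on V F' \<and> (\<forall>(x, y)\<in>V. G x y = F' x y)"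
    using assms by (intro exI[of _ W] exI[of _ F]) auto
qed

lemma smooth2_on_subset:
  assumes "smooth2_on W F" "V \<subseteq> W"
  shows "smooth2_on V F"
proof (rule smooth2_on_closed_class)
  show "F \<in> Collect (smooth2_on W)" using assms(1) by simp
  fix F assume "F \<in> Collect (smooth2_on W)"
  then have F: "smooth2_on W F" by simp
  then obtain F1 F2 where F': "smooth2_on W F1" "smooth2_on W F2" "partials_on W F F1 F2"
    by (rule smooth2_on_partials)
  have "partials_on V F F1 F2" using F'(3) assms(2) by (auto simp: partials_on_def)
  then show "continuous_on V (\<lambda>(x, y). F x y) \<and>
      (\<exists>F1\<in>Collect (smooth2_on W). \<exists>F2\<in>Collect (smooth2_on W). partials_on V F F1 F2)"
    using F' continuous_on_subset[OF smooth2_on_cont[OF F] assms(2)] by blast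
qed

lemma smooth2_swap:
  assumes "smooth2 F" shows "smooth2 (\<lambda>x y. F y x)"
proof (rule smooth2_on_closed_class)
  let ?B = "{\<lambda>x y. F y x |F. smooth2 F}"
  show "(\<lambda>x y. F y x) \<in> ?B" using assms by blast
  fix G assume "G \<in> ?B"
  then obtain F where G: "G = (\<lambda>x y. F y x)" and F: "smooth2 F" by blast
  obtain F1 F2 where F': "smooth2 F1" "smooth2 F2" "partials_on UNIV F F1 F2"
    using F by (rule smooth2_on_partials)
  have "continuous_on UNIV (\<lambda>p::real \<times> real. (snd p, fst p))"
    by (intro continuous_on_Pair continuous_on_fst continuous_on_snd continuous_on_id)
  from continuous_on_compose2[OF smooth2_on_cont[OF F] this]
  have "continuous_on UNIV (\<lambda>(x, y). G x y)" by (simp add: G case_prod_unfold)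
  moreover have "partials_on UNIV G (\<lambda>x y. F2 y x) (\<lambda>x y. F1 y x)"
    using F'(3) by (simp add: G partials_on_def)
  moreover have "(\<lambda>x y. F2 y x) \<in> ?B" "(\<lambda>x y. F1 y x) \<in> ?B" using F' by blast+
  ultimately show "continuous_on UNIV (\<lambda>(x, y). G x y) \<and> (\<exists>F1\<in>?B. \<exists>F2\<in>?B. partials_on UNIV G F1 F2)"
    by blast
qed

definition smooth1 :: "(real \<Rightarrow> real) \<Rightarrow> bool" where
  "smooth1 A \<longleftrightarrow> smooth2 (\<lambda>x y. A x)"

lemma smooth1_deriv:
  assumes "smooth1 A"
  obtains A' where "smooth1 A'" "\<And>x. (A has_real_derivative A' x) (at x)"
proof -
  obtain F1 F2 where F: "smooth2 F1" "smooth2 F2" "partials_on UNIV (\<lambda>x y. A x) F1 F2"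
    using assms unfolding smooth1_def by (rule smooth2_on_partials)
  have d: "(A has_real_derivative F1 x y) (at x)" for x y
    using F(3) by (simp add: partials_on_def)
  have "F1 x 0 = F1 x y" for x y
    by (rule DERIV_unique[OF d d])
  then have "(\<lambda>x y. F1 x 0) = F1" by blast
  then have "smooth1 (\<lambda>x. F1 x 0)" using F(1) by (simp add: smooth1_def)
  then show ?thesis using d by (rule that)
qed

lemma smooth1_isCont: "smooth1 A \<Longrightarrow> isCont A x"
  by (erule smooth1_deriv) (rule DERIV_isCont)

lemma smooth1I:
  assumes "\<And>x. (A has_real_derivative A' x) (at x)" "smooth1 A'"
  shows "smooth1 A"
  unfolding smooth1_def
proof (rule smooth2_onI)
  have "continuous_on UNIV A"
    using assms(1) by (auto intro!: continuous_at_imp_continuous_on DERIV_isCont)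
  then show "continuous_on UNIV (\<lambda>(x, y). A x)"
    unfolding case_prod_unfold by (rule continuous_on_compose2) (auto intro: continuous_on_fst)
  show "partials_on UNIV (\<lambda>x y. A x) (\<lambda>x y. A' x) (\<lambda>x y. 0)"
    using assms(1) by (simp add: partials_on_def)
qed (use assms(2) in \<open>simp_all add: smooth1_def\<close>)

lemma smooth2_fix_fst:
  assumes "smooth2 F" shows "smooth2 (\<lambda>x y. F a y)"
proof (rule smooth2_on_closed_class)
  let ?B = "{\<lambda>(x::real) y. F a y |F. smooth2 F}"
  show "(\<lambda>(x::real) y. F a y) \<in> ?B" using assms by blast
  fix G assume "G \<in> ?B"
  then obtain F where G: "G = (\<lambda>x y. F a y)" and F: "smooth2 F" by blast
  obtain F1 F2 where F': "smooth2 F1" "smooth2 F2" "partials_on UNIV F F1 F2"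
    using F by (rule smooth2_on_partials)
  have "continuous_on UNIV (\<lambda>p::real \<times> real. (a, snd p))"
    by (intro continuous_on_Pair continuous_on_const continuous_on_snd continuous_on_id)
  from continuous_on_compose2[OF smooth2_on_cont[OF F] this]
  have "continuous_on UNIV (\<lambda>(x, y). G x y)" by (simp add: G case_prod_unfold)
  moreover have "partials_on UNIV G (\<lambda>x y. 0) (\<lambda>x y. F2 a y)"
    using F'(3) by (simp add: G partials_on_def)
  moreover have "(\<lambda>x y. 0) \<in> ?B" by (rule CollectI, rule exI[of _ "\<lambda>x y. 0"]) simp
  moreover have "(\<lambda>x y. F2 a y) \<in> ?B" using F' by blast
  ultimately show "continuous_on UNIV (\<lambda>(x, y). G x y) \<and> (\<exists>F1\<in>?B. \<exists>F2\<in>?B. partials_on UNIV G F1 F2)"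
    by blast
qed

lemma smooth1_section: "smooth2 F \<Longrightarrow> smooth1 (\<lambda>t. F a t)"
  unfolding smooth1_def using smooth2_swap[OF smooth2_fix_fst[of F a]] by simp

lemma smooth2_fix_snd: "smooth2 F \<Longrightarrow> smooth2 (\<lambda>x y. F x b)"
  using smooth1_section[OF smooth2_swap[of F], of b] by (simp add: smooth1_def)

section \<open>Periodic functions\<close>

definition periodic :: "(real \<Rightarrow> real) \<Rightarrow> bool" where
  "periodic f \<longleftrightarrow> (\<forall>x. f (x + 2 * pi) = f x)"

lemma periodic_int: assumes "periodic f" shows "f (x + 2 * pi * of_int k) = f x"
proof (induction k rule: int_induct[where k = 0])
  case (step1 i)
  then show ?case using assms[unfolded periodic_def, rule_format, of "x + 2 * pi * of_int i"]
    by (simp add: algebra_simps)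
next
  case (step2 i)
  then show ?case using assms[unfolded periodic_def, rule_format, of "x + 2 * pi * of_int (i - 1)"]
    by (simp add: algebra_simps)
qed simp

definition mod2pi :: "real \<Rightarrow> real" where "mod2pi x = x - 2 * pi * of_int \<lfloor>x / (2 * pi)\<rfloor>"

lemma mod2pi_bounds: "0 \<le> mod2pi x" "mod2pi x < 2 * pi"
proof -
  define k where "k = \<lfloor>x / (2 * pi)\<rfloor>"
  have "of_int k \<le> x / (2 * pi)" "x / (2 * pi) < of_int k + 1"
    unfolding k_def by linarith+
  then have "of_int k * (2 * pi) \<le> x" "x < (of_int k + 1) * (2 * pi)"
    by (simp_all add: pos_le_divide_eq pos_divide_less_eq)
  moreover have "mod2pi x = x - 2 * pi * of_int k" by (simp add: mod2pi_def k_def)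
  ultimately show "0 \<le> mod2pi x" "mod2pi x < 2 * pi" by (simp_all add: algebra_simps)
qed

lemma periodic_mod2pi: "periodic f \<Longrightarrow> f (mod2pi x) = f x"
  using periodic_int[of f x "- \<lfloor>x / (2 * pi)\<rfloor>"] by (simp add: mod2pi_def)

lemma mod2pi_eq: "0 \<le> x \<Longrightarrow> x < 2 * pi \<Longrightarrow> mod2pi x = x"
proof -
  assume "0 \<le> x" "x < 2 * pi"
  then have "\<lfloor>x / (2 * pi)\<rfloor> = 0" by (simp add: floor_eq_iff)
  then show ?thesis by (simp add: mod2pi_def)
qed

lemma mod2pi_shift: "mod2pi (x + 2 * pi * of_int k) = mod2pi x"
proof -
  have "(x + 2 * pi * of_int k) / (2 * pi) = x / (2 * pi) + of_int k" by (simp add: field_simps)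
  then show ?thesis by (simp add: mod2pi_def algebra_simps)
qed

lemma periodic_bounded:
  assumes "periodic f" "\<And>x. isCont f x"
  obtains M where "M > 0" "\<And>x. \<bar>f x\<bar> \<le> M"
proof -
  have "compact (f ` {0..2 * pi})"
    using assms(2) by (intro compact_continuous_image continuous_at_imp_continuous_on) auto
  then obtain M where "\<And>x. x \<in> {0..2 * pi} \<Longrightarrow> \<bar>f x\<bar> \<le> M"
    using compact_imp_bounded bounded_iff by (metis image_eqI real_norm_def)
  then have "\<bar>f x\<bar> \<le> M" for x
    using mod2pi_bounds[of x] periodic_mod2pi[OF assms(1), of x] by (metis atLeastAtMost_iff less_eq_real_def)
  then show ?thesis by (intro that[of "max M 1"]) (auto simp: le_max_iff_disj)
qed

definition smooth_periodic :: "(real \<Rightarrow> real) \<Rightarrow> bool" where "smooth_periodic A \<longleftrightarrow> periodic A \<and> smooth1 A"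

lemma smooth_periodic_deriv:
  assumes "smooth_periodic A"
  obtains A' where "smooth_periodic A'" "\<And>x. (A has_real_derivative A' x) (at x)"
proof -
  obtain A' where A': "smooth1 A'" "\<And>x. (A has_real_derivative A' x) (at x)"
    using assms unfolding smooth_periodic_def by (blast elim: smooth1_deriv)
  have "A' (x + 2 * pi) = A' x" for x
  proof -
    have "((\<lambda>x. A (x + 2 * pi)) has_real_derivative A' (x + 2 * pi)) (at x)"
      by (rule DERIV_chain2[where g = "\<lambda>x. x + 2 * pi" and Db = 1, simplified])
         (auto intro!: A' derivative_eq_intros)
    moreover have "(\<lambda>x. A (x + 2 * pi)) = A"
      using assms by (auto simp: smooth_periodic_def periodic_def)
    ultimately show ?thesis using A'(2) DERIV_unique by metis
  qed
  then show ?thesis using A' by (intro that[of A']) (auto simp: smooth_periodic_def periodic_def)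
qed

section \<open>Functions that are flat along a circle\<close>

text \<open>
  The convention \<open>inverse 0 = 0\<close> makes \<open>blowup\<close> zero, rather than infinite, where \<open>cos y = 1\<close>.
\<close>
definition blowup :: "real \<Rightarrow> real" where "blowup y = inverse (1 - cos y)"

text \<open>
  The function \<open>e\<^bsup>-z\<^esup> z\<^sup>m A(x + z)\<close> with \<open>z = 1 / (1 - cos y)\<close>. For \<open>m \<ge> 1\<close> the value of
  \<open>blowup\<close> at \<open>cos y = 1\<close> gives it the value 0 there, which is its continuous extension.
\<close>
definition flat_wave :: "nat \<Rightarrow> (real \<Rightarrow> real) \<Rightarrow> real \<Rightarrow> real \<Rightarrow> real" where
  "flat_wave m A x y = exp (- blowup y) * blowup y ^ m * A (x + blowup y)"

lemma blowup_nonneg: "0 \<le> blowup y"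
  by (simp add: blowup_def)

lemma blowup_deriv: "cos y \<noteq> 1 \<Longrightarrow> (blowup has_real_derivative - (sin y * (blowup y)\<^sup>2)) (at y)"
  unfolding blowup_def[abs_def]
  by (auto intro!: derivative_eq_intros simp: power2_eq_square field_simps)

lemma power_le_fact_exp: "0 \<le> z \<Longrightarrow> z ^ n \<le> fact n * exp (z::real)"
proof (induction n arbitrary: z)
  case (Suc n)
  let ?g = "\<lambda>z::real. fact (Suc n) * exp z - z ^ Suc n"
  have "?g 0 \<le> ?g z"
  proof (rule DERIV_nonneg_imp_nondecreasing[OF Suc.prems])
    fix x :: real assume x: "0 \<le> x" "x \<le> z"
    have "(?g has_real_derivative (fact (Suc n) * exp x - of_nat (Suc n) * x ^ n)) (at x)"
      using DERIV_diff[OF DERIV_cmult[OF DERIV_exp] DERIV_pow[of "Suc n" x]] by simp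
    moreover have "0 \<le> fact (Suc n) * exp x - of_nat (Suc n) * x ^ n"
      using mult_left_mono[OF Suc.IH[OF x(1)], of "of_nat (Suc n)"] by (simp add: algebra_simps)
    ultimately show "\<exists>y. (?g has_real_derivative y) (at x) \<and> 0 \<le> y" by blast
  qed
  moreover have "?g 0 \<ge> 0" by simp
  ultimately show ?case by linarith
qed simp

text \<open>
  Exponential decay in \<open>z\<close> beats every power, so one factor \<open>1 / z = 1 - cos y\<close> can be split off.
\<close>
lemma flat_wave_bound:
  assumes "m \<ge> 1" "\<And>x. \<bar>A x\<bar> \<le> M"
  shows "\<bar>flat_wave m A x y\<bar> \<le> M * fact (Suc m) * (1 - cos y)"
proof (cases "cos y = 1")
  case True
  then show ?thesis using assms(1) by (simp add: flat_wave_def blowup_def)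
next
  case False
  then have pos: "1 - cos y > 0" using cos_le_one[of y] by linarith
  then have z: "blowup y > 0" by (simp add: blowup_def)
  have "blowup y ^ m * blowup y \<le> fact (Suc m) * exp (blowup y)"
    using power_le_fact_exp[of "blowup y" "Suc m"] z by (simp add: mult.commute)
  then have "blowup y ^ m * exp (- blowup y) \<le> fact (Suc m) * inverse (blowup y)"
    using z by (simp add: exp_minus field_simps)
  then have "exp (- blowup y) * blowup y ^ m \<le> fact (Suc m) * (1 - cos y)"
    by (simp add: blowup_def mult.commute)
  then have "(exp (- blowup y) * blowup y ^ m) * \<bar>A (x + blowup y)\<bar> \<le> (fact (Suc m) * (1 - cos y)) * M"
    by (rule mult_mono) (use pos assms(2) z in auto)
  then show ?thesis using z by (simp add: flat_wave_def abs_mult mult_ac)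
qed

text \<open>
  The derivatives are combinations of functions of the same kind, since
  \<open>dz/dy = - z\<^sup>2 sin y\<close>. The formula also holds on the circle \<open>cos y = 1\<close>, where both sides vanish.
\<close>
lemma flat_wave_partials:
  assumes m: "m \<ge> 1" and A: "smooth_periodic A" and A': "\<And>x. (A has_real_derivative A' x) (at x)"
  shows "partials_on UNIV (flat_wave m A) (flat_wave m A')
    (\<lambda>x y. sin y * (flat_wave (m + 2) A x y + (- real m) * flat_wave (m + 1) A x y + (- 1) * flat_wave (m + 2) A' x y))"
proof -
  have "(flat_wave m A x has_real_derivative
     sin y * (flat_wave (m + 2) A x y + (- real m) * flat_wave (m + 1) A x y + (- 1) * flat_wave (m + 2) A' x y)) (at y)" for x y
  proof (cases "cos y = 1")
    case False
    let ?z = "blowup y"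
    have dz: "(blowup has_real_derivative - sin y * ?z\<^sup>2) (at y)"
      using blowup_deriv[OF False] by simp
    have dA: "((\<lambda>y. A (x + blowup y)) has_real_derivative A' (x + ?z) * (- sin y * ?z\<^sup>2)) (at y)"
      by (rule DERIV_chain2[OF A']) (auto intro!: derivative_eq_intros dz)
    obtain k where k: "m = Suc k" using m by (cases m) auto
    show ?thesis unfolding flat_wave_def[abs_def] k
      by (rule derivative_eq_intros dz dA refl)+ (simp add: power2_eq_square algebra_simps)
  next
    case True
    have s: "sin y = 0" using True sin_cos_squared_add[of y] by simp
    obtain M where M: "\<And>x. \<bar>A x\<bar> \<le> M"
      using A periodic_bounded[of A] unfolding smooth_periodic_def by (metis smooth1_isCont)
    \<comment> \<open>Here \<open>\<bar>flat_wave\<bar> \<le> C (1 - cos t)\<close>, which vanishes to second order at \<open>y\<close>.\<close>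
    let ?C = "M * fact (Suc m)"
    have b: "\<bar>flat_wave m A x t\<bar> \<le> ?C * (1 - cos t)" for t
      by (rule flat_wave_bound[OF m M])
    have 0: "flat_wave m A x y = 0" using b[of y] True by simp
    have "((\<lambda>t. ?C * (1 - cos t)) has_real_derivative 0) (at y)"
      by (auto intro!: derivative_eq_intros simp: s)
    then have "((\<lambda>t. (?C * (1 - cos t)) / (t - y)) \<longlongrightarrow> 0) (at y)"
      using True by (simp add: has_field_derivative_iff)
    from tendsto_rabs_zero[OF this]
    have "((\<lambda>t. flat_wave m A x t / (t - y)) \<longlongrightarrow> 0) (at y)"
    proof (rule Lim_null_comparison[rotated])
      show "\<forall>\<^sub>F t in at y. norm (flat_wave m A x t / (t - y)) \<le> \<bar>(?C * (1 - cos t)) / (t - y)\<bar>"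
        using order_trans[OF b abs_ge_self] by (intro always_eventually) (auto simp: abs_divide intro!: divide_right_mono)
    qed
    then show ?thesis by (simp add: has_field_derivative_iff 0 s)
  qed
  moreover have "((\<lambda>t. flat_wave m A t y) has_real_derivative flat_wave m A' x y) (at x)" for x y
    unfolding flat_wave_def by (rule DERIV_cmult, rule DERIV_chain2[OF A', where Db = 1, simplified])
      (auto intro!: derivative_eq_intros)
  ultimately show ?thesis unfolding partials_on_def by simp
qed

lemma flat_wave_continuous:
  assumes m: "m \<ge> 1" and A: "smooth_periodic A"
  shows "continuous_on UNIV (\<lambda>(x, y). flat_wave m A x y)"
proof -
  have "isCont (\<lambda>p. flat_wave m A (fst p) (snd p)) (x, y)" for x y
  proof (cases "cos y = 1")
    case False
    have z: "isCont (\<lambda>p::real \<times> real. blowup (snd p)) (x, y)"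
      unfolding blowup_def using False by (intro continuous_intros) auto
    have "isCont (\<lambda>p. A (fst p + blowup (snd p))) (x, y)"
      by (rule isCont_o2[where g = A]) (use z A in \<open>auto intro!: continuous_intros smooth1_isCont simp: smooth_periodic_def\<close>)
    then show ?thesis unfolding flat_wave_def
      by (intro isCont_mult isCont_power isCont_o2[OF isCont_minus[OF z] isCont_exp] z)
  next
    case True
    obtain M where M: "\<And>x. \<bar>A x\<bar> \<le> M"
      using A periodic_bounded[of A] unfolding smooth_periodic_def by (metis smooth1_isCont)
    have b: "\<bar>flat_wave m A x t\<bar> \<le> M * fact (Suc m) * (1 - cos t)" for x t
      by (rule flat_wave_bound[OF m M])
    have "isCont (\<lambda>p::real \<times> real. M * fact (Suc m) * (1 - cos (snd p))) (x, y)"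
      by (intro continuous_intros)
    then have "((\<lambda>p::real \<times> real. M * fact (Suc m) * (1 - cos (snd p))) \<longlongrightarrow> 0) (at (x, y))"
      using True by (simp add: isCont_def)
    then have "((\<lambda>p. flat_wave m A (fst p) (snd p)) \<longlongrightarrow> 0) (at (x, y))"
      by (rule Lim_null_comparison[rotated]) (use b in simp)
    moreover have "flat_wave m A x y = 0" using b[of x y] True by simp
    ultimately show ?thesis by (simp add: isCont_def)
  qed
  then show ?thesis
    by (auto intro!: continuous_at_imp_continuous_on simp: case_prod_unfold)
qed

lemma smooth2_flat_wave:
  assumes "m \<ge> 1" "smooth_periodic A"
  shows "smooth2 (flat_wave m A)"
proof -
  define B where "B = {flat_wave m A |m A. m \<ge> 1 \<and> smooth_periodic A}"
  let ?A = "alg_closure (B \<union> Collect smooth2)"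
  show ?thesis
  proof (rule smooth2_on_extend[of B])
    fix F assume "F \<in> B"
    then obtain m A where F: "F = flat_wave m A" "m \<ge> 1" "smooth_periodic A" by (auto simp: B_def)
    obtain A' where A': "smooth_periodic A'" "\<And>x. (A has_real_derivative A' x) (at x)"
      by (rule smooth_periodic_deriv[OF F(3)]) (rule that)
    have P: "flat_wave k A \<in> ?A" "flat_wave k A' \<in> ?A" if "k \<ge> 1" for k
      by (rule alg_closure.base, use that F A' in \<open>auto simp: B_def\<close>)+
    have C: "(\<lambda>x y. c) \<in> ?A" "(\<lambda>x y. sin y) \<in> ?A" for c
      by (rule alg_closure.base, simp add: smooth2_on_intros)+
    have "(\<lambda>x y. sin y * (flat_wave (m + 2) A x y + (- real m) * flat_wave (m + 1) A x y + (- 1) * flat_wave (m + 2) A' x y)) \<in> ?A"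
      by (intro alg_closure.mult[OF C(2)] alg_closure.add alg_closure.mult[OF C(1)] P) auto
    then show "continuous_on UNIV (\<lambda>(x, y). F x y) \<and> (\<exists>F1\<in>?A. \<exists>F2\<in>?A. partials_on UNIV F F1 F2)"
      using flat_wave_continuous[OF F(2,3)] flat_wave_partials[OF F(2,3) A'(2)] P(2)[OF F(2)] unfolding F(1) by blast
  next
    show "flat_wave m A \<in> ?A" by (rule alg_closure.base) (use assms in \<open>auto simp: B_def\<close>)
  qed
qed

section \<open>Hadamard division on the circle\<close>

text \<open>
  The averages \<open>\<integral>\<^sub>0\<^sup>1 t\<^sup>n G(b + t (x - b), y) dt\<close> for all \<open>n\<close> and all smooth \<open>G\<close> form a class closed
  under differentiation under the integral sign.
\<close>
lemma smooth2_average: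
  assumes "smooth2 G"
  shows "smooth2 (\<lambda>x y. integral (cbox 0 1) (\<lambda>t. t ^ n * G (b + t * (x - b)) y))"
proof -
  let ?I = "\<lambda>n G x y. integral (cbox 0 1) (\<lambda>t::real. t ^ n * G (b + t * (x - b)) y)"
  let ?B = "{?I n G |n G. smooth2 G}"
  have cont: "continuous_on S (\<lambda>u. snd u ^ n * G (b + snd u * (fst (fst u) - b)) (snd (fst u)))"
    if "smooth2 G" for G n and S :: "((real \<times> real) \<times> real) set"
  proof -
    have 1: "continuous_on S (\<lambda>u. (b + snd u * (fst (fst u) - b), snd (fst u)))"
      by (intro continuous_intros)
    show ?thesis
      using continuous_on_compose2[OF smooth2_on_cont'[OF that] 1] by (intro continuous_intros) auto
  qed
  show ?thesis
  proof (rule smooth2_on_closed_class)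
    show "?I n G \<in> ?B" using assms by blast
    fix F assume "F \<in> ?B"
    then obtain n G where F: "F = ?I n G" and G: "smooth2 G" by blast
    obtain G1 G2 where G': "smooth2 G1" "smooth2 G2" "partials_on UNIV G G1 G2"
      using G by (rule smooth2_on_partials)
    have "continuous_on UNIV (\<lambda>p. integral (cbox 0 1) (\<lambda>t. t ^ n * G (b + t * (fst p - b)) (snd p)))"
      by (rule integral_continuous_on_param) (use cont[OF G] in \<open>simp add: case_prod_unfold\<close>)
    then have c: "continuous_on UNIV (\<lambda>(x, y). F x y)"
      by (simp add: F case_prod_unfold)
    have int: "(\<lambda>t. t ^ n * G (b + t * (x - b)) y) integrable_on cbox 0 1" for x y
    proof (rule integrable_continuous)
      have "continuous_on (cbox 0 1) (\<lambda>t::real. ((x, y), t))" by (intro continuous_intros)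
      from continuous_on_compose2[OF cont[OF G, of UNIV n] this]
      show "continuous_on (cbox 0 1) (\<lambda>t. t ^ n * G (b + t * (x - b)) y)" by simp
    qed
    have "((\<lambda>x. ?I n G x y) has_real_derivative ?I (Suc n) G1 x y) (at x within UNIV)" for x y
    proof (rule leibniz_rule_field_derivative)
      fix x t :: real
      have "((\<lambda>x. G (b + t * (x - b)) y) has_real_derivative G1 (b + t * (x - b)) y * t) (at x)"
        using G'(3) by (intro DERIV_chain2[where f = "\<lambda>x. G x y"])
           (auto simp: partials_on_def intro!: derivative_eq_intros)
      from DERIV_cmult[OF this, of "t ^ n"]
      show "((\<lambda>x. t ^ n * G (b + t * (x - b)) y) has_real_derivative
          t ^ Suc n * G1 (b + t * (x - b)) y) (at x within UNIV)"
        by (simp add: mult_ac)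
      have "continuous_on (UNIV \<times> cbox 0 1) (\<lambda>u::real \<times> real. ((fst u, y), snd u))"
        by (intro continuous_intros)
      from continuous_on_compose2[OF cont[OF G'(1), of UNIV "Suc n"] this]
      show "continuous_on (UNIV \<times> cbox 0 1) (\<lambda>(x, t). t ^ Suc n * G1 (b + t * (x - b)) y)"
        by (simp add: case_prod_unfold)
    qed (use int in auto)
    moreover have "((\<lambda>y. ?I n G x y) has_real_derivative ?I n G2 x y) (at y within UNIV)" for x y
    proof (rule leibniz_rule_field_derivative)
      fix y t :: real
      have "((\<lambda>y. G (b + t * (x - b)) y) has_real_derivative G2 (b + t * (x - b)) y) (at y)"
        using G'(3) by (auto simp: partials_on_def)
      from DERIV_cmult[OF this, of "t ^ n"]
      show "((\<lambda>y. t ^ n * G (b + t * (x - b)) y) has_real_derivative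
          t ^ n * G2 (b + t * (x - b)) y) (at y within UNIV)"
        by simp
      have "continuous_on (UNIV \<times> cbox 0 1) (\<lambda>u::real \<times> real. ((x, fst u), snd u))"
        by (intro continuous_intros)
      from continuous_on_compose2[OF cont[OF G'(2), of UNIV n] this]
      show "continuous_on (UNIV \<times> cbox 0 1) (\<lambda>(y, t). t ^ n * G2 (b + t * (x - b)) y)"
        by (simp add: case_prod_unfold)
    qed (use int in auto)
    ultimately have "partials_on UNIV F (?I (Suc n) G1) (?I n G2)"
      by (simp add: F partials_on_def)
    moreover have "?I (Suc n) G1 \<in> ?B" "?I n G2 \<in> ?B" using G' by blast+
    ultimately show "continuous_on UNIV (\<lambda>(x, y). F x y) \<and> (\<exists>F1\<in>?B. \<exists>F2\<in>?B. partials_on UNIV F F1 F2)"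
      using c by blast
  qed
qed

text \<open>
  The quotient is \<open>\<integral>\<^sub>0\<^sup>1 \<partial>\<^sub>1F(b + t (x - b), y) dt\<close>.
\<close>
lemma hadamard:
  assumes "smooth2 F"
  obtains I where "smooth2 I" "\<And>x y. F x y - F b y = (x - b) * I x y"
    "\<And>y. ((\<lambda>t. F t y) has_real_derivative I b y) (at b)"
proof -
  obtain F1 F2 where F: "smooth2 F1" "smooth2 F2" "partials_on UNIV F F1 F2"
    using assms by (rule smooth2_on_partials)
  have d: "((\<lambda>t. F t y) has_real_derivative F1 x y) (at x)" for x y
    using F(3) by (simp add: partials_on_def)
  let ?I = "\<lambda>x y. integral (cbox 0 1) (\<lambda>t. t ^ 0 * F1 (b + t * (x - b)) y)"
  have "((\<lambda>t. F1 (b + t * (x - b)) y * (x - b)) has_integral F (b + 1 * (x - b)) y - F (b + 0 * (x - b)) y) {0..1}" for x y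
  proof (rule fundamental_theorem_of_calculus)
    fix t :: real
    have "((\<lambda>t. F (b + t * (x - b)) y) has_real_derivative F1 (b + t * (x - b)) y * (x - b)) (at t)"
      by (rule DERIV_chain2[OF d]) (auto intro!: derivative_eq_intros)
    then show "((\<lambda>t. F (b + t * (x - b)) y) has_vector_derivative F1 (b + t * (x - b)) y * (x - b)) (at t within {0..1})"
      by (simp add: has_real_derivative_iff_has_vector_derivative has_vector_derivative_at_within)
  qed simp
  from integral_unique[OF this]
  have "integral {0..1} (\<lambda>t. F1 (b + t * (x - b)) y * (x - b)) = F x y - F b y" for x y
    by simp
  from this[symmetric] have "F x y - F b y = (x - b) * ?I x y" for x y
    by (simp add: mult.commute)
  moreover have "?I b y = F1 b y" for y by simp
  ultimately show ?thesis
    using d smooth2_average[OF F(1), of 0 b] by (intro that[of ?I]) simp_all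
qed

text \<open>
  Hadamard's lemma with all functions periodic, so that it is an identity on the torus and no cutoff
  functions are needed. Instead of dividing by \<open>x - a\<close> one multiplies by
  \<open>cot ((x - a) / 2) = (1 + cos (x - a)) / sin (x - a)\<close>, whose only singularities, simple poles at
  \<open>a + 2\<pi>\<int>\<close>, are cancelled by \<open>F(x) - F(a)\<close>.
\<close>
lemma hadamard_circle:
  assumes F: "smooth2 F" and px: "\<And>y. periodic (\<lambda>x. F x y)" and py: "\<And>x. periodic (F x)"
  obtains G where "smooth2 G" "\<And>y. periodic (\<lambda>x. G x y)" "\<And>x. periodic (G x)"
    "\<And>x y. (F x y - F a y) * (1 + cos (x - a)) = G x y * sin (x - a)"
proof -
  define F1 where "F1 = (\<lambda>x y. deriv (\<lambda>t. F t y) x)"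
  \<comment> \<open>\<open>(F(x) - F(a)) cot ((x - a) / 2)\<close>, with its limit at the removable singularities.\<close>
  define G where "G = (\<lambda>x y. if sin ((x - a) / 2) = 0 then 2 * F1 x y
     else (F x y - F a y) * cos ((x - a) / 2) * inverse (sin ((x - a) / 2)))"
  have sub: "F x y = F a y" if z: "sin ((x - a) / 2) = 0" for x y
  proof -
    obtain i where "(x - a) / 2 = of_int i * pi"
      using z[unfolded sin_zero_iff_int2] by (elim exE) (rule that)
    then have "x = a + 2 * pi * of_int i" by (simp add: field_simps)
    then show ?thesis using periodic_int[OF px[of y], of a i] by simp
  qed
  have double: "sin (x - a) = 2 * sin ((x - a) / 2) * cos ((x - a) / 2)"
    "1 + cos (x - a) = 2 * (cos ((x - a) / 2))\<^sup>2" for x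
  proof -
    obtain h where h: "x - a = 2 * h" by (rule that[of "(x - a) / 2"]) simp
    show "sin (x - a) = 2 * sin ((x - a) / 2) * cos ((x - a) / 2)"
      "1 + cos (x - a) = 2 * (cos ((x - a) / 2))\<^sup>2"
      by (simp_all add: h sin_double cos_double_cos)
  qed
  have eq: "(F x y - F a y) * (1 + cos (x - a)) = G x y * sin (x - a)" for x y
  proof (cases "sin ((x - a) / 2) = 0")
    case True
    then show ?thesis using sub[OF True] double(1)[of x] by simp
  next
    case False
    then show ?thesis unfolding double by (simp add: G_def power2_eq_square)
  qed
  have half: "sin ((x + 2 * pi - a) / 2) = - sin ((x - a) / 2)" "cos ((x + 2 * pi - a) / 2) = - cos ((x - a) / 2)" for x
  proof -
    have "(x + 2 * pi - a) / 2 = (x - a) / 2 + pi" by (simp add: field_simps)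
    then show "sin ((x + 2 * pi - a) / 2) = - sin ((x - a) / 2)" "cos ((x + 2 * pi - a) / 2) = - cos ((x - a) / 2)"
      by (simp_all only: sin_periodic_pi cos_periodic_pi)
  qed
  have F1p: "F1 (x + 2 * pi) y = F1 x y" for x y
  proof -
    have "(\<lambda>t. F (t + 2 * pi) y) = (\<lambda>t. F t y)" using px by (auto simp: periodic_def)
    then show ?thesis unfolding F1_def deriv_def DERIV_shift by simp
  qed
  have Gpx: "periodic (\<lambda>x. G x y)" for y
    using px by (auto simp: periodic_def G_def half F1p)
  have Gpy: "periodic (G x)" for x
    using py by (auto simp: periodic_def G_def F1_def)
  have "smooth2 G"
  proof (rule smooth2_on_local)
    fix p :: "real \<times> real"
    obtain x0 y0 where p: "p = (x0, y0)" by (cases p)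
    show "\<exists>V F'. open V \<and> p \<in> V \<and> smooth2_on V F' \<and> (\<forall>(x, y)\<in>V. G x y = F' x y)"
    proof (cases "sin ((x0 - a) / 2) = 0")
      case False
      let ?V = "{p::real \<times> real. sin ((fst p - a) / 2) \<noteq> 0}"
      let ?F = "\<lambda>x y. (F x y - F a y) * cos ((x - a) * (1 / 2)) * inverse (sin ((x - a) * (1 / 2)))"
      have "open ?V" by (intro open_Collect_neq continuous_intros) auto
      moreover have "smooth2_on ?V ?F"
        by (intro smooth2_on_intros smooth2_on_inverse smooth2_on_subset[OF F] 
            smooth2_on_subset[OF smooth2_fix_fst[OF F]]) auto
      ultimately show ?thesis using False
        by (intro exI[of _ ?V] exI[of _ ?F]) (auto simp: p G_def)
    next
      case True
      \<comment> \<open>Near \<open>x0\<close> both \<open>F(x) - F(x0)\<close> and \<open>sin ((x - x0) / 2)\<close> are \<open>x - x0\<close> times a smooth function,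
        the latter with a factor \<open>J\<close> that has no zero in the strip.\<close>
      obtain I where I: "smooth2 I" "\<And>x y. F x y - F x0 y = (x - x0) * I x y"
        "\<And>y. ((\<lambda>t. F t y) has_real_derivative I x0 y) (at x0)"
        by (rule hadamard[OF F]) (rule that)
      have "smooth2 (\<lambda>x y. sin ((x - x0) * (1 / 2)))"
        by (intro smooth2_on_intros)
      then obtain J where J: "smooth2 J" "\<And>x y. sin ((x - x0) * (1 / 2)) - sin ((x0 - x0) * (1 / 2)) = (x - x0) * J x y"
        "\<And>y. ((\<lambda>t. sin ((t - x0) * (1 / 2))) has_real_derivative J x0 y) (at x0)"
        by (rule hadamard[of _ x0]) (rule that)
      have "((\<lambda>t. sin ((t - x0) * (1 / 2))) has_real_derivative 1 / 2) (at x0)"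
        by (auto intro!: derivative_eq_intros)
      then have J0: "J x0 y = 1 / 2" for y using J(3) DERIV_unique by blast
      have I0: "I x0 y = F1 x0 y" for y using I(3)[of y] by (simp add: F1_def DERIV_imp_deriv)
      let ?V = "{p::real \<times> real. \<bar>fst p - x0\<bar> < 2 * pi}"
      let ?F = "\<lambda>x y. I x y * cos ((x - x0) * (1 / 2)) * inverse (J x y)"
      have sinz: "sin ((x - x0) / 2) \<noteq> 0" if "\<bar>x - x0\<bar> < 2 * pi" "x \<noteq> x0" for x
      proof (cases "x > x0")
        case True
        then show ?thesis using that sin_gt_zero[of "(x - x0) / 2"] by auto
      next
        case False
        then show ?thesis using that sin_gt_zero[of "(x0 - x) / 2"] sin_minus[of "(x0 - x) / 2"]
          by (auto simp: minus_divide_left)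
      qed
      have Jnz: "J x y \<noteq> 0" if "\<bar>x - x0\<bar> < 2 * pi" for x y
        using sinz[OF that] J(2)[of x y] J0[of y] by (cases "x = x0") auto
      have "open ?V" by (intro open_Collect_less continuous_intros)
      moreover have "smooth2_on ?V ?F"
        by (intro smooth2_on_intros smooth2_on_inverse smooth2_on_subset[OF I(1)] 
            smooth2_on_subset[OF J(1)]) (use Jnz in auto)
      moreover have cancel: "d * A * B * inverse (d * C) = A * B * inverse C" if "d \<noteq> 0" for d A B C :: real
        using that by (cases "C = 0") (auto simp: field_simps)
      moreover have "G x y = ?F x y" if V: "\<bar>x - x0\<bar> < 2 * pi" for x y
      proof (cases "x = x0")
        case True
        then show ?thesis using \<open>sin ((x0 - a) / 2) = 0\<close> by (simp add: G_def J0 I0)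
      next
        case False
        \<comment> \<open>Sine and cosine of the half angle change by the same sign when \<open>a\<close> is replaced by \<open>x0\<close>.\<close>
        let ?c = "cos ((x0 - a) / 2)"
        have "(x - a) / 2 = (x - x0) / 2 + (x0 - a) / 2" by (simp add: field_simps)
        then have sc: "sin ((x - a) / 2) = sin ((x - x0) / 2) * ?c"
          "cos ((x - a) / 2) = cos ((x - x0) / 2) * ?c"
          using True by (simp_all only: sin_add cos_add)
        have c: "?c \<noteq> 0" using True sin_cos_squared_add[of "(x0 - a) / 2"] by auto
        have "F a y = F x0 y" using sub[OF True] by simp
        then have "G x y = (x - x0) * I x y * cos ((x - x0) / 2) * inverse (sin ((x - x0) / 2))"
          using sinz[OF V False] c I(2)[of x y] by (simp add: G_def sc)
        also have "sin ((x - x0) / 2) = (x - x0) * J x y" using J(2)[of x y] by simp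
        finally show ?thesis using cancel[of "x - x0"] False by simp
      qed
      ultimately show ?thesis
        by (intro exI[of _ ?V] exI[of _ ?F]) (auto simp: p)
    qed
  qed simp
  then show ?thesis using Gpx Gpy eq by (rule that)
qed

section \<open>Global solutions of Lipschitz differential equations\<close>

text \<open>
  With the weight \<open>e\<^bsup>-2Lt\<^esup>\<close> integration has norm at most \<open>1 / (2L)\<close>; this makes Picard's operator a
  contraction with factor \<open>1 / 2\<close> on the whole half-line at once.
\<close>
lemma weighted_integral_bound:
  fixes h :: "real \<Rightarrow> 'a::euclidean_space"
  assumes "0 \<le> t" "L > 0" "continuous_on {0..t} h" "\<And>s. 0 \<le> s \<Longrightarrow> s \<le> t \<Longrightarrow> norm (h s) \<le> K * exp (2 * L * s)"
  shows "exp (- (2 * L * t)) * norm (integral {0..t} h) \<le> K / (2 * L)"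
proof -
  have K: "0 \<le> K" using order_trans[OF norm_ge_zero assms(4)[of 0]] assms(1) by simp
  have I: "((\<lambda>s. K * exp (2 * L * s)) has_integral K * exp (2 * L * t) / (2 * L) - K * exp (2 * L * 0) / (2 * L)) {0..t}"
    using assms(1,2) by (intro fundamental_theorem_of_calculus)
      (auto intro!: derivative_eq_intros simp flip: has_real_derivative_iff_has_vector_derivative)
  have i: "(\<lambda>s. K * exp (2 * L * s)) integrable_on {0..t}"
    "integral {0..t} (\<lambda>s. K * exp (2 * L * s)) \<le> K * exp (2 * L * t) / (2 * L)"
    using I integral_unique[OF I] K assms(2) by (blast, simp)
  have "norm (integral {0..t} h) \<le> integral {0..t} (\<lambda>s. K * exp (2 * L * s))"
    using assms by (intro integral_norm_bound_integral i integrable_continuous_interval) auto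
  also have "\<dots> \<le> K * exp (2 * L * t) / (2 * L)" by (rule i)
  finally show ?thesis by (simp add: exp_minus field_simps)
qed

lemma picard_forward:
  fixes f :: "'a::euclidean_space \<Rightarrow> 'a"
  assumes L: "L > 0" "\<And>x y. norm (f x - f y) \<le> L * norm (x - y)"
  obtains \<gamma> where "\<gamma> 0 = x0" "\<And>t. 0 \<le> t \<Longrightarrow> (\<gamma> has_vector_derivative f (\<gamma> t)) (at t within {0..})"
proof -
  have "L-lipschitz_on UNIV f" using L by (auto simp: lipschitz_on_def dist_norm)
  then have contf: "continuous_on UNIV f" by (rule lipschitz_on_continuous_on)
  \<comment> \<open>The unknown is \<open>g(t) = e\<^bsup>-2Lt\<^esup> (\<gamma>(t) - x0)\<close>, which is bounded since solutions grow at most like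
    \<open>e\<^bsup>Lt\<^esup>\<close>.\<close>
  define h where "h = (\<lambda>(g :: real \<Rightarrow>\<^sub>C 'a) s. f (x0 + exp (2 * L * s) *\<^sub>R apply_bcontfun g s))"
  have conth: "continuous_on S (h g)" for g S
  proof -
    have "continuous_on S (\<lambda>s. x0 + exp (2 * L * s) *\<^sub>R apply_bcontfun g s)"
      by (intro continuous_intros continuous_on_apply_bcontfun)
    from continuous_on_compose2[OF contf this] show ?thesis by (simp add: h_def)
  qed
  \<comment> \<open>Picard's operator in terms of \<open>g\<close>; \<open>max 0 t\<close> extends it constantly to negative times.\<close>
  define T where "T = (\<lambda>g t. exp (- (2 * L * max 0 t)) *\<^sub>R integral {0..max 0 t} (h g))"
  have T: "T g \<in> bcontfun" for g
  proof (rule bcontfun_normI)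
    have "isCont (T g) t" for t
    proof -
      let ?b = "\<bar>t\<bar> + 1"
      have "continuous_on {0..?b} (\<lambda>u. integral {0..u} (h g))"
        by (intro indefinite_integral_continuous_1 integrable_continuous_interval conth)
      moreover have "continuous_on {-?b..?b} (\<lambda>t::real. max 0 t)" by (intro continuous_intros)
      ultimately have "continuous_on {-?b..?b} (\<lambda>t. integral {0..max 0 t} (h g))"
        by (rule continuous_on_compose2) auto
      then have "continuous_on {-?b..?b} (T g)"
        unfolding T_def by (intro continuous_intros)
      then show ?thesis by (rule continuous_on_interior) (simp add: interior_atLeastAtMost_real, linarith)
    qed
    then show "continuous_on UNIV (T g)" by (simp add: continuous_at_imp_continuous_on)
    fix t
    let ?K = "norm (f x0) + L * norm g"
    have "norm (h g s) \<le> ?K * exp (2 * L * s)" if "0 \<le> s" for s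
    proof -
      have "norm (h g s) \<le> norm (f x0) + norm (h g s - f x0)"
        using norm_triangle_ineq[of "f x0" "h g s - f x0"] by simp
      also have "norm (h g s - f x0) \<le> L * (exp (2 * L * s) * norm (apply_bcontfun g s))"
        using L(2)[of "x0 + exp (2 * L * s) *\<^sub>R apply_bcontfun g s" x0] by (simp add: h_def)
      also have "\<dots> \<le> L * (exp (2 * L * s) * norm g)"
        using L(1) norm_bounded[of g s] by (intro mult_left_mono) auto
      also have "norm (f x0) \<le> norm (f x0) * exp (2 * L * s)"
        using L(1) that mult_left_mono[of 1 "exp (2 * L * s)" "norm (f x0)"] by simp
      finally show ?thesis by (simp add: algebra_simps)
    qed
    then have "exp (- (2 * L * max 0 t)) * norm (integral {0..max 0 t} (h g)) \<le> ?K / (2 * L)"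
      by (intro weighted_integral_bound L(1) conth) auto
    then show "norm (T g t) \<le> ?K / (2 * L)" by (simp add: T_def)
  qed
  define P where "P = (\<lambda>g. Bcontfun (T g))"
  have P: "apply_bcontfun (P g) = T g" for g
    unfolding P_def using T by (rule Bcontfun_inverse)
  have "dist (P g) (P g') \<le> 1 / 2 * dist g g'" for g g'
  proof (rule dist_bound)
    fix t :: real
    let ?u = "max 0 t"
    have "norm (h g s - h g' s) \<le> (L * dist g g') * exp (2 * L * s)" for s
    proof -
      have "norm (h g s - h g' s) \<le> L * norm (exp (2 * L * s) *\<^sub>R apply_bcontfun g s - exp (2 * L * s) *\<^sub>R apply_bcontfun g' s)"
        using L(2)[of "x0 + exp (2 * L * s) *\<^sub>R apply_bcontfun g s" "x0 + exp (2 * L * s) *\<^sub>R apply_bcontfun g' s"]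
        by (simp add: h_def)
      also have "\<dots> = L * (exp (2 * L * s) * dist (apply_bcontfun g s) (apply_bcontfun g' s))"
        by (simp add: dist_norm flip: scaleR_diff_right)
      also have "\<dots> \<le> L * (exp (2 * L * s) * dist g g')"
        using L(1) dist_bounded[of g s g'] by (intro mult_left_mono) auto
      finally show ?thesis by (simp add: mult_ac)
    qed
    then have "exp (- (2 * L * ?u)) * norm (integral {0..?u} (\<lambda>s. h g s - h g' s)) \<le> (L * dist g g') / (2 * L)"
      by (intro weighted_integral_bound L(1) continuous_on_diff conth) auto
    also have "integral {0..?u} (\<lambda>s. h g s - h g' s) = integral {0..?u} (h g) - integral {0..?u} (h g')"
      by (intro Henstock_Kurzweil_Integration.integral_diff integrable_continuous_interval conth)
    finally show "dist (apply_bcontfun (P g) t) (apply_bcontfun (P g') t) \<le> 1 / 2 * dist g g'"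
      using L(1) by (simp add: P T_def dist_norm flip: scaleR_diff_right)
  qed
  then obtain g where g: "P g = g"
    using banach_fix_type[of "1/2" P] by auto
  define \<gamma> where "\<gamma> = (\<lambda>t. x0 + integral {0..t} (h g))"
  have h: "h g s = f (\<gamma> s)" if "0 \<le> s" for s
  proof -
    have "apply_bcontfun g s = T g s" using g P by metis
    then have "exp (2 * L * s) *\<^sub>R apply_bcontfun g s = integral {0..s} (h g)"
      using that by (simp add: T_def exp_minus)
    then show ?thesis by (simp add: h_def \<gamma>_def)
  qed
  have "(\<gamma> has_vector_derivative f (\<gamma> t)) (at t within {0..})" if "0 \<le> t" for t
  proof -
    have "((\<lambda>u. integral {0..u} (h g)) has_vector_derivative h g t) (at t within {0..t + 1})"
      using that by (intro integral_has_vector_derivative conth) auto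
    then have "(\<gamma> has_vector_derivative h g t) (at t within {0..t + 1})"
      unfolding \<gamma>_def by (auto intro!: derivative_eq_intros)
    moreover have "at t within {0..t + 1} = at t within {0..}"
      by (rule at_within_nhd[of _ "{..<t + 1}"]) auto
    ultimately show ?thesis using h[OF that] by simp
  qed
  moreover have "\<gamma> 0 = x0" by (simp add: \<gamma>_def)
  ultimately show ?thesis by (intro that)
qed

text \<open>
  Solutions of \<open>x' = f(x)\<close> and of \<open>x' = - f(x)\<close> on the half-line, the latter run backwards, are glued
  at time 0.
\<close>
lemma picard_global:
  fixes f :: "'a::euclidean_space \<Rightarrow> 'a"
  assumes L: "L > 0" "\<And>x y. norm (f x - f y) \<le> L * norm (x - y)"
  obtains \<gamma> where "\<gamma> 0 = x0" "\<And>t. (\<gamma> has_vector_derivative f (\<gamma> t)) (at t)"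
proof -
  obtain \<alpha> where \<alpha>: "\<alpha> 0 = x0" "\<And>t. 0 \<le> t \<Longrightarrow> (\<alpha> has_vector_derivative f (\<alpha> t)) (at t within {0..})"
    by (rule picard_forward[OF L, of x0]) (rule that)
  have L': "norm (- f x - - f y) \<le> L * norm (x - y)" for x y
    using L(2)[of x y] by (simp add: norm_minus_commute)
  obtain \<beta> where \<beta>: "\<beta> 0 = x0" "\<And>t. 0 \<le> t \<Longrightarrow> (\<beta> has_vector_derivative - f (\<beta> t)) (at t within {0..})"
    by (rule picard_forward[where f = "\<lambda>x. - f x", OF L(1) L', of x0]) (rule that)
  have \<beta>': "((\<lambda>t. \<beta> (- t)) has_vector_derivative f (\<beta> (- t))) (at t within {..0})" if "t \<le> 0" for t
  proof -
    have "(\<beta> \<circ> uminus has_vector_derivative (- 1) *\<^sub>R (- f (\<beta> (- t)))) (at t within {..0})"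
    proof (rule vector_diff_chain_within)
      show "(uminus has_vector_derivative (- 1 :: real)) (at t within {..0})"
        by (auto intro!: derivative_eq_intros simp flip: has_real_derivative_iff_has_vector_derivative)
      show "(\<beta> has_vector_derivative - f (\<beta> (- t))) (at (- t) within uminus ` {..0})"
        using \<beta>(2)[of "- t"] that by simp
    qed
    then show ?thesis by (simp add: o_def)
  qed
  define \<gamma> where "\<gamma> = (\<lambda>t. if t \<in> {0..} then \<alpha> t else \<beta> (- t))"
  have "(\<gamma> has_vector_derivative (if t \<in> {0..} then f (\<alpha> t) else f (\<beta> (- t)))) (at t within UNIV)" for t :: real
    unfolding \<gamma>_def
  proof (rule has_vector_derivative_If_within_closures)
    show "t \<in> {0..} \<union> {..0}" "UNIV = {0..} \<union> {..0::real}" by auto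
    have c: "{0::real..} \<union> closure {0..} \<inter> closure {..0} = {0..}" "{..0} \<union> closure {0..} \<inter> closure {..0} = {..(0::real)}"
      unfolding closure_closed[OF closed_atLeast] closure_closed[OF closed_atMost] by auto
    show "(\<alpha> has_vector_derivative f (\<alpha> t)) (at t within {0..} \<union> closure {0..} \<inter> closure {..0})"
      if "t \<in> {0..} \<union> closure {0..} \<inter> closure {..0}"
      using \<alpha>(2)[of t] that unfolding c by auto
    show "((\<lambda>t. \<beta> (- t)) has_vector_derivative f (\<beta> (- t))) (at t within {..0} \<union> closure {0..} \<inter> closure {..0})"
      if "t \<in> {..0} \<union> closure {0..} \<inter> closure {..0}"
      using \<beta>'[of t] that unfolding c by auto
    show "\<alpha> t = \<beta> (- t)" "f (\<alpha> t) = f (\<beta> (- t))" if "t \<in> closure {0..}" "t \<in> closure {..0}"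
      using that \<alpha>(1) \<beta>(1) by (auto intro: antisym)
  qed
  moreover have "(if t \<in> {0..} then f (\<alpha> t) else f (\<beta> (- t))) = f (\<gamma> t)" for t by (simp add: \<gamma>_def)
  ultimately have "(\<gamma> has_vector_derivative f (\<gamma> t)) (at t)" for t by metis
  moreover have "\<gamma> 0 = x0" using \<alpha>(1) by (simp add: \<gamma>_def)
  ultimately show ?thesis by (intro that)
qed

section \<open>The torus\<close>

definition plane_pt :: "real \<times> real \<Rightarrow> nat \<Rightarrow> real" where
  "plane_pt p = (\<lambda>i. if i = 0 then fst p else if i = 1 then snd p else 0)"

lemma plane_pt_simps [simp]: "plane_pt p 0 = fst p" "plane_pt p (Suc 0) = snd p" "plane_pt p (Suc (Suc i)) = 0"
  "(plane_pt p)(0 := t) = plane_pt (t, snd p)" "(plane_pt p)(Suc 0 := t) = plane_pt (fst p, t)"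
  by (auto simp: plane_pt_def)

lemma inj_plane_pt: "inj plane_pt"
proof (rule injI)
  fix p p' assume "plane_pt p = plane_pt p'"
  then have "plane_pt p 0 = plane_pt p' 0" "plane_pt p 1 = plane_pt p' 1" by simp_all
  then show "p = p'" by (simp add: prod_eq_iff)
qed

lemma topspace_plane: "topspace (Euclidean_space 2) = range plane_pt"
proof -
  have "x = plane_pt (x 0, x 1)" if "\<forall>i\<ge>2. x i = 0" for x
  proof
    fix i show "x i = plane_pt (x 0, x 1) i"
      using that by (cases "i \<ge> 2") (auto simp: plane_pt_def not_le less_Suc_eq numeral_2_eq_2)
  qed
  moreover have "plane_pt p i = 0" if "i \<ge> 2" for p i using that by (simp add: plane_pt_def)
  ultimately show ?thesis by (auto simp: topspace_Euclidean_space)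
qed

lemma plane_top_of_set: "Euclidean_space 2 = top_of_set (range plane_pt)"
  using topspace_plane by (simp add: Euclidean_space_def euclidean_product_topology topspace_Euclidean_space)

lemma plane_pt_continuous: "continuous_on S plane_pt"
proof (rule continuous_on_coordinatewise_then_product)
  fix i show "continuous_on S (\<lambda>p. plane_pt p i)"
    by (cases "i = 0"; cases "i = 1") (auto simp: plane_pt_def intro: continuous_intros)
qed

lemma plane_pt_inv_continuous: "continuous_on S (\<lambda>x::nat \<Rightarrow> real. (x 0, x 1))"
  by (intro continuous_on_Pair continuous_on_subset[OF continuous_on_product_coordinates subset_UNIV])

lemma homeomorphic_maps_plane_pt: "homeomorphic_maps euclidean (Euclidean_space 2) plane_pt (\<lambda>x. (x 0, x 1))"
  unfolding homeomorphic_maps_def plane_top_of_set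
  using plane_pt_continuous[of UNIV] plane_pt_inv_continuous[of "range plane_pt"]
  by (auto simp: continuous_map_in_subtopology)

lemma openin_plane_pt_image: "open W \<Longrightarrow> openin (Euclidean_space 2) (plane_pt ` W)"
  using homeomorphic_map_openness[OF homeomorphic_maps_imp_map[OF homeomorphic_maps_plane_pt], of W] by simp

lemma continuous_map_plane_pt_image:
  "continuous_map (subtopology (Euclidean_space 2) (plane_pt ` W)) euclideanreal f \<longleftrightarrow>
    continuous_on W (\<lambda>(x, y). f (plane_pt (x, y)))"
proof -
  have "subtopology (Euclidean_space 2) (plane_pt ` W) = top_of_set (plane_pt ` W)"
    by (simp add: plane_top_of_set subtopology_subtopology inf_absorb2 image_mono)
  then have *: "continuous_map (subtopology (Euclidean_space 2) (plane_pt ` W)) euclideanreal f \<longleftrightarrow>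
      continuous_on (plane_pt ` W) f" by simp
  show ?thesis unfolding *
  proof
    assume "continuous_on (plane_pt ` W) f"
    from continuous_on_compose2[OF this plane_pt_continuous[of W]]
    show "continuous_on W (\<lambda>(x, y). f (plane_pt (x, y)))" by (simp add: case_prod_unfold)
  next
    assume "continuous_on W (\<lambda>(x, y). f (plane_pt (x, y)))"
    from continuous_on_compose2[OF this plane_pt_inv_continuous[of "plane_pt ` W"]]
    have "continuous_on (plane_pt ` W) (\<lambda>x. f (plane_pt (x 0, x 1)))" by (simp add: image_image)
    then show "continuous_on (plane_pt ` W) f"
      by (subst (asm) continuous_on_cong[OF refl, where g = f]) auto
  qed
qed

lemma partial_plane_pt:
  "partial 0 f (plane_pt (x, y)) = deriv (\<lambda>t. f (plane_pt (t, y))) x"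
  "partial (Suc 0) f (plane_pt (x, y)) = deriv (\<lambda>t. f (plane_pt (x, t))) y"
  by (simp_all add: partial_def)

text \<open>
  Translates the smoothness of functions on subsets of \<^term>\<open>Euclidean_space 2\<close> into smoothness of
  functions of two real variables, in which all calculations are done.
\<close>
lemma Cinf_on_plane_pt_image:
  assumes W: "open W"
  shows "Cinf_on 2 (plane_pt ` W) f \<longleftrightarrow> smooth2_on W (\<lambda>x y. f (plane_pt (x, y)))"
proof
  assume f: "Cinf_on 2 (plane_pt ` W) f"
  let ?B = "{\<lambda>x y. f (plane_pt (x, y)) |f. Cinf_on 2 (plane_pt ` W) f}"
  show "smooth2_on W (\<lambda>x y. f (plane_pt (x, y)))"
  proof (rule smooth2_on_closed_class)
    show "(\<lambda>x y. f (plane_pt (x, y))) \<in> ?B" using f by blast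
    fix F assume "F \<in> ?B"
    then obtain f where F: "F = (\<lambda>x y. f (plane_pt (x, y)))" and f: "Cinf_on 2 (plane_pt ` W) f" by blast
    have C: "Ck_on 2 (Suc k) (plane_pt ` W) f" for k using f by (simp add: Cinf_on_def del: Ck_on.simps)
    have p: "Cinf_on 2 (plane_pt ` W) (partial 0 f)" "Cinf_on 2 (plane_pt ` W) (partial (Suc 0) f)"
      using C by (auto simp: Cinf_on_def)
    have "continuous_on W (\<lambda>(x, y). F x y)"
      using C[of 0] unfolding F by (simp only: Ck_on.simps continuous_map_plane_pt_image)
    moreover have "partials_on W F (\<lambda>x y. partial 0 f (plane_pt (x, y))) (\<lambda>x y. partial (Suc 0) f (plane_pt (x, y)))"
      unfolding partials_on_def
    proof (intro allI impI)
      fix x y assume xy: "(x, y) \<in> W"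
      have "(\<lambda>t. f ((plane_pt (x, y))(0 := t))) field_differentiable at (plane_pt (x, y) 0)"
        "(\<lambda>t. f ((plane_pt (x, y))(Suc 0 := t))) field_differentiable at (plane_pt (x, y) (Suc 0))"
        using C[of 0] xy by (auto simp del: plane_pt_simps)
      then show "((\<lambda>t. F t y) has_real_derivative partial 0 f (plane_pt (x, y))) (at x) \<and>
          ((\<lambda>t. F x t) has_real_derivative partial (Suc 0) f (plane_pt (x, y))) (at y)"
        by (simp add: F partial_plane_pt DERIV_deriv_iff_field_differentiable)
    qed
    moreover have "(\<lambda>x y. partial 0 f (plane_pt (x, y))) \<in> ?B" "(\<lambda>x y. partial (Suc 0) f (plane_pt (x, y))) \<in> ?B"
      using p by blast+
    ultimately show "continuous_on W (\<lambda>(x, y). F x y) \<and> (\<exists>F1\<in>?B. \<exists>F2\<in>?B. partials_on W F F1 F2)"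
      by blast
  qed
next
  have "Ck_on 2 k (plane_pt ` W) f" if "smooth2_on W (\<lambda>x y. f (plane_pt (x, y)))" for k f
    using that
  proof (induction k arbitrary: f)
    case 0
    then show ?case using smooth2_on_cont[OF 0] by (simp add: continuous_map_plane_pt_image)
  next
    case (Suc k)
    obtain F1 F2 where F: "smooth2_on W F1" "smooth2_on W F2" "partials_on W (\<lambda>x y. f (plane_pt (x, y))) F1 F2"
      using Suc.prems by (rule smooth2_on_partials)
    have d: "((\<lambda>t. f (plane_pt (t, y))) has_real_derivative F1 x y) (at x)"
      "((\<lambda>t. f (plane_pt (x, t))) has_real_derivative F2 x y) (at y)" if "(x, y) \<in> W" for x y
      using F(3) that by (auto simp: partials_on_def)
    have "smooth2_on W (\<lambda>x y. partial 0 f (plane_pt (x, y)))" "smooth2_on W (\<lambda>x y. partial (Suc 0) f (plane_pt (x, y)))"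
      by (rule smooth2_on_cong[OF F(1) W] smooth2_on_cong[OF F(2) W],
          simp add: partial_plane_pt DERIV_imp_deriv[OF d(1)] DERIV_imp_deriv[OF d(2)])+
    then have "Ck_on 2 k (plane_pt ` W) (partial 0 f)" "Ck_on 2 k (plane_pt ` W) (partial (Suc 0) f)"
      using Suc.IH by blast+
    moreover have "(\<lambda>t. f (plane_pt (t, y))) field_differentiable at x"
      "(\<lambda>t. f (plane_pt (x, t))) field_differentiable at y" if "(x, y) \<in> W" for x y
      unfolding field_differentiable_def using d[OF that] by blast+
    moreover have "i < 2 \<longleftrightarrow> i = 0 \<or> i = Suc 0" for i :: nat by auto
    ultimately show ?case
      using smooth2_on_cont[OF Suc.prems] by (auto simp: continuous_map_plane_pt_image)
  qed
  then show "smooth2_on W (\<lambda>x y. f (plane_pt (x, y))) \<Longrightarrow> Cinf_on 2 (plane_pt ` W) f"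
    by (simp add: Cinf_on_def)
qed

lemma mod2pi_eq_iff: "mod2pi x = mod2pi y \<longleftrightarrow> (\<exists>k::int. y = x + 2 * pi * of_int k)"
proof
  assume "mod2pi x = mod2pi y"
  then have "y = x + 2 * pi * of_int (\<lfloor>y / (2 * pi)\<rfloor> - \<lfloor>x / (2 * pi)\<rfloor>)"
    by (simp add: mod2pi_def algebra_simps)
  then show "\<exists>k::int. y = x + 2 * pi * of_int k" by blast
qed (auto simp: mod2pi_shift)

lemma mod2pi_mod2pi_diff [simp]: "mod2pi (mod2pi x - a) = mod2pi (x - a)"
proof -
  have "mod2pi x - a = (x - a) + 2 * pi * of_int (- \<lfloor>x / (2 * pi)\<rfloor>)" by (simp add: mod2pi_def)
  then show ?thesis by (metis mod2pi_shift)
qed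

lemma mod2pi_idem [simp]: "mod2pi (mod2pi x) = mod2pi x"
  using mod2pi_mod2pi_diff[of x 0] by simp

text \<open>
  The points of the torus are represented in the fundamental domain \<open>[0, 2\<pi>)\<^sup>2\<close>; its topology and
  charts are those of the quotient of the plane.
\<close>
definition tproj :: "real \<times> real \<Rightarrow> nat \<Rightarrow> real" where "tproj p = plane_pt (mod2pi (fst p), mod2pi (snd p))"

definition torus_top :: "(nat \<Rightarrow> real) topology" where
  "torus_top = topology (\<lambda>U. U \<subseteq> range tproj \<and> open (tproj -` U))"

lemma openin_torus_top: "openin torus_top U \<longleftrightarrow> U \<subseteq> range tproj \<and> open (tproj -` U)"
proof -
  have "istopology (\<lambda>U. U \<subseteq> range tproj \<and> open (tproj -` U))"
    unfolding istopology_def by (auto simp: vimage_Union)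
  then show ?thesis by (simp add: torus_top_def)
qed

lemma topspace_torus_top [simp]: "topspace torus_top = range tproj"
  by (auto simp: topspace_def openin_torus_top intro!: exI[of _ "range tproj"] simp: vimage_def)

lemma continuous_map_tproj: "continuous_map euclidean torus_top tproj"
  by (auto simp: continuous_map openin_torus_top vimage_def)

lemma tproj_eq_iff: "tproj p = tproj p' \<longleftrightarrow> mod2pi (fst p) = mod2pi (fst p') \<and> mod2pi (snd p) = mod2pi (snd p')"
  using inj_plane_pt by (auto simp: tproj_def inj_def)

lemma saturation: "tproj -` (tproj ` V) = (\<Union>k l::int. (\<lambda>p. (fst p + 2 * pi * of_int k, snd p + 2 * pi * of_int l)) -` V)"
proof -
  have "tproj p \<in> tproj ` V \<longleftrightarrow> (\<exists>k l::int. (fst p + 2 * pi * of_int k, snd p + 2 * pi * of_int l) \<in> V)" for p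
  proof
    assume "tproj p \<in> tproj ` V"
    then obtain v where v: "v \<in> V" "tproj p = tproj v" by (rule imageE)
    obtain k l :: int where "fst v = fst p + 2 * pi * of_int k" "snd v = snd p + 2 * pi * of_int l"
      using v(2) unfolding tproj_eq_iff mod2pi_eq_iff by (elim conjE exE) (rule that)
    then have "v = (fst p + 2 * pi * of_int k, snd p + 2 * pi * of_int l)"
      by (simp add: prod_eq_iff)
    then show "\<exists>k l::int. (fst p + 2 * pi * of_int k, snd p + 2 * pi * of_int l) \<in> V"
      using v(1) by metis
  next
    assume "\<exists>k l::int. (fst p + 2 * pi * of_int k, snd p + 2 * pi * of_int l) \<in> V"
    then obtain k l :: int where v: "(fst p + 2 * pi * of_int k, snd p + 2 * pi * of_int l) \<in> V"
      by (elim exE) (rule that)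
    show "tproj p \<in> tproj ` V"
      by (rule image_eqI[OF _ v]) (simp add: tproj_eq_iff mod2pi_shift)
  qed
  then show ?thesis by (intro set_eqI) simp
qed

lemma openin_tproj_image: assumes "open V" shows "openin torus_top (tproj ` V)"
proof -
  have "open ((\<lambda>p::real \<times> real. (fst p + c, snd p + d)) -` V)" for c d
    by (rule open_vimage[OF assms]) (intro continuous_intros)
  then have "open (tproj -` (tproj ` V))" unfolding saturation by (intro open_UN ballI)
  then show ?thesis by (auto simp: openin_torus_top)
qed

text \<open>
  The universal property of the quotient topology.
\<close>
lemma continuous_map_torus_top:
  fixes g :: "(nat \<Rightarrow> real) \<Rightarrow> real"
  assumes c: "continuous_on UNIV (\<lambda>p. g (tproj p))"
  shows "continuous_map torus_top euclideanreal g"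
  unfolding continuous_map
proof (intro conjI allI impI)
  fix U :: "real set" assume U: "openin euclidean U"
  have "tproj -` {x \<in> topspace torus_top. g x \<in> U} = (\<lambda>p. g (tproj p)) -` U" by auto
  then show "openin torus_top {x \<in> topspace torus_top. g x \<in> U}"
    using open_vimage[OF _ c] U by (auto simp: openin_torus_top)
qed simp

lemma periodic_sin_cos: "periodic sin" "periodic cos"
  by (simp_all add: periodic_def)

lemma cos_sin_tproj [simp]: "cos (tproj p 0) = cos (fst p)" "sin (tproj p 0) = sin (fst p)"
  "cos (tproj p (Suc 0)) = cos (snd p)" "sin (tproj p (Suc 0)) = sin (snd p)"
  using periodic_mod2pi[OF periodic_sin_cos(1)] periodic_mod2pi[OF periodic_sin_cos(2)]
  by (simp_all add: tproj_def)

lemma mod2pi_inj_sin_cos: "sin x = sin y \<Longrightarrow> cos x = cos y \<Longrightarrow> mod2pi x = mod2pi y"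
  unfolding mod2pi_eq_iff sin_cos_eq_iff by (metis add.commute mult.assoc mult.commute sin_cos_eq_iff)

text \<open>
  The sines and cosines of the two angles are continuous functions that separate points.
\<close>
lemma Hausdorff_torus_top: "Hausdorff_space torus_top"
  unfolding Hausdorff_space_def
proof (intro allI impI)
  fix x y assume "x \<in> topspace torus_top \<and> y \<in> topspace torus_top \<and> x \<noteq> y"
  then obtain p p' where p: "x = tproj p" "y = tproj p'" "tproj p \<noteq> tproj p'" by auto
  have c: "continuous_map torus_top euclideanreal (\<lambda>x. sin (x 0))" "continuous_map torus_top euclideanreal (\<lambda>x. cos (x 0))"
    "continuous_map torus_top euclideanreal (\<lambda>x. sin (x (Suc 0)))" "continuous_map torus_top euclideanreal (\<lambda>x. cos (x (Suc 0)))"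
    by (intro continuous_map_torus_top; simp; intro continuous_intros)+
  have "\<exists>g :: (nat \<Rightarrow> real) \<Rightarrow> real. continuous_map torus_top euclideanreal g \<and> g x \<noteq> g y"
  proof (rule ccontr)
    assume "\<not> ?thesis"
    then have "g x = g y" if c: "continuous_map torus_top euclideanreal g" for g :: "(nat \<Rightarrow> real) \<Rightarrow> real"
      using c by blast
    from this[OF c(1)] this[OF c(2)] this[OF c(3)] this[OF c(4)]
    have "sin (fst p) = sin (fst p')" "cos (fst p) = cos (fst p')"
      "sin (snd p) = sin (snd p')" "cos (snd p) = cos (snd p')"
      unfolding p(1,2) by simp_all
    then have "mod2pi (fst p) = mod2pi (fst p')" "mod2pi (snd p) = mod2pi (snd p')"
      by (blast intro: mod2pi_inj_sin_cos)+
    then show False using p(3) by (simp add: tproj_eq_iff)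
  qed
  then obtain g :: "(nat \<Rightarrow> real) \<Rightarrow> real" where g: "continuous_map torus_top euclideanreal g" "g x \<noteq> g y" by blast
  obtain U V :: "real set" where UV: "open U" "open V" "g x \<in> U" "g y \<in> V" "U \<inter> V = {}"
    using hausdorff[OF g(2)] by blast
  let ?P = "\<lambda>U :: real set. {z \<in> topspace torus_top. g z \<in> U}"
  have "openin torus_top (?P U)" "openin torus_top (?P V)"
    using g(1) UV unfolding continuous_map by simp_all
  then show "\<exists>U V. openin torus_top U \<and> openin torus_top V \<and> x \<in> U \<and> y \<in> V \<and> disjnt U V"
    using UV p by (intro exI[of _ "?P U"] exI[of _ "?P V"]) (auto simp: disjnt_def)
qed

lemma second_countable_torus_top: "second_countable torus_top"
proof (rule second_countable_open_map_image[OF continuous_map_tproj])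
  show "open_map euclidean torus_top tproj" using openin_tproj_image by (simp add: open_map_def)
  obtain B :: "(real \<times> real) set set" where B: "countable B" "\<And>C. C \<in> B \<Longrightarrow> open C"
    "\<And>S. open S \<Longrightarrow> \<exists>U. U \<subseteq> B \<and> S = \<Union>U"
    by (rule univ_second_countable) (rule that)
  show "second_countable (euclidean :: (real \<times> real) topology)"
    unfolding second_countable_def
  proof (intro exI[of _ B] conjI ballI allI impI)
    fix U :: "(real \<times> real) set" and x assume "openin euclidean U \<and> x \<in> U"
    then have U: "open U" "x \<in> U" by simp_all
    then obtain C where "C \<subseteq> B" "U = \<Union>C" using B(3) by metis
    then show "\<exists>V\<in>B. x \<in> V \<and> V \<subseteq> U" using U(2) by auto
  qed (use B in auto)
qed simp

lemma compact_torus_top: "compact_space torus_top"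
proof -
  let ?K = "cbox (0, 0) (2 * pi, 2 * pi)"
  have "tproj p \<in> tproj ` ?K" for p
  proof (rule image_eqI)
    show "tproj p = tproj (mod2pi (fst p), mod2pi (snd p))" by (simp add: tproj_eq_iff)
    show "(mod2pi (fst p), mod2pi (snd p)) \<in> ?K" using mod2pi_bounds[of "fst p"] mod2pi_bounds[of "snd p"] by auto
  qed
  then have "tproj ` ?K = range tproj" by blast
  moreover have "compactin torus_top (tproj ` ?K)"
    by (rule image_compactin[OF _ continuous_map_tproj]) simp
  ultimately show ?thesis by (simp add: compact_space_def)
qed

text \<open>
  An open square of side \<open>2\<pi>\<close>, on which the projection to the torus is injective. Squares with
  arbitrary corners are allowed, so that they cover the plane.
\<close>
definition open_cell :: "real \<Rightarrow> real \<Rightarrow> (real \<times> real) set" where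
  "open_cell a b = {p. a < fst p \<and> fst p < a + 2 * pi \<and> b < snd p \<and> snd p < b + 2 * pi}"

text \<open>
  The inverse of the projection on \<^term>\<open>open_cell a b\<close>.
\<close>
definition torus_chart :: "real \<Rightarrow> real \<Rightarrow> (nat \<Rightarrow> real) \<Rightarrow> nat \<Rightarrow> real" where
  "torus_chart a b x = plane_pt (a + mod2pi (x 0 - a), b + mod2pi (x 1 - b))"

definition torus :: "(nat \<Rightarrow> real) mfd" where
  "torus = \<lparr>mtop = torus_top, mdim = 2, atlas = {(tproj ` open_cell a b, torus_chart a b) |a b. True}\<rparr>"

lemma torus_simps [simp]: "mtop torus = torus_top" "mdim torus = 2"
  "atlas torus = {(tproj ` open_cell a b, torus_chart a b) |a b. True}"
  by (simp_all add: torus_def)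

lemma open_open_cell: "open (open_cell a b)"
  unfolding open_cell_def by (intro open_Collect_conj open_Collect_less continuous_intros)

lemma torus_chart_tproj: "torus_chart a b (tproj p) = plane_pt (a + mod2pi (fst p - a), b + mod2pi (snd p - b))"
  by (simp add: torus_chart_def tproj_def)

lemma chart_on_cell: assumes "p \<in> open_cell a b" shows "torus_chart a b (tproj p) = plane_pt p"
proof -
  have "mod2pi (fst p - a) = fst p - a" "mod2pi (snd p - b) = snd p - b"
    by (rule mod2pi_eq; use assms in \<open>simp add: open_cell_def\<close>)+
  then show ?thesis by (simp add: torus_chart_tproj)
qed

lemma tproj_inj_on_cell: "tproj p = tproj p' \<Longrightarrow> p \<in> open_cell a b \<Longrightarrow> p' \<in> open_cell a b \<Longrightarrow> p = p'"
  using chart_on_cell injD[OF inj_plane_pt] by metis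

lemma inj_on_torus_chart: "inj_on (torus_chart a b) (tproj ` open_cell a b)"
  by (rule inj_onI) (auto simp: chart_on_cell dest!: injD[OF inj_plane_pt])

lemma inv_into_torus_chart: "p \<in> open_cell a b \<Longrightarrow> inv_into (tproj ` open_cell a b) (torus_chart a b) (plane_pt p) = tproj p"
  using inv_into_f_f[OF inj_on_torus_chart, of "tproj p" a b] by (simp add: chart_on_cell)

lemma torus_chart_image: "W \<subseteq> open_cell a b \<Longrightarrow> torus_chart a b ` tproj ` W = plane_pt ` W"
  by (force simp: image_image chart_on_cell subset_eq)

lemma chart_torus: "chart torus (tproj ` open_cell a b) (torus_chart a b)"
  unfolding chart_def
proof (intro conjI)
  show "openin (mtop torus) (tproj ` open_cell a b)" by (simp add: openin_tproj_image open_open_cell)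
  show "openin (Euclidean_space (mdim torus)) (torus_chart a b ` tproj ` open_cell a b)"
    by (simp add: torus_chart_image openin_plane_pt_image open_open_cell)
  let ?U = "tproj ` open_cell a b" and ?V = "plane_pt ` open_cell a b"
  have "homeomorphic_maps (subtopology torus_top ?U) (subtopology (Euclidean_space 2) ?V) (torus_chart a b) (\<lambda>x. tproj (x 0, x 1))"
    unfolding homeomorphic_maps_def
  proof (intro conjI ballI)
    show "continuous_map (subtopology torus_top ?U) (subtopology (Euclidean_space 2) ?V) (torus_chart a b)"
      unfolding continuous_map
    proof (intro conjI allI impI)
      show "torus_chart a b ` topspace (subtopology torus_top ?U) \<subseteq> topspace (subtopology (Euclidean_space 2) ?V)"
        by (auto simp: topspace_plane chart_on_cell)
      fix S assume "openin (subtopology (Euclidean_space 2) ?V) S"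
      then obtain R where R: "openin (Euclidean_space 2) R" "S = R \<inter> ?V" by (auto simp: openin_subtopology)
      have "open {x. plane_pt x \<in> R}"
        using R(1) homeomorphic_maps_plane_pt unfolding homeomorphic_maps_def continuous_map by simp
      then have "open (plane_pt -` R)" by (simp add: vimage_def)
      then have "openin torus_top (tproj ` (plane_pt -` R \<inter> open_cell a b))"
        by (intro openin_tproj_image open_Int open_open_cell)
      moreover have "{x \<in> topspace (subtopology torus_top ?U). torus_chart a b x \<in> S} = tproj ` (plane_pt -` R \<inter> open_cell a b) \<inter> ?U"
        unfolding R by (auto simp: chart_on_cell) (metis tproj_inj_on_cell)
      ultimately show "openin (subtopology torus_top ?U) {x \<in> topspace (subtopology torus_top ?U). torus_chart a b x \<in> S}"
        by (auto simp: openin_subtopology)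
    qed
    have "continuous_map (Euclidean_space 2) torus_top (\<lambda>x. tproj (x 0, x 1))"
      using continuous_map_compose[OF _ continuous_map_tproj, of "Euclidean_space 2" "\<lambda>x. (x 0, x 1)"]
        homeomorphic_maps_plane_pt by (simp add: homeomorphic_maps_def o_def)
    then show "continuous_map (subtopology (Euclidean_space 2) ?V) (subtopology torus_top ?U) (\<lambda>x. tproj (x 0, x 1))"
      by (auto simp: continuous_map_in_subtopology continuous_map_from_subtopology)
  qed (auto simp: chart_on_cell)
  then show "homeomorphic_map (subtopology (mtop torus) ?U)
     (subtopology (Euclidean_space (mdim torus)) (torus_chart a b ` tproj ` open_cell a b)) (torus_chart a b)"
    by (simp add: homeomorphic_maps_imp_map torus_chart_image)
qed

text \<open>
  Away from its jumps the reduction is locally a translation; the transition maps between charts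
  inherit this.
\<close>
lemma smooth_mod2pi:
  fixes l :: "real \<times> real \<Rightarrow> real"
  assumes l: "l = fst \<or> l = snd"
  shows "smooth2_on {p. mod2pi (l p - a) \<noteq> 0} (\<lambda>x y. mod2pi (l (x, y) - a))"
proof -
  let ?W = "{p. mod2pi (l p - a) \<noteq> 0}"
  let ?k = "\<lambda>x. \<lfloor>(x - a) / (2 * pi)\<rfloor>"
  let ?V = "\<lambda>k::int. {p. a + 2 * pi * of_int k < l p \<and> l p < a + 2 * pi * (of_int k + 1)}"
  have lc: "continuous_on UNIV l" using l by (auto intro: continuous_on_fst continuous_on_snd)
  have ls: "smooth2_on S (\<lambda>x y. l (x, y))" for S using l by auto
  have V: "open (?V k)" for k
    by (intro open_Collect_conj open_Collect_less lc continuous_on_const)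
  have in_V: "p \<in> ?V (?k (l p))" if "p \<in> ?W" for p
    using that mod2pi_bounds[of "l p - a"] by (auto simp: mod2pi_def algebra_simps)
  have mod2pi_V: "mod2pi (l p - a) = l p - a - 2 * pi * of_int k" "mod2pi (l p - a) \<noteq> 0" if "p \<in> ?V k" for p k
  proof -
    have "mod2pi ((l p - a - 2 * pi * of_int k) + 2 * pi * of_int k) = l p - a - 2 * pi * of_int k"
      unfolding mod2pi_shift using that by (intro mod2pi_eq) (auto simp: algebra_simps)
    then show "mod2pi (l p - a) = l p - a - 2 * pi * of_int k" by simp
    with that show "mod2pi (l p - a) \<noteq> 0" by simp
  qed
  have "?W = (\<Union>k. ?V k)"
  proof (intro equalityI subsetI)
    fix p assume "p \<in> ?W" then show "p \<in> (\<Union>k. ?V k)" using in_V by blast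
  next
    fix p assume "p \<in> (\<Union>k. ?V k)"
    then obtain k where "p \<in> ?V k" by blast
    then show "p \<in> ?W" using mod2pi_V(2) by blast
  qed
  moreover have "open (\<Union>k. ?V k)" by (intro open_UN ballI V)
  ultimately have W: "open ?W" by simp
  show "smooth2_on ?W (\<lambda>x y. mod2pi (l (x, y) - a))"
  proof (rule smooth2_on_local[OF W])
    fix p assume p: "p \<in> ?W"
    let ?F = "\<lambda>x y. l (x, y) - a - 2 * pi * of_int (?k (l p))"
    have "smooth2_on (?V (?k (l p))) ?F"
      by (intro smooth2_on_diff smooth2_on_const ls)
    moreover have "\<forall>(x, y)\<in>?V (?k (l p)). mod2pi (l (x, y) - a) = ?F x y" using mod2pi_V(1) by blast
    ultimately show "\<exists>V F'. open V \<and> p \<in> V \<and> smooth2_on V F' \<and> (\<forall>(x, y)\<in>V. mod2pi (l (x, y) - a) = F' x y)"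
      using in_V[OF p] V by (intro exI[of _ "?V (?k (l p))"] exI[of _ ?F]) blast
  qed
qed

lemma smooth_transition:
  assumes "i < 2"
  shows "Cinf_on 2 (torus_chart a b ` (tproj ` open_cell a b \<inter> tproj ` open_cell a' b'))
    (\<lambda>y. torus_chart a' b' (inv_into (tproj ` open_cell a b) (torus_chart a b) y) i)"
proof -
  let ?W = "open_cell a b \<inter> tproj -` (tproj ` open_cell a' b')"
  have W: "open ?W"
    using openin_tproj_image[OF open_open_cell] by (intro open_Int open_open_cell) (simp add: openin_torus_top)
  have "tproj ` open_cell a b \<inter> tproj ` open_cell a' b' = tproj ` ?W" by auto
  then have im: "torus_chart a b ` (tproj ` open_cell a b \<inter> tproj ` open_cell a' b') = plane_pt ` ?W"
    using torus_chart_image[of ?W a b] by simp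
  have nz: "mod2pi (fst p - a') \<noteq> 0 \<and> mod2pi (snd p - b') \<noteq> 0" if "p \<in> ?W" for p
  proof -
    obtain p' where p': "p' \<in> open_cell a' b'" "tproj p = tproj p'" using \<open>p \<in> ?W\<close> by auto
    then have "mod2pi (fst p - a') = mod2pi (fst p' - a')" "mod2pi (snd p - b') = mod2pi (snd p' - b')"
      by (metis tproj_eq_iff mod2pi_mod2pi_diff)+
    moreover have "mod2pi (fst p' - a') = fst p' - a'" "mod2pi (snd p' - b') = snd p' - b'"
      using p'(1) by (auto simp: open_cell_def intro!: mod2pi_eq)
    ultimately show ?thesis using p'(1) by (auto simp: open_cell_def)
  qed
  have "smooth2_on ?W (\<lambda>x y. torus_chart a' b' (tproj (x, y)) i)"
  proof (cases "i = 0")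
    case True
    have "smooth2_on ?W (\<lambda>x y. a' + mod2pi (x - a'))"
      by (intro smooth2_on_intros smooth2_on_subset[OF smooth_mod2pi[of fst, simplified]]) (use nz in auto)
    then show ?thesis by (simp add: True torus_chart_tproj)
  next
    case False
    have "smooth2_on ?W (\<lambda>x y. b' + mod2pi (y - b'))"
      by (intro smooth2_on_intros smooth2_on_subset[OF smooth_mod2pi[of snd, simplified]]) (use nz in auto)
    moreover have "i = Suc 0" using False assms by simp
    ultimately show ?thesis by (simp add: torus_chart_tproj)
  qed
  then have "smooth2_on ?W (\<lambda>x y. torus_chart a' b' (inv_into (tproj ` open_cell a b) (torus_chart a b) (plane_pt (x, y))) i)"
    by (rule smooth2_on_cong[OF _ W]) (simp add: inv_into_torus_chart)
  then show ?thesis unfolding im Cinf_on_plane_pt_image[OF W] .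
qed

lemma in_open_cell: "\<exists>a b. p \<in> open_cell a b"
  by (rule exI[of _ "fst p - pi"], rule exI[of _ "snd p - pi"]) (simp add: open_cell_def)

lemma atlas_torus_Ball: "(\<forall>(U, c)\<in>atlas torus. P U c) \<longleftrightarrow> (\<forall>a b. P (tproj ` open_cell a b) (torus_chart a b))"
  unfolding torus_simps by blast

lemma smooth_manifold_torus: "smooth_manifold torus"
  unfolding smooth_manifold_def atlas_torus_Ball
proof (intro conjI allI impI)
  have "(\<Union>(U, c)\<in>atlas torus. U) = (\<Union>a b. tproj ` open_cell a b)"
    unfolding torus_simps by blast
  also have "\<dots> = range tproj"
  proof (intro equalityI subsetI)
    fix x assume "x \<in> range tproj"
    then obtain p where "x = tproj p" by blast
    moreover obtain a b where "p \<in> open_cell a b" using in_open_cell by blast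
    ultimately show "x \<in> (\<Union>a b. tproj ` open_cell a b)" by blast
  qed blast
  finally show "(\<Union>(U, c)\<in>atlas torus. U) = points torus" by simp
  show "Hausdorff_space (mtop torus)" "second_countable (mtop torus)"
    by (simp_all add: Hausdorff_torus_top second_countable_torus_top)
  show "chart torus (tproj ` open_cell a b) (torus_chart a b)" for a b by (rule chart_torus)
  show "Cinf_on (mdim torus) (torus_chart a b ` (tproj ` open_cell a b \<inter> tproj ` open_cell a' b'))
    (\<lambda>y. torus_chart a' b' (inv_into (tproj ` open_cell a b) (torus_chart a b) y) i)" if "i < mdim torus" for a b a' b' i
    using smooth_transition that by simp
qed

lemma closed_manifold_torus: "closed_manifold torus"
  by (simp add: closed_manifold_def smooth_manifold_torus compact_torus_top)

text \<open>
  Smoothness on the torus is smoothness of the lift to the plane, because squares cover the plane and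
  smoothness is local.
\<close>
lemma smooth_fun_torus: "smooth_fun torus f \<longleftrightarrow> smooth2 (\<lambda>x y. f (tproj (x, y)))"
proof -
  have *: "Cinf_on 2 (torus_chart a b ` tproj ` open_cell a b) (\<lambda>y. f (inv_into (tproj ` open_cell a b) (torus_chart a b) y)) \<longleftrightarrow>
      smooth2_on (open_cell a b) (\<lambda>x y. f (tproj (x, y)))" for a b
    unfolding torus_chart_image[OF order_refl] Cinf_on_plane_pt_image[OF open_open_cell]
    by (rule iffI; erule smooth2_on_cong[OF _ open_open_cell]; simp add: inv_into_torus_chart)
  have "smooth_fun torus f \<longleftrightarrow> (\<forall>a b. smooth2_on (open_cell a b) (\<lambda>x y. f (tproj (x, y))))"
    unfolding smooth_fun_def atlas_torus_Ball torus_simps(2) * ..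
  also have "\<dots> \<longleftrightarrow> smooth2 (\<lambda>x y. f (tproj (x, y)))"
  proof
    assume s: "\<forall>a b. smooth2_on (open_cell a b) (\<lambda>x y. f (tproj (x, y)))"
    show "smooth2 (\<lambda>x y. f (tproj (x, y)))"
    proof (rule smooth2_on_local)
      fix p :: "real \<times> real"
      obtain a b where "p \<in> open_cell a b" using in_open_cell by blast
      then show "\<exists>V F'. open V \<and> p \<in> V \<and> smooth2_on V F' \<and> (\<forall>(x, y)\<in>V. f (tproj (x, y)) = F' x y)"
        using s open_open_cell by (intro exI[of _ "open_cell a b"] exI[of _ "\<lambda>x y. f (tproj (x, y))"]) auto
    qed simp
  qed (blast intro: smooth2_on_subset)
  finally show ?thesis .
qed

section \<open>Derivations and forms on the torus\<close>

abbreviation sin_coord :: "nat \<Rightarrow> (nat \<Rightarrow> real) \<Rightarrow> real" where "sin_coord i \<equiv> \<lambda>x. sin (x i)"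
abbreviation cos_coord :: "nat \<Rightarrow> (nat \<Rightarrow> real) \<Rightarrow> real" where "cos_coord i \<equiv> \<lambda>x. cos (x i)"

text \<open>
  The differential of the \<open>i\<close>-th angle, which is not a function on the torus, written through its
  sine and cosine.
\<close>
definition angle_form :: "nat \<Rightarrow> (nat \<Rightarrow> real) form1" where
  "angle_form i p v = cos (p i) * v (sin_coord i) - sin (p i) * v (cos_coord i)"

definition area_form :: "(nat \<Rightarrow> real) form2" where
  "area_form p v w = angle_form 0 p v * angle_form 1 p w - angle_form 1 p v * angle_form 0 p w"

abbreviation torus_smooth :: "((nat \<Rightarrow> real) \<Rightarrow> real) \<Rightarrow> bool" where "torus_smooth \<equiv> smooth_fun torus"
abbreviation torus_tangent :: "(nat \<Rightarrow> real) \<Rightarrow> (nat \<Rightarrow> real) tvec set" where "torus_tangent \<equiv> tangent_space torus"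

lemma torus_smooth_intros:
  "torus_smooth f \<Longrightarrow> torus_smooth g \<Longrightarrow> torus_smooth (\<lambda>x. f x + g x)"
  "torus_smooth f \<Longrightarrow> torus_smooth g \<Longrightarrow> torus_smooth (\<lambda>x. f x * g x)"
  "torus_smooth f \<Longrightarrow> torus_smooth g \<Longrightarrow> torus_smooth (\<lambda>x. f x - g x)"
  "torus_smooth (\<lambda>x. c)"
  by (simp_all add: smooth_fun_torus smooth2_on_intros)

lemma torus_smooth_trig: "i < 2 \<Longrightarrow> torus_smooth (sin_coord i)" "i < 2 \<Longrightarrow> torus_smooth (cos_coord i)"
  unfolding less_2_cases_iff by (elim disjE; simp add: smooth_fun_torus smooth2_on_intros)+

definition biperiodic :: "(real \<Rightarrow> real \<Rightarrow> real) \<Rightarrow> bool" where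
  "biperiodic F \<longleftrightarrow> (\<forall>y. periodic (\<lambda>x. F x y)) \<and> (\<forall>x. periodic (F x))"

lemma biperiodic_mod2pi: "biperiodic F \<Longrightarrow> F (mod2pi x) (mod2pi y) = F x y"
  unfolding biperiodic_def using periodic_mod2pi[of "F (mod2pi x)" y] periodic_mod2pi[of "\<lambda>x. F x y" x] by simp

lemma tproj_coords [simp]: "tproj p 0 = mod2pi (fst p)" "tproj p (Suc 0) = mod2pi (snd p)"
  by (simp_all add: tproj_def)

lemma torus_smooth_of_biperiodic: "biperiodic F \<Longrightarrow> smooth2 F \<Longrightarrow> torus_smooth (\<lambda>x. F (x 0) (x 1))"
  by (simp add: smooth_fun_torus biperiodic_mod2pi)

lemma biperiodic_lift: "biperiodic (\<lambda>x y. f (tproj (x, y)))"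
proof -
  have "mod2pi (x + 2 * pi) = mod2pi x" for x using mod2pi_shift[of x 1] by simp
  then show ?thesis by (simp add: biperiodic_def periodic_def tproj_def)
qed

lemma tproj_point: "p \<in> range tproj \<Longrightarrow> tproj (p 0, p 1) = p"
  by (auto simp: tproj_def)

context
  fixes p v assumes v: "v \<in> torus_tangent p"
begin

lemma torus_tangent_add: "torus_smooth f \<Longrightarrow> torus_smooth g \<Longrightarrow> v (\<lambda>x. f x + g x) = v f + v g"
  and torus_tangent_cmult: "torus_smooth f \<Longrightarrow> v (\<lambda>x. a * f x) = a * v f"
  and torus_tangent_mult: "torus_smooth f \<Longrightarrow> torus_smooth g \<Longrightarrow> v (\<lambda>x. f x * g x) = f p * v g + g p * v f"
  and torus_tangent_nonsmooth: "\<not> torus_smooth f \<Longrightarrow> v f = 0"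
  using v unfolding tangent_space_def by blast+

lemma torus_tangent_const: "v (\<lambda>x. c) = 0"
proof -
  have "v (\<lambda>x. 1 * 1) = 1 * v (\<lambda>x. 1) + 1 * v (\<lambda>x. 1)"
    by (rule torus_tangent_mult) (simp_all add: torus_smooth_intros)
  then have "v (\<lambda>x. 1) = 0" by simp
  then show ?thesis using torus_tangent_cmult[of "\<lambda>x. 1" c] by (simp add: torus_smooth_intros)
qed

lemma torus_tangent_diff: "torus_smooth f \<Longrightarrow> torus_smooth g \<Longrightarrow> v (\<lambda>x. f x - g x) = v f - v g"
  using torus_tangent_add[of f "\<lambda>x. (- 1) * g x"] torus_tangent_cmult[of g "- 1"] torus_smooth_intros(2)[OF torus_smooth_intros(4)[of "-1"], of g]
  by simp

text \<open>
  Deriving \<open>sin\<^sup>2 + cos\<^sup>2 = 1\<close> shows that \<open>(v sin, v cos)\<close> is orthogonal to \<open>(sin, cos)\<close>, hence a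
  multiple of \<open>(cos, - sin)\<close>.
\<close>
lemma torus_tangent_trig:
  assumes i: "i < 2"
  shows "v (sin_coord i) = cos (p i) * angle_form i p v" "v (cos_coord i) = - sin (p i) * angle_form i p v"
proof -
  note s = torus_smooth_trig[OF i]
  have "v (\<lambda>x. sin (x i) * sin (x i) + cos (x i) * cos (x i)) =
      2 * (sin (p i) * v (sin_coord i) + cos (p i) * v (cos_coord i))"
    by (subst torus_tangent_add) (simp_all add: torus_smooth_intros s torus_tangent_mult)
  moreover have "(\<lambda>x::nat \<Rightarrow> real. sin (x i) * sin (x i) + cos (x i) * cos (x i)) = (\<lambda>x. 1)"
    by (simp flip: power2_eq_square)
  ultimately have 0: "sin (p i) * v (sin_coord i) + cos (p i) * v (cos_coord i) = 0"
    using torus_tangent_const[of 1] by simp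
  have 1: "sin (p i) * sin (p i) = 1 - cos (p i) * cos (p i)"
    using sin_cos_squared_add[of "p i"] by (simp add: power2_eq_square)
  have "cos (p i) * angle_form i p v = v (sin_coord i) - sin (p i) * (sin (p i) * v (sin_coord i) + cos (p i) * v (cos_coord i))"
    unfolding angle_form_def using 1 by algebra
  then show "v (sin_coord i) = cos (p i) * angle_form i p v" unfolding 0 by simp
  have "- sin (p i) * angle_form i p v = v (cos_coord i) - cos (p i) * (sin (p i) * v (sin_coord i) + cos (p i) * v (cos_coord i))"
    unfolding angle_form_def using 1 by algebra
  then show "v (cos_coord i) = - sin (p i) * angle_form i p v" unfolding 0 by simp
qed

text \<open>
  Derivations act on functions defined on the whole type, but see only the values on the torus.
\<close>
lemma torus_tangent_cong:
  assumes p: "p \<in> range tproj" and f: "torus_smooth f" "torus_smooth g" and eq: "\<And>z. f (tproj z) = g (tproj z)"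
  shows "v f = v g"
proof -
  \<comment> \<open>The difference equals its product with the indicator of the complement of the torus, and both
    factors vanish at \<open>p\<close>.\<close>
  let ?d = "\<lambda>x. f x - g x" and ?e = "\<lambda>x. if x \<in> range tproj then 0 else 1"
  have d: "torus_smooth ?d" and e: "torus_smooth ?e" by (simp_all add: torus_smooth_intros f) (simp add: smooth_fun_torus)
  have "?d = (\<lambda>x. ?d x * ?e x)"
  proof
    fix x show "?d x = ?d x * ?e x"
    proof (cases "x \<in> range tproj")
      case True
      then obtain z where "x = tproj z" by blast
      then show ?thesis using eq[of z] by simp
    qed simp
  qed
  then have "v ?d = v (\<lambda>x. ?d x * ?e x)" by (rule arg_cong)
  also have "\<dots> = ?d p * v ?e + ?e p * v ?d" by (rule torus_tangent_mult[OF d e])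
  also have "\<dots> = 0" using p eq by auto
  finally show ?thesis using torus_tangent_diff[OF f] by simp
qed

text \<open>
  Apply \<open>v\<close> to the equation: at \<open>p\<close> the factors \<open>f\<close> and \<open>sin (x i - p i)\<close> vanish and
  \<open>1 + cos (x i - p i) = 2\<close>.
\<close>
lemma torus_tangent_step:
  assumes i: "i < 2" and p: "p \<in> range tproj" and s: "torus_smooth f" "torus_smooth g" "f p = 0"
    and eq: "\<And>x. f x * (1 + cos (x i - p i)) = g x * sin (x i - p i)"
  shows "v f = g p / 2 * angle_form i p v"
proof -
  note t = torus_smooth_trig[OF i]
  let ?u = "\<lambda>x. cos (p i) * cos (x i) + sin (p i) * sin (x i)"
  let ?w = "\<lambda>x. cos (p i) * sin (x i) - sin (p i) * cos (x i)"
  have sm: "torus_smooth (\<lambda>x. 1 + ?u x)" "torus_smooth ?w" by (intro torus_smooth_intros t)+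
  have "(\<lambda>x. f x * (1 + ?u x)) = (\<lambda>x. g x * ?w x)"
    using eq by (simp add: cos_diff sin_diff mult.commute)
  then have "v (\<lambda>x. f x * (1 + ?u x)) = v (\<lambda>x. g x * ?w x)" by (rule arg_cong)
  also have "v (\<lambda>x. f x * (1 + ?u x)) = 2 * v f"
    using torus_tangent_mult[OF s(1) sm(1)] s(3) sin_cos_squared_add[of "p i"] by (simp add: power2_eq_square)
  also have "v (\<lambda>x. g x * ?w x) = g p * v ?w"
    using torus_tangent_mult[OF s(2) sm(2)] by simp
  also have "v ?w = angle_form i p v"
    unfolding angle_form_def by (simp add: torus_tangent_diff torus_tangent_cmult torus_smooth_intros t)
  finally show ?thesis by simp
qed

end

text \<open>
  Splits \<open>f(x, y) - f(a, b)\<close> into \<open>(f(x, y) - f(a, y)) + (f(a, y) - f(a, b))\<close> and applies the periodic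
  Hadamard lemma to each part. The
  coefficients are half the values at \<open>p\<close> of the two quotients.
\<close>
lemma derivation_two_coefficients:
  assumes p: "p \<in> range tproj" and f: "torus_smooth f"
  obtains A B where "\<And>v. v \<in> torus_tangent p \<Longrightarrow> v f = A * angle_form 0 p v + B * angle_form 1 p v"
proof -
  let ?F = "\<lambda>x y. f (tproj (x, y))" and ?a = "p 0" and ?b = "p 1"
  have F: "smooth2 ?F" "biperiodic ?F" using f biperiodic_lift by (simp_all add: smooth_fun_torus)
  obtain G where G: "smooth2 G" "\<And>y. periodic (\<lambda>x. G x y)" "\<And>x. periodic (G x)"
    "\<And>x y. (?F x y - ?F ?a y) * (1 + cos (x - ?a)) = G x y * sin (x - ?a)"
    by (rule hadamard_circle[OF F(1), of ?a]) (use F(2) that in \<open>auto simp: biperiodic_def\<close>)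
  \<comment> \<open>The remaining variable is moved to the first place.\<close>
  let ?E = "\<lambda>x y::real. ?F ?a x"
  have E: "smooth2 ?E" using smooth1_section[OF F(1), of ?a] by (simp add: smooth1_def)
  obtain K where K: "smooth2 K" "\<And>y. periodic (\<lambda>x. K x y)" "\<And>x. periodic (K x)"
    "\<And>x y. (?E x y - ?E ?b y) * (1 + cos (x - ?b)) = K x y * sin (x - ?b)"
    by (rule hadamard_circle[OF E, of ?b]) (use F(2) that in \<open>auto simp: biperiodic_def periodic_def\<close>)
  let ?f0 = "\<lambda>x. ?F (x 0) (x 1)" and ?f1 = "\<lambda>x. ?F ?a (x 1)"
  let ?g0 = "\<lambda>x::nat \<Rightarrow> real. G (x 0) (x 1)" and ?g1 = "\<lambda>x::nat \<Rightarrow> real. K (x 1) 0"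
  have s: "torus_smooth ?f0" "torus_smooth ?f1" "torus_smooth ?g0" "torus_smooth ?g1"
  proof -
    show "torus_smooth ?f0" by (rule torus_smooth_of_biperiodic) (rule F)+
    show "torus_smooth ?f1" by (rule torus_smooth_of_biperiodic[of "\<lambda>x y. ?F ?a y"])
      (use F smooth2_fix_fst[OF F(1), of ?a] in \<open>auto simp: biperiodic_def periodic_def\<close>)
    show "torus_smooth ?g0" by (rule torus_smooth_of_biperiodic) (use G in \<open>auto simp: biperiodic_def\<close>)
    show "torus_smooth ?g1" by (rule torus_smooth_of_biperiodic[of "\<lambda>x y. K y 0"])
      (use K smooth2_swap[OF smooth2_fix_snd[OF K(1), of 0]] in \<open>auto simp: biperiodic_def periodic_def\<close>)
  qed
  have "v f = (?g0 p / 2) * angle_form 0 p v + (?g1 p / 2) * angle_form 1 p v" if v: "v \<in> torus_tangent p" for v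
  proof -
    have "v f = v ?f0"
      by (rule torus_tangent_cong[OF v p f s(1)]) (simp add: tproj_eq_iff tproj_def)
    also have "\<dots> = v (\<lambda>x. ?f0 x - ?f1 x) + v (\<lambda>x. ?f1 x - ?F ?a ?b)"
      using torus_tangent_diff[OF v s(1,2)] torus_tangent_diff[OF v s(2) torus_smooth_intros(4)[of "?F ?a ?b"]] torus_tangent_const[OF v] by simp
    also have "v (\<lambda>x. ?f0 x - ?f1 x) = ?g0 p / 2 * angle_form 0 p v"
      by (rule torus_tangent_step[OF v _ p]) (use G(4) in \<open>auto intro: torus_smooth_intros s[unfolded One_nat_def]\<close>)
    also have "v (\<lambda>x. ?f1 x - ?F ?a ?b) = ?g1 p / 2 * angle_form 1 p v"
      by (rule torus_tangent_step[OF v _ p]) (use K(4)[of _ 0] in \<open>auto intro: torus_smooth_intros s[unfolded One_nat_def]\<close>)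
    finally show ?thesis .
  qed
  then show ?thesis by (rule that)
qed

text \<open>
  The vector \<open>a \<partial>\<^sub>\<theta> + b \<partial>\<^sub>y\<close>.
\<close>
definition coord_vector :: "real \<Rightarrow> real \<Rightarrow> (nat \<Rightarrow> real) \<Rightarrow> (nat \<Rightarrow> real) tvec" where
  "coord_vector a b p f = (if torus_smooth f then a * deriv (\<lambda>t. f (tproj (t, p 1))) (p 0) + b * deriv (\<lambda>t. f (tproj (p 0, t))) (p 1) else 0)"

lemma coord_vector_eq:
  assumes "torus_smooth f" "partials_on UNIV (\<lambda>x y. f (tproj (x, y))) F1 F2"
  shows "coord_vector a b p f = a * F1 (p 0) (p 1) + b * F2 (p 0) (p 1)"
proof -
  have "deriv (\<lambda>t. f (tproj (t, p 1))) (p 0) = F1 (p 0) (p 1)" "deriv (\<lambda>t. f (tproj (p 0, t))) (p 1) = F2 (p 0) (p 1)"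
    by (rule DERIV_imp_deriv, use assms(2) in \<open>simp add: partials_on_def\<close>)+
  then show ?thesis using assms(1) by (simp add: coord_vector_def)
qed

lemma torus_smooth_partials:
  assumes "torus_smooth f"
  obtains F1 F2 where "smooth2 F1" "smooth2 F2" "partials_on UNIV (\<lambda>x y. f (tproj (x, y))) F1 F2"
  using assms unfolding smooth_fun_torus by (rule smooth2_on_partials)

lemma coord_vector_torus_tangent:
  assumes p: "p \<in> range tproj"
  shows "coord_vector a b p \<in> torus_tangent p"
  unfolding tangent_space_def
proof (intro CollectI conjI allI impI)
  show "coord_vector a b p f = 0" if "\<not> torus_smooth f" for f using that by (simp add: coord_vector_def)
  fix f g assume f: "torus_smooth f" and g: "torus_smooth g"
  obtain F1 F2 where F: "partials_on UNIV (\<lambda>x y. f (tproj (x, y))) F1 F2" using f by (rule torus_smooth_partials)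
  obtain G1 G2 where G: "partials_on UNIV (\<lambda>x y. g (tproj (x, y))) G1 G2" using g by (rule torus_smooth_partials)
  have "partials_on UNIV (\<lambda>x y. f (tproj (x, y)) + g (tproj (x, y))) (\<lambda>x y. F1 x y + G1 x y) (\<lambda>x y. F2 x y + G2 x y)"
    using F G unfolding partials_on_def by (auto intro!: DERIV_add)
  from coord_vector_eq[OF torus_smooth_intros(1)[OF f g] this]
  show "coord_vector a b p (\<lambda>x. f x + g x) = coord_vector a b p f + coord_vector a b p g"
    by (simp add: coord_vector_eq[OF f F] coord_vector_eq[OF g G] algebra_simps)
  have "partials_on UNIV (\<lambda>x y. f (tproj (x, y)) * g (tproj (x, y)))
    (\<lambda>x y. f (tproj (x, y)) * G1 x y + F1 x y * g (tproj (x, y))) (\<lambda>x y. f (tproj (x, y)) * G2 x y + F2 x y * g (tproj (x, y)))"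
    using F G unfolding partials_on_def by (auto intro!: DERIV_mult')
  from coord_vector_eq[OF torus_smooth_intros(2)[OF f g] this]
  show "coord_vector a b p (\<lambda>x. f x * g x) = f p * coord_vector a b p g + g p * coord_vector a b p f"
    using tproj_point[OF p] by (simp add: coord_vector_eq[OF f F] coord_vector_eq[OF g G] algebra_simps)
next
  fix c f assume f: "torus_smooth f"
  obtain F1 F2 where F: "partials_on UNIV (\<lambda>x y. f (tproj (x, y))) F1 F2" using f by (rule torus_smooth_partials)
  have "partials_on UNIV (\<lambda>x y. c * f (tproj (x, y))) (\<lambda>x y. c * F1 x y) (\<lambda>x y. c * F2 x y)"
    using F unfolding partials_on_def by (auto intro!: DERIV_cmult)
  from coord_vector_eq[OF torus_smooth_intros(2)[OF torus_smooth_intros(4) f] this]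
  show "coord_vector a b p (\<lambda>x. c * f x) = c * coord_vector a b p f"
    by (simp add: coord_vector_eq[OF f F] algebra_simps)
qed

lemma angle_form_coord_vector: "angle_form 0 p (coord_vector a b p) = a" "angle_form (Suc 0) p (coord_vector a b p) = b"
proof -
  have "partials_on UNIV (\<lambda>x y. sin (tproj (x, y) 0)) (\<lambda>x y. cos x) (\<lambda>x y. 0)"
    "partials_on UNIV (\<lambda>x y. cos (tproj (x, y) 0)) (\<lambda>x y. - sin x) (\<lambda>x y. 0)"
    "partials_on UNIV (\<lambda>x y. sin (tproj (x, y) (Suc 0))) (\<lambda>x y. 0) (\<lambda>x y. cos y)"
    "partials_on UNIV (\<lambda>x y. cos (tproj (x, y) (Suc 0))) (\<lambda>x y. 0) (\<lambda>x y. - sin y)"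
    unfolding cos_sin_tproj by (auto simp: partials_on_def intro!: derivative_eq_intros)
  note l = coord_vector_eq[OF _ this(1)] coord_vector_eq[OF _ this(2)] coord_vector_eq[OF _ this(3)] coord_vector_eq[OF _ this(4)]
  have "angle_form 0 p (coord_vector a b p) = cos (p 0) * (a * cos (p 0)) - sin (p 0) * (a * - sin (p 0))"
    unfolding angle_form_def by (simp add: l torus_smooth_trig)
  also have "\<dots> = a" using sin_cos_squared_add[of "p 0"] by algebra
  finally show "angle_form 0 p (coord_vector a b p) = a" .
  have "angle_form (Suc 0) p (coord_vector a b p) = cos (p 1) * (b * cos (p 1)) - sin (p 1) * (b * - sin (p 1))"
    unfolding angle_form_def by (simp add: l torus_smooth_trig)
  also have "\<dots> = b" using sin_cos_squared_add[of "p 1"] by algebra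
  finally show "angle_form (Suc 0) p (coord_vector a b p) = b" .
qed

text \<open>
  The two coefficients are found by evaluating at the coordinate vectors.
\<close>
lemma gradient:
  assumes p: "p \<in> range tproj" and f: "torus_smooth f" and v: "v \<in> torus_tangent p"
    and F: "partials_on UNIV (\<lambda>x y. f (tproj (x, y))) F1 F2"
  shows "v f = F1 (p 0) (p 1) * angle_form 0 p v + F2 (p 0) (p 1) * angle_form 1 p v"
proof -
  obtain A B where AB: "\<And>v. v \<in> torus_tangent p \<Longrightarrow> v f = A * angle_form 0 p v + B * angle_form 1 p v"
    by (rule derivation_two_coefficients[OF p f]) (rule that)
  have "A = F1 (p 0) (p 1)" "B = F2 (p 0) (p 1)"
    using AB[OF coord_vector_torus_tangent[OF p, of 1 0]] AB[OF coord_vector_torus_tangent[OF p, of 0 1]]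
    by (simp_all add: angle_form_coord_vector coord_vector_eq[OF f F])
  then show ?thesis using AB[OF v] by simp
qed

lemma angle_form_linear: "linear_on_tangent torus p (angle_form i p)"
  by (simp add: linear_on_tangent_def angle_form_def algebra_simps)

lemma angle_form_smooth:
  assumes "i < 2" "vector_field torus X"
  shows "torus_smooth (\<lambda>p. angle_form i p (X p))"
  unfolding angle_form_def using assms torus_smooth_trig[OF assms(1)]
  by (intro torus_smooth_intros) (auto simp: vector_field_def)

lemma vector_field_torus_tangent: "vector_field torus X \<Longrightarrow> p \<in> range tproj \<Longrightarrow> X p \<in> torus_tangent p"
  unfolding vector_field_def torus_simps topspace_torus_top by blast

text \<open>
  This is closedness of the angle forms. By the Leibniz rule the two sides differ by
  \<open>2 (X cos \<cdot> Y sin - X sin \<cdot> Y cos)\<close>, which is zero because \<open>(X sin, X cos)\<close> and \<open>(Y sin, Y cos)\<close> are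
  proportional.
\<close>
lemma angle_form_bracket:
  assumes i: "i < 2" and X: "vector_field torus X" and Y: "vector_field torus Y" and p: "p \<in> range tproj"
  shows "angle_form i p (bracket X Y p) = X p (\<lambda>r. angle_form i r (Y r)) - Y p (\<lambda>r. angle_form i r (X r))"
proof -
  note t = torus_smooth_trig[OF i]
  have s: "torus_smooth (\<lambda>r. X r f)" "torus_smooth (\<lambda>r. Y r f)" if "torus_smooth f" for f
    using X Y that by (auto simp: vector_field_def)
  have *: "V p (\<lambda>r. angle_form i r (W r)) =
      cos (p i) * V p (\<lambda>r. W r (sin_coord i)) - sin (p i) * V p (\<lambda>r. W r (cos_coord i))
      + (W p (sin_coord i) * V p (cos_coord i) - W p (cos_coord i) * V p (sin_coord i))"
    if V: "V p \<in> torus_tangent p" and W: "\<And>f. torus_smooth f \<Longrightarrow> torus_smooth (\<lambda>r. W r f)" for V W :: "(nat \<Rightarrow> real) \<Rightarrow> (nat \<Rightarrow> real) tvec"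
    unfolding angle_form_def
    by (subst torus_tangent_diff[OF V]) (simp_all add: torus_tangent_mult[OF V] torus_smooth_intros t W algebra_simps)
  have tX: "X p \<in> torus_tangent p" and tY: "Y p \<in> torus_tangent p" using vector_field_torus_tangent X Y p by blast+
  have X': "X p (\<lambda>r. angle_form i r (Y r)) =
      cos (p i) * X p (\<lambda>r. Y r (sin_coord i)) - sin (p i) * X p (\<lambda>r. Y r (cos_coord i))"
    by (subst *[where V = X and W = Y, OF tX s(2)]) (simp_all add: torus_tangent_trig[OF tX i] torus_tangent_trig[OF tY i])
  have Y': "Y p (\<lambda>r. angle_form i r (X r)) =
      cos (p i) * Y p (\<lambda>r. X r (sin_coord i)) - sin (p i) * Y p (\<lambda>r. X r (cos_coord i))"
    by (subst *[where V = Y and W = X, OF tY s(1)]) (simp_all add: torus_tangent_trig[OF tX i] torus_tangent_trig[OF tY i])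
  show ?thesis unfolding X' Y' by (simp add: angle_form_def bracket_def algebra_simps)
qed

text \<open>
  The area form is a product of two closed 1-forms, so it is closed; the wedge product with
  \<open>angle_form 0\<close> vanishes because this is one of its two factors.
\<close>
lemma conformal_symplectic_torus: "conformal_symplectic_manifold torus (angle_form 0) area_form"
  unfolding conformal_symplectic_manifold_def
proof (intro conjI allI impI ballI)
  show "smooth_manifold torus" by (rule smooth_manifold_torus)
  show "even (mdim torus)" by simp
  show "smooth_form1 torus (angle_form 0)"
    by (simp add: smooth_form1_def angle_form_linear angle_form_smooth)
  show "closed_form1 torus (angle_form 0)"
    by (simp add: closed_form1_def ext_d1_def angle_form_bracket)
  have "linear_on_tangent torus p (area_form p v)" "linear_on_tangent torus p (\<lambda>w. area_form p w v)" for p v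
    by (simp_all add: linear_on_tangent_def area_form_def angle_form_def algebra_simps)
  moreover have "torus_smooth (\<lambda>p. area_form p (X p) (Y p))" if "vector_field torus X" "vector_field torus Y" for X Y
    unfolding area_form_def using that by (intro torus_smooth_intros angle_form_smooth) auto
  ultimately show "smooth_form2 torus area_form"
    by (simp add: smooth_form2_def area_form_def)
  show "nondegenerate torus area_form"
    unfolding nondegenerate_def
  proof (intro ballI impI)
    fix p v assume p: "p \<in> points torus" and v: "v \<in> torus_tangent p" and 0: "\<forall>w\<in>torus_tangent p. area_form p v w = 0"
    then have p: "p \<in> range tproj" by simp
    have "area_form p v (coord_vector 1 0 p) = 0" "area_form p v (coord_vector 0 1 p) = 0" using 0 coord_vector_torus_tangent[OF p] by blast+
    then have d: "angle_form 0 p v = 0" "angle_form 1 p v = 0" by (simp_all add: area_form_def angle_form_coord_vector)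
    show "v = (\<lambda>f. 0)"
    proof
      fix f show "v f = 0"
      proof (cases "torus_smooth f")
        case True
        obtain A B where AB: "\<And>v. v \<in> torus_tangent p \<Longrightarrow> v f = A * angle_form 0 p v + B * angle_form 1 p v"
          by (rule derivation_two_coefficients[OF p True]) (rule that)
        show ?thesis using AB[OF v] d by simp
      qed (rule torus_tangent_nonsmooth[OF v])
    qed
  qed
  fix X Y Z p
  assume X: "vector_field torus X" and Y: "vector_field torus Y" and Z: "vector_field torus Z"
    and p: "p \<in> points torus"
  then have p: "p \<in> range tproj" by simp
  have area_form: "V p (\<lambda>r. area_form r (U r) (W r)) =
     angle_form 0 p (U p) * V p (\<lambda>r. angle_form 1 r (W r)) + V p (\<lambda>r. angle_form 0 r (U r)) * angle_form 1 p (W p)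
     - angle_form 1 p (U p) * V p (\<lambda>r. angle_form 0 r (W r)) - V p (\<lambda>r. angle_form 1 r (U r)) * angle_form 0 p (W p)"
    if V: "V p \<in> torus_tangent p" and U: "vector_field torus U" and W: "vector_field torus W"
    for U V W :: "(nat \<Rightarrow> real) \<Rightarrow> (nat \<Rightarrow> real) tvec"
    unfolding area_form_def
    by (subst torus_tangent_diff[OF V]) (simp_all add: torus_tangent_mult[OF V] torus_smooth_intros angle_form_smooth U W algebra_simps)
  have "ext_d2 area_form X Y Z p = 0"
    unfolding ext_d2_def area_form[where V = X and U = Y and W = Z, OF vector_field_torus_tangent[OF X p] Y Z]
      area_form[where V = Y and U = Z and W = X, OF vector_field_torus_tangent[OF Y p] Z X] area_form[where V = Z and U = X and W = Y, OF vector_field_torus_tangent[OF Z p] X Y]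
    unfolding area_form_def
    using X Y Z p by (simp add: angle_form_bracket algebra_simps)
  moreover have "wedge12 (angle_form 0) area_form p (X p) (Y p) (Z p) = 0"
    by (simp add: wedge12_def area_form_def algebra_simps)
  ultimately show "lee_d2 (angle_form 0) area_form X Y Z p = 0" by (simp add: lee_d2_def)
qed

section \<open>Hamiltonian flows on the torus\<close>

text \<open>
  Continuous partial derivatives imply total differentiability.
\<close>
lemma smooth2_has_derivative:
  assumes F: "smooth2 F" "partials_on UNIV F F1 F2"
  shows "((\<lambda>p. F (fst p) (snd p)) has_derivative (\<lambda>h. F1 x y * fst h + F2 x y * snd h)) (at (x, y))"
proof -
  obtain G1 G2 where G: "smooth2 G1" "smooth2 G2" "partials_on UNIV F G1 G2"
    using F(1) by (rule smooth2_on_partials)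
  have "F2 = G2" using partials_on_unique(2)[OF F(2) G(3)] by blast
  then have c: "continuous_on UNIV (\<lambda>p. F2 (fst p) (snd p))" using smooth2_on_cont'[OF G(2)] by simp
  have "((\<lambda>(x, y). F x y) has_derivative (\<lambda>(tx, ty). (\<lambda>h. F1 x y * h) tx + blinfun_apply (blinfun_mult_right (F2 x y)) ty))
      (at (x, y) within UNIV \<times> UNIV)"
  proof (rule has_derivative_partialsI)
    show "((\<lambda>x. F x y) has_derivative (*) (F1 x y)) (at x within UNIV)"
      "((\<lambda>y. F x y) has_derivative blinfun_apply (blinfun_mult_right (F2 x y))) (at y within UNIV)" for x y
      using F(2) by (simp_all add: partials_on_def has_field_derivative_def)
    have "continuous_on UNIV (\<lambda>p. blinfun_mult_right (F2 (fst p) (snd p)))"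
      using bounded_linear.continuous_on[OF bounded_linear_blinfun_mult_right c] .
    then show "continuous (at (x, y) within UNIV \<times> UNIV) (\<lambda>(x, y). blinfun_mult_right (F2 x y))"
      by (simp add: case_prod_unfold continuous_on_eq_continuous_at)
  qed simp_all
  then show ?thesis by (simp add: case_prod_unfold)
qed

lemma smooth2_chain:
  assumes F: "smooth2 F" "partials_on UNIV F F1 F2"
    and \<gamma>: "(\<gamma> has_vector_derivative (a, b)) (at t)"
  shows "((\<lambda>s. F (fst (\<gamma> s)) (snd (\<gamma> s))) has_real_derivative
    F1 (fst (\<gamma> t)) (snd (\<gamma> t)) * a + F2 (fst (\<gamma> t)) (snd (\<gamma> t)) * b) (at t)"
proof -
  have "((\<lambda>p. F (fst p) (snd p)) \<circ> \<gamma> has_derivative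
      (\<lambda>h. F1 (fst (\<gamma> t)) (snd (\<gamma> t)) * fst h + F2 (fst (\<gamma> t)) (snd (\<gamma> t)) * snd h) \<circ> (\<lambda>h. h *\<^sub>R (a, b))) (at t)"
    using smooth2_has_derivative[OF F, of "fst (\<gamma> t)" "snd (\<gamma> t)"] \<gamma>
    unfolding has_vector_derivative_def by (intro diff_chain_at) auto
  then show ?thesis
    unfolding has_field_derivative_def o_def
    by (rule has_derivative_eq_rhs) (simp add: fun_eq_iff algebra_simps)
qed

lemma biperiodic_partials:
  assumes F: "biperiodic F" "partials_on UNIV F F1 F2"
  shows "biperiodic F1" "biperiodic F2"
proof -
  have d: "((\<lambda>t. F t y) has_real_derivative F1 x y) (at x)" "(F x has_real_derivative F2 x y) (at y)" for x y
    using F(2) by (simp_all add: partials_on_def)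
  have e: "(\<lambda>t. F (t + 2 * pi) y) = (\<lambda>t. F t y)" "(\<lambda>t. F x (t + 2 * pi)) = F x" 
    "F (x + 2 * pi) = F x" "(\<lambda>t. F t (y + 2 * pi)) = (\<lambda>t. F t y)" for x y
    using F(1) by (auto simp: biperiodic_def periodic_def)
  have "F1 (x + 2 * pi) y = F1 x y" "F2 x (y + 2 * pi) = F2 x y"
    "F1 x (y + 2 * pi) = F1 x y" "F2 (x + 2 * pi) y = F2 x y" for x y
  proof -
    show "F1 (x + 2 * pi) y = F1 x y"
      using d(1)[of y "x + 2 * pi", unfolded DERIV_shift e] d(1) by (rule DERIV_unique)
    show "F2 x (y + 2 * pi) = F2 x y"
      using d(2)[of x "y + 2 * pi", unfolded DERIV_shift e] d(2) by (rule DERIV_unique)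
    show "F1 x (y + 2 * pi) = F1 x y"
      using d(1)[of "y + 2 * pi" x, unfolded e] d(1) by (rule DERIV_unique)
    show "F2 (x + 2 * pi) y = F2 x y"
      using d(2)[of "x + 2 * pi" y, unfolded e] d(2) by (rule DERIV_unique)
  qed
  then show "biperiodic F1" "biperiodic F2" by (simp_all add: biperiodic_def periodic_def)
qed

lemma biperiodic_bounded:
  assumes "smooth2 F" "biperiodic F"
  obtains M where "M > 0" "\<And>x y. \<bar>F x y\<bar> \<le> M"
proof -
  let ?K = "cbox (0, 0) (2 * pi, 2 * pi)"
  have "compact ((\<lambda>p. F (fst p) (snd p)) ` ?K)"
    by (intro compact_continuous_image continuous_on_subset[OF smooth2_on_cont'[OF assms(1)]]) auto
  from compact_imp_bounded[OF this]
  obtain M where M: "\<forall>u\<in>(\<lambda>p. F (fst p) (snd p)) ` ?K. norm u \<le> M"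
    unfolding bounded_iff by (elim exE) (rule that)
  have "\<bar>F x y\<bar> \<le> M" for x y
  proof -
    have "(mod2pi x, mod2pi y) \<in> ?K" using mod2pi_bounds[of x] mod2pi_bounds[of y] by auto
    from bspec[OF M imageI[OF this]] show ?thesis by (simp add: biperiodic_mod2pi[OF assms(2)])
  qed
  then show ?thesis by (intro that[of "max M 1"]) (auto simp: le_max_iff_disj)
qed

lemma biperiodic_lipschitz:
  assumes F: "smooth2 F" "biperiodic F"
  obtains L where "L > 0" "\<And>p p'. \<bar>F (fst p) (snd p) - F (fst p') (snd p')\<bar> \<le> L * norm (p - p')"
proof -
  obtain F1 F2 where F': "smooth2 F1" "smooth2 F2" "partials_on UNIV F F1 F2"
    using F(1) by (rule smooth2_on_partials)
  obtain M1 where M1: "M1 > 0" "\<And>x y. \<bar>F1 x y\<bar> \<le> M1"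
    by (rule biperiodic_bounded[OF F'(1) biperiodic_partials(1)[OF F(2) F'(3)]]) (rule that)
  obtain M2 where M2: "M2 > 0" "\<And>x y. \<bar>F2 x y\<bar> \<le> M2"
    by (rule biperiodic_bounded[OF F'(2) biperiodic_partials(2)[OF F(2) F'(3)]]) (rule that)
  have "\<bar>F (fst p) (snd p) - F (fst p') (snd p')\<bar> \<le> (M1 + M2) * norm (p - p')" for p p'
  proof -
    have 1: "norm (F (fst p) y - F (fst p') y) \<le> M1 * norm (fst p - fst p')" for y
      by (rule field_differentiable_bound[where S = UNIV and f' = "\<lambda>x. F1 x y"])
        (use F'(3) M1 in \<open>auto simp: partials_on_def\<close>)
    have 2: "norm (F x (snd p) - F x (snd p')) \<le> M2 * norm (snd p - snd p')" for x
      by (rule field_differentiable_bound[where S = UNIV and f' = "F2 x"])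
        (use F'(3) M2 in \<open>auto simp: partials_on_def\<close>)
    have "norm (fst p - fst p') \<le> norm (p - p')" "norm (snd p - snd p') \<le> norm (p - p')"
      using norm_fst_le[of "fst (p - p')" "snd (p - p')"] norm_snd_le[of "snd (p - p')" "fst (p - p')"]
      unfolding prod.collapse by simp_all
    then have "M1 * norm (fst p - fst p') \<le> M1 * norm (p - p')" "M2 * norm (snd p - snd p') \<le> M2 * norm (p - p')"
      using M1 M2 by (auto intro!: mult_left_mono)
    then show ?thesis using 1[of "snd p"] 2[of "fst p'"] by (simp add: algebra_simps)
  qed
  then show ?thesis using M1 M2 by (intro that[of "M1 + M2"]) auto
qed

lemma biperiodic_ode:
  assumes A: "smooth2 A" "biperiodic A" and B: "smooth2 B" "biperiodic B"
  obtains \<gamma> where "\<gamma> 0 = z"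
    "\<And>t. (\<gamma> has_vector_derivative (A (fst (\<gamma> t)) (snd (\<gamma> t)), B (fst (\<gamma> t)) (snd (\<gamma> t)))) (at t)"
proof -
  obtain LA where LA: "LA > 0" "\<And>p p'. \<bar>A (fst p) (snd p) - A (fst p') (snd p')\<bar> \<le> LA * norm (p - p')"
    by (rule biperiodic_lipschitz[OF A]) (rule that)
  obtain LB where LB: "LB > 0" "\<And>p p'. \<bar>B (fst p) (snd p) - B (fst p') (snd p')\<bar> \<le> LB * norm (p - p')"
    by (rule biperiodic_lipschitz[OF B]) (rule that)
  let ?f = "\<lambda>p. (A (fst p) (snd p), B (fst p) (snd p))"
  have "norm (?f p - ?f p') \<le> (LA + LB) * norm (p - p')" for p p'
  proof -
    have "norm (?f p - ?f p') \<le> \<bar>A (fst p) (snd p) - A (fst p') (snd p')\<bar> + \<bar>B (fst p) (snd p) - B (fst p') (snd p')\<bar>"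
      using norm_Pair_le[of "A (fst p) (snd p) - A (fst p') (snd p')" "B (fst p) (snd p) - B (fst p') (snd p')"]
      by simp
    also have "\<dots> \<le> (LA + LB) * norm (p - p')" using LA(2)[of p p'] LB(2)[of p p'] by (simp add: algebra_simps)
    finally show ?thesis .
  qed
  moreover have "LA + LB > 0" using LA LB by simp
  ultimately obtain \<gamma> where "\<gamma> 0 = z" "\<And>t. (\<gamma> has_vector_derivative ?f (\<gamma> t)) (at t)"
    using picard_global[of "LA + LB" ?f z] by (metis (no_types, lifting))
  then show ?thesis by (rule that)
qed

text \<open>
  From \<open>\<iota>\<^sub>X (d\<theta> \<and> dy) = dK - K d\<theta>\<close> one reads off \<open>X = K\<^sub>y \<partial>\<^sub>\<theta> + (K - K\<^sub>\<theta>) \<partial>\<^sub>y\<close>. Its integral curves are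
  solved in the plane and projected; the winding is the increment of the lifted first angle by the
  fundamental theorem of calculus.
\<close>
lemma hamiltonian_flow_torus:
  assumes K: "smooth2 K" "biperiodic K" "partials_on UNIV K K1 K2"
  obtains X \<phi> \<Gamma> where
    "hamiltonian_vector_field torus (angle_form 0) area_form (\<lambda>p. K (p 0) (p 1)) X"
    "is_flow torus X \<phi>"
    "\<And>p. \<Gamma> p 0 = (p 0, p 1)"
    "\<And>p t. (\<Gamma> p has_vector_derivative (K2 (fst (\<Gamma> p t)) (snd (\<Gamma> p t)),
        K (fst (\<Gamma> p t)) (snd (\<Gamma> p t)) - K1 (fst (\<Gamma> p t)) (snd (\<Gamma> p t)))) (at t)"
    "\<And>p t. winding (angle_form 0) X \<phi> t p = fst (\<Gamma> p t) - fst (\<Gamma> p 0)"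
proof -
  obtain G1 G2 where G: "smooth2 G1" "smooth2 G2" "partials_on UNIV K G1 G2"
    using K(1) by (rule smooth2_on_partials)
  have "K1 = G1" "K2 = G2" using partials_on_unique[OF K(3) G(3)] by blast+
  then have K1: "smooth2 K1" and K2: "smooth2 K2" using G by simp_all
  note per = biperiodic_partials[OF K(2,3)]
  let ?B = "\<lambda>x y. K x y - K1 x y"
  have B: "smooth2 ?B" "biperiodic ?B"
    using smooth2_on_diff[OF K(1) K1] K(2) per(1) by (simp_all add: biperiodic_def periodic_def)
  define X where "X = (\<lambda>p :: nat \<Rightarrow> real. coord_vector (K2 (p 0) (p 1)) (?B (p 0) (p 1)) p)"
  have "torus_smooth (\<lambda>p. X p f)" if f: "torus_smooth f" for f
  proof -
    obtain F1 F2 where F: "smooth2 F1" "smooth2 F2" "partials_on UNIV (\<lambda>x y. f (tproj (x, y))) F1 F2"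
      using f by (rule torus_smooth_partials)
    have "torus_smooth (\<lambda>p. K2 (p 0) (p 1) * F1 (p 0) (p 1) + ?B (p 0) (p 1) * F2 (p 0) (p 1))"
      by (intro torus_smooth_intros(1,2) torus_smooth_of_biperiodic[OF per(2) K2] torus_smooth_of_biperiodic[OF B(2,1)]
          torus_smooth_of_biperiodic[OF biperiodic_partials(1)[OF biperiodic_lift F(3)] F(1)]
          torus_smooth_of_biperiodic[OF biperiodic_partials(2)[OF biperiodic_lift F(3)] F(2)])
    then show ?thesis by (simp only: X_def coord_vector_eq[OF f F(3)])
  qed
  then have X: "vector_field torus X"
    unfolding vector_field_def by (auto simp: X_def intro: coord_vector_torus_tangent)
  have lift: "(\<lambda>x y. K (tproj (x, y) 0) (tproj (x, y) 1)) = K"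
    using biperiodic_mod2pi[OF K(2)] by (simp add: fun_eq_iff)
  have "area_form p (X p) v = lee_d0 (angle_form 0) (\<lambda>p. K (p 0) (p 1)) p v" if p: "p \<in> range tproj" and v: "v \<in> torus_tangent p" for p v
    using gradient[OF p torus_smooth_of_biperiodic[OF K(2,1)] v, unfolded lift, OF K(3)]
    by (simp add: area_form_def X_def angle_form_coord_vector lee_d0_def ext_d0_def algebra_simps)
  then have ham: "hamiltonian_vector_field torus (angle_form 0) area_form (\<lambda>p. K (p 0) (p 1)) X"
    using X unfolding hamiltonian_vector_field_def by simp
  have "\<exists>\<gamma>. \<gamma> 0 = z \<and> (\<forall>t. (\<gamma> has_vector_derivative (K2 (fst (\<gamma> t)) (snd (\<gamma> t)), ?B (fst (\<gamma> t)) (snd (\<gamma> t)))) (at t))" for z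
    by (rule biperiodic_ode[OF K2 per(2) B, of z]) blast
  then obtain \<Delta> where \<Delta>: "\<And>z. \<Delta> z 0 = z" "\<And>z t. (\<Delta> z has_vector_derivative
      (K2 (fst (\<Delta> z t)) (snd (\<Delta> z t)), ?B (fst (\<Delta> z t)) (snd (\<Delta> z t)))) (at t)"
    by metis
  define \<Gamma> where "\<Gamma> = (\<lambda>p :: nat \<Rightarrow> real. \<Delta> (p 0, p 1))"
  define \<phi> where "\<phi> = (\<lambda>t p. tproj (\<Gamma> p t))"
  have d: "(\<Gamma> p has_vector_derivative (K2 (fst (\<Gamma> p t)) (snd (\<Gamma> p t)), ?B (fst (\<Gamma> p t)) (snd (\<Gamma> p t)))) (at t)"
    for p t unfolding \<Gamma>_def by (rule \<Delta>(2))
  have "integral_curve torus X (\<lambda>t. \<phi> t p)" for p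
    unfolding integral_curve_def
  proof (intro conjI allI impI)
    show "\<phi> t p \<in> points torus" for t by (simp add: \<phi>_def)
    fix f t assume f: "torus_smooth f"
    obtain F1 F2 where F: "smooth2 F1" "smooth2 F2" "partials_on UNIV (\<lambda>x y. f (tproj (x, y))) F1 F2"
      using f by (rule torus_smooth_partials)
    have sm: "smooth2 (\<lambda>x y. f (tproj (x, y)))" using f by (simp add: smooth_fun_torus)
    have "X (\<phi> t p) f = F1 (fst (\<Gamma> p t)) (snd (\<Gamma> p t)) * K2 (fst (\<Gamma> p t)) (snd (\<Gamma> p t))
        + F2 (fst (\<Gamma> p t)) (snd (\<Gamma> p t)) * ?B (fst (\<Gamma> p t)) (snd (\<Gamma> p t))"
      using biperiodic_mod2pi[OF biperiodic_partials(1)[OF biperiodic_lift F(3)]] biperiodic_mod2pi[OF biperiodic_partials(2)[OF biperiodic_lift F(3)]]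
        biperiodic_mod2pi[OF per(1)] biperiodic_mod2pi[OF per(2)] biperiodic_mod2pi[OF K(2)]
      by (simp add: X_def coord_vector_eq[OF f F(3)] \<phi>_def mult.commute)
    with smooth2_chain[OF sm F(3) d[of p t]]
    show "((\<lambda>s. f (\<phi> s p)) has_real_derivative X (\<phi> t p) f) (at t)" by (simp add: \<phi>_def)
  qed
  moreover have "\<phi> 0 p = p" if "p \<in> range tproj" for p
    using tproj_point[OF that] by (simp add: \<phi>_def \<Gamma>_def \<Delta>(1))
  ultimately have flow: "is_flow torus X \<phi>" by (simp add: is_flow_def)
  have "winding (angle_form 0) X \<phi> t p = fst (\<Gamma> p t) - fst (\<Gamma> p 0)" for p t
  proof -
    have e: "angle_form 0 (\<phi> s p) (X (\<phi> s p)) = K2 (fst (\<Gamma> p s)) (snd (\<Gamma> p s))" for s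
      using biperiodic_mod2pi[OF per(2)] by (simp add: X_def angle_form_coord_vector \<phi>_def)
    have fd: "((\<lambda>s. fst (\<Gamma> p s)) has_vector_derivative K2 (fst (\<Gamma> p s)) (snd (\<Gamma> p s))) (at s)" for s
      using smooth2_chain[OF smooth2_on_fst _ d[of p s], of "\<lambda>x y. 1" "\<lambda>x y. 0"]
      by (simp add: partials_on_def has_real_derivative_iff_has_vector_derivative)
    have "continuous_on S (\<Gamma> p)" for S
      using has_vector_derivative_continuous[OF d] by (simp add: continuous_at_imp_continuous_on)
    from continuous_on_compose2[OF smooth2_on_cont'[OF K2] this]
    have c: "continuous_on S (\<lambda>s. K2 (fst (\<Gamma> p s)) (snd (\<Gamma> p s)))" for S by simp
    show ?thesis
      unfolding winding_def e zero_ereal_def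
      by (rule interval_integral_FTC_finite[OF c has_vector_derivative_at_within[OF fd]])
  qed
  then show ?thesis using ham flow \<Delta>(1) d by (intro that[of X \<phi> \<Gamma>]) (simp_all add: \<Gamma>_def)
qed

section \<open>The Hamiltonian and its zigzag level curve\<close>

text \<open>
  The function \<open>e\<^bsup>-w\<^esup>\<close> with \<open>w = 1 / (1 - cos s)\<close>, extended by 0. Written as \<open>(1 - cos s) w e\<^bsup>-w\<^esup>\<close> it
  needs only the case \<open>m = 1\<close> of \<open>flat_wave\<close>, which has the right value at \<open>w = \<infinity>\<close>.
\<close>
definition flat_bump :: "real \<Rightarrow> real" where "flat_bump s = (1 - cos s) * flat_wave 1 (\<lambda>_. 1) 0 s"

text \<open>
  The product of \<open>flat_bump\<close> and \<open>zigzag\<close>, in a form that is smooth by construction.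
\<close>
definition bump_zigzag :: "real \<Rightarrow> real" where
  "bump_zigzag s = 2 * flat_bump s + flat_wave 1 (\<lambda>_. 1) 0 s + flat_wave 1 sin 0 s"

text \<open>
  As \<open>s\<close> decreases to 0, this oscillates between 2 and \<open>2 + 2w\<close> with \<open>w \<rightarrow> \<infinity>\<close>.
\<close>
definition zigzag :: "real \<Rightarrow> real" where "zigzag s = 2 + blowup s * (1 + sin (blowup s))"

lemma smooth_periodic_const: "smooth_periodic (\<lambda>_. c)"
  by (simp add: smooth_periodic_def periodic_def smooth1_def)

lemma smooth_periodic_sin: "smooth_periodic sin"
  by (simp add: smooth_periodic_def periodic_sin_cos smooth1_def smooth2_on_intros)

lemma blowup_periodic: "blowup (y + 2 * pi) = blowup y"
  by (simp add: blowup_def)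

lemma smooth_periodic_flat_wave_section:
  assumes "m \<ge> 1" "smooth_periodic A" shows "smooth_periodic (flat_wave m A 0)"
  unfolding smooth_periodic_def
proof
  show "periodic (flat_wave m A 0)" by (simp add: periodic_def flat_wave_def blowup_periodic)
  show "smooth1 (flat_wave m A 0)" by (rule smooth1_section[OF smooth2_flat_wave[OF assms]])
qed

lemma flat_wave_shift: "smooth_periodic A \<Longrightarrow> flat_wave m A (x + 2 * pi) y = flat_wave m A x y" "flat_wave m A x (y + 2 * pi) = flat_wave m A x y"
proof -
  have "x + 2 * pi + blowup y = (x + blowup y) + 2 * pi" by simp
  then show "flat_wave m A (x + 2 * pi) y = flat_wave m A x y" if "smooth_periodic A"
    unfolding flat_wave_def using that by (simp only: smooth_periodic_def periodic_def)
  show "flat_wave m A x (y + 2 * pi) = flat_wave m A x y" by (simp add: flat_wave_def blowup_periodic)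
qed

lemma smooth_periodic_arith:
  assumes "smooth_periodic A" "smooth_periodic B"
  shows "smooth_periodic (\<lambda>s. A s + B s)" "smooth_periodic (\<lambda>s. A s - B s)" "smooth_periodic (\<lambda>s. A s * B s)"
  using assms by (simp_all add: smooth_periodic_def periodic_def smooth1_def smooth2_on_intros)

lemma smooth_periodic_flat_bump: "smooth_periodic flat_bump"
proof -
  have "smooth_periodic (\<lambda>s. 1 - cos s)"
    by (simp add: smooth_periodic_def periodic_def smooth1_def smooth2_on_intros)
  from smooth_periodic_arith(3)[OF this smooth_periodic_flat_wave_section[OF _ smooth_periodic_const]] show ?thesis
    by (simp add: flat_bump_def[abs_def])
qed

lemma smooth_periodic_bump_zigzag: "smooth_periodic bump_zigzag"
  unfolding bump_zigzag_def[abs_def]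
  by (intro smooth_periodic_arith smooth_periodic_const smooth_periodic_flat_bump smooth_periodic_flat_wave_section smooth_periodic_sin) auto

lemma flat_bump_eq: "cos s \<noteq> 1 \<Longrightarrow> flat_bump s = exp (- blowup s)"
  by (simp add: flat_bump_def flat_wave_def blowup_def)

lemma flat_bump_zero: "cos s = 1 \<Longrightarrow> flat_bump s = 0"
  by (simp add: flat_bump_def)

lemma flat_bump_nonneg: "0 \<le> flat_bump s"
  using flat_bump_eq[of s] flat_bump_zero[of s] by (cases "cos s = 1") auto

lemma bump_zigzag_eq: "cos s \<noteq> 1 \<Longrightarrow> bump_zigzag s = flat_bump s * zigzag s"
  by (simp add: bump_zigzag_def flat_bump_eq zigzag_def flat_wave_def algebra_simps)

lemma cos_neq_1: "0 < s \<Longrightarrow> s < 2 * pi \<Longrightarrow> cos s \<noteq> 1"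
proof -
  assume "0 < s" "s < 2 * pi"
  then have "sin (s / 2) \<noteq> 0" using sin_gt_zero[of "s / 2"] by simp
  then show ?thesis using cos_double_sin[of "s / 2"] by simp
qed

lemma flat_bump_pos: "0 < s \<Longrightarrow> s < 2 * pi \<Longrightarrow> 0 < flat_bump s"
  using cos_neq_1[of s] by (simp add: flat_bump_eq)

lemma blowup_antimono: "0 < r \<Longrightarrow> r \<le> s \<Longrightarrow> s \<le> pi \<Longrightarrow> blowup s \<le> blowup r"
proof -
  assume r: "0 < r" "r \<le> s" "s \<le> pi"
  have "cos s \<le> cos r" using r by (intro cos_monotone_0_pi_le) auto
  moreover have "cos r < 1" using cos_neq_1[of r] cos_le_one[of r] r pi_gt_zero by linarith
  ultimately show ?thesis unfolding blowup_def by (intro le_imp_inverse_le) auto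
qed

lemma flat_bump_mono: "0 < r \<Longrightarrow> r \<le> s \<Longrightarrow> s \<le> pi \<Longrightarrow> flat_bump r \<le> flat_bump s"
proof -
  assume r: "0 < r" "r \<le> s" "s \<le> pi"
  have "cos r \<noteq> 1" "cos s \<noteq> 1" by (rule cos_neq_1; use r pi_gt_zero in linarith)+
  then show ?thesis using blowup_antimono[OF r] by (simp add: flat_bump_eq)
qed

text \<open>
  The bump vanishes at 0 and has bounded derivative.
\<close>
lemma flat_bump_le_linear: obtains L where "L > 0" "\<And>s. 0 \<le> s \<Longrightarrow> flat_bump s \<le> L * s"
proof -
  obtain b' where b': "smooth_periodic b'" "\<And>x. (flat_bump has_real_derivative b' x) (at x)"
    by (rule smooth_periodic_deriv[OF smooth_periodic_flat_bump]) (rule that)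
  obtain L where L: "L > 0" "\<And>x. \<bar>b' x\<bar> \<le> L"
    by (rule periodic_bounded[of b']) (use b'(1) smooth1_isCont that in \<open>auto simp: smooth_periodic_def\<close>)
  have "norm (flat_bump s - flat_bump 0) \<le> L * norm (s - 0)" for s
    by (rule field_differentiable_bound[where S = UNIV and f' = b']) (use b' L in auto)
  then have "flat_bump s \<le> L * s" if "0 \<le> s" for s using that flat_bump_nonneg[of s] flat_bump_zero[of 0] by (metis abs_of_nonneg cos_zero diff_zero real_norm_def)
  then show ?thesis using L(1) by (rule that[rotated])
qed

lemma antiderivative:
  fixes b :: "real \<Rightarrow> real"
  assumes "\<And>x. isCont b x"
  obtains f where "\<And>x. (f has_real_derivative b x) (at x)"
proof -
  let ?f = "\<lambda>u. LBINT y=0..ereal u. b y"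
  have "(?f has_real_derivative b x) (at x)" for x
  proof -
    let ?a = "- \<bar>x\<bar> - 1" and ?c = "\<bar>x\<bar> + 1"
    have "((\<lambda>u. LBINT y=ereal 0..ereal u. b y) has_vector_derivative b x) (at x within {?a..?c})"
      by (rule interval_integral_FTC2) (use assms in \<open>auto intro: continuous_at_imp_continuous_on\<close>)
    moreover have "at x within {?a..?c} = at x"
      by (rule at_within_interior) (simp add: interior_atLeastAtMost_real, linarith)
    ultimately show ?thesis
      by (simp add: has_real_derivative_iff_has_vector_derivative zero_ereal_def)
  qed
  then show ?thesis by (rule that)
qed

text \<open>
  A lift of a circle homeomorphism of degree one with derivative proportional to the bump: the
  integral of the bump, normalised to increase by \<open>2\<pi>\<close> over a period. Then \<open>e\<^bsup>s - f(s)\<^esup>\<close> is periodic,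
  and it agrees with \<open>e\<^sup>s\<close> to infinite order at 0.
\<close>
lemma flat_circle_map:
  obtains f c where "c > 0" "\<And>s. (f has_real_derivative c * flat_bump s) (at s)" "f 0 = 0" "\<And>s. f (s + 2 * pi) = f s + 2 * pi"
proof -
  have cont: "isCont flat_bump x" for x using smooth_periodic_flat_bump smooth1_isCont by (simp add: smooth_periodic_def)
  obtain g where g: "\<And>x. (g has_real_derivative flat_bump x) (at x)"
    by (rule antiderivative[of flat_bump]) (use cont that in blast)+
  obtain \<xi> where "0 < \<xi>" "\<xi> < 2 * pi" "g (2 * pi) - g 0 = (2 * pi - 0) * flat_bump \<xi>"
    using MVT2[of 0 "2 * pi" g flat_bump] g by auto
  then have pos: "g (2 * pi) - g 0 > 0" using flat_bump_pos[of \<xi>] by simp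
  have "((\<lambda>s. g (s + 2 * pi) - g s) has_real_derivative 0) (at x)" for x
  proof -
    have "((\<lambda>s. g (s + 2 * pi)) has_real_derivative flat_bump (x + 2 * pi)) (at x)"
      using g[of "x + 2 * pi"] unfolding DERIV_shift .
    from DERIV_diff[OF this g[of x]] show ?thesis using smooth_periodic_flat_bump by (simp add: smooth_periodic_def periodic_def)
  qed
  then have "g (s + 2 * pi) - g s = g (0 + 2 * pi) - g 0" for s
    using DERIV_isconst_all by blast
  then have per: "g (s + 2 * pi) = g s + (g (2 * pi) - g 0)" for s by (simp add: algebra_simps)
  let ?c = "2 * pi / (g (2 * pi) - g 0)"
  let ?f = "\<lambda>s. ?c * (g s - g 0)"
  have "(?f has_real_derivative ?c * flat_bump s) (at s)" for s
    using DERIV_cmult[OF DERIV_diff[OF g[of s] DERIV_const], of ?c] by simp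
  moreover have "?f (s + 2 * pi) = ?f s + 2 * pi" for s
    using pos unfolding per by (simp add: field_simps)
  moreover have "?c > 0" using pos by simp
  ultimately show ?thesis by (intro that[of ?c ?f]) auto
qed

locale flat_circle =
  fixes f :: "real \<Rightarrow> real" and c :: real
  assumes c: "c > 0" and f: "\<And>s. (f has_real_derivative c * flat_bump s) (at s)" "f 0 = 0"
    "\<And>s. f (s + 2 * pi) = f s + 2 * pi"
begin

definition profile :: "real \<Rightarrow> real" where "profile s = exp (s - f s) - bump_zigzag s"

text \<open>
  With \<open>z = 1 / (1 - cos y)\<close> and \<open>s = x + z\<close> this is
  \<open>e\<^bsup>-z\<^esup> (e\<^bsup>s - f(s)\<^esup> + b(s) (z - \<zeta>(s)))\<close>, where \<open>b\<close> is \<open>flat_bump\<close> and \<open>\<zeta>\<close> is \<open>zigzag\<close>. The factor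
  \<open>1 - cos y\<close> lowers the power of \<open>z\<close> in the first summand to 0.
\<close>
definition Ham :: "real \<Rightarrow> real \<Rightarrow> real" where
  "Ham x y = (1 - cos y) * flat_wave 1 profile x y + flat_wave 1 flat_bump x y"

text \<open>
  The value of \<open>z\<close> on the level curve \<open>K = 1\<close> as a function of the phase \<open>s\<close>.
\<close>
definition branch :: "real \<Rightarrow> real" where "branch s = zigzag s + exp s * (1 - exp (- f s)) / flat_bump s"

lemma smooth_periodic_profile: "smooth_periodic profile"
proof -
  have "smooth_periodic (\<lambda>s. c * flat_bump s)" using smooth_periodic_arith(3)[OF smooth_periodic_const smooth_periodic_flat_bump] .
  then have "smooth1 f" using f(1) smooth1I[of f "\<lambda>s. c * flat_bump s"] by (simp add: smooth_periodic_def)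
  then have "smooth_periodic (\<lambda>s. exp (s - f s))"
    unfolding smooth_periodic_def smooth1_def by (auto simp: periodic_def f(3) intro!: smooth2_on_intros)
  then show ?thesis unfolding profile_def[abs_def] by (intro smooth_periodic_arith smooth_periodic_bump_zigzag)
qed

lemma Ham_smooth: "smooth2 Ham"
  unfolding Ham_def[abs_def]
  by (intro smooth2_on_intros smooth2_flat_wave smooth_periodic_profile smooth_periodic_flat_bump) auto

lemma Ham_biperiodic: "biperiodic Ham"
  by (simp add: biperiodic_def periodic_def Ham_def flat_wave_shift smooth_periodic_profile smooth_periodic_flat_bump)

lemma Ham_eq: "cos y \<noteq> 1 \<Longrightarrow> Ham x y = exp (- blowup y) * (profile (x + blowup y) + blowup y * flat_bump (x + blowup y))"
proof -
  assume "cos y \<noteq> 1"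
  then have z: "(1 - cos y) * blowup y = 1" by (simp add: blowup_def)
  have "Ham x y = exp (- blowup y) * (((1 - cos y) * blowup y) * profile (x + blowup y) + blowup y * flat_bump (x + blowup y))"
    by (simp add: Ham_def flat_wave_def algebra_simps)
  then show ?thesis by (simp add: z)
qed

lemma Ham_zero: "cos y = 1 \<Longrightarrow> Ham x y = 0"
  by (simp add: Ham_def flat_wave_def blowup_def)

text \<open>
  For fixed \<open>s\<close> the function \<open>K = e\<^bsup>-x\<^esup> H\<close> is affine in \<open>z\<close> with slope \<open>e\<^bsup>-s\<^esup> b(s) > 0\<close>.
\<close>
lemma level_set:
  assumes y: "cos y \<noteq> 1" and s: "0 < x + blowup y" "x + blowup y < 2 * pi"
  shows "Ham x y = exp x \<longleftrightarrow> blowup y = branch (x + blowup y)"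
proof -
  let ?z = "blowup y"
  let ?s = "x + ?z"
  have b: "flat_bump ?s > 0" by (rule flat_bump_pos[OF s])
  have "Ham x y = exp x \<longleftrightarrow> profile ?s + ?z * flat_bump ?s = exp ?s"
    unfolding Ham_eq[OF y] by (simp add: exp_minus exp_add field_simps)
  also have "\<dots> \<longleftrightarrow> flat_bump ?s * (?z - zigzag ?s) = exp ?s * (1 - exp (- f ?s))"
    unfolding profile_def bump_zigzag_eq[OF cos_neq_1[OF s]] by (simp add: exp_diff exp_minus field_simps)
  also have "\<dots> \<longleftrightarrow> ?z = branch ?s"
    unfolding branch_def using b by (auto simp: field_simps)
  finally show ?thesis .
qed

text \<open>
  The mean value theorem and monotonicity of the bump give \<open>0 \<le> f(s) \<le> c s b(s)\<close>, so the strands of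
  the level curve follow the zigzag up to a bounded error.
\<close>
lemma branch_bounds:
  assumes s: "0 < s" "s \<le> pi"
  shows "zigzag s \<le> branch s" "branch s \<le> zigzag s + exp pi * c * pi"
proof -
  have b: "flat_bump s > 0" by (rule flat_bump_pos) (use s pi_gt_zero in linarith)+
  obtain \<xi> where \<xi>: "0 < \<xi>" "\<xi> < s" "f s - f 0 = (s - 0) * (c * flat_bump \<xi>)"
    using MVT2[OF s(1), of f "\<lambda>s. c * flat_bump s"] f(1) by auto
  have "flat_bump \<xi> \<le> flat_bump s" using flat_bump_mono \<xi> s by simp
  then have fs: "0 \<le> f s" "f s \<le> s * c * flat_bump s"
    using \<xi>(3) f(2) c s flat_bump_nonneg[of \<xi>] by (auto simp: mult_left_mono)
  then have e: "0 \<le> 1 - exp (- f s)" "1 - exp (- f s) \<le> f s"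
    using exp_ge_add_one_self[of "- f s"] by auto
  show "zigzag s \<le> branch s" unfolding branch_def using e b by simp
  have "(1 - exp (- f s)) / flat_bump s \<le> s * c" using e fs b by (simp add: divide_le_eq)
  also have "\<dots> \<le> pi * c" using s c by simp
  finally have "exp s * ((1 - exp (- f s)) / flat_bump s) \<le> exp pi * (pi * c)"
    using s e b by (intro mult_mono) auto
  then show "branch s \<le> zigzag s + exp pi * c * pi" unfolding branch_def by (simp add: mult_ac)
qed

lemma zigzag_ge: "2 \<le> zigzag s"
proof -
  have "0 \<le> 1 + sin (blowup s)" using sin_ge_minus_one[of "blowup s"] by linarith
  then show ?thesis using blowup_nonneg[of s] by (simp add: zigzag_def)
qed

lemma branch_ge: 
  assumes s: "0 < s" "s < 2 * pi" shows "2 \<le> branch s"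
proof -
  have b: "flat_bump s > 0" by (rule flat_bump_pos[OF s])
  have "f 0 \<le> f s"
    by (rule DERIV_nonneg_imp_nondecreasing) (use s f(1) c flat_bump_nonneg in \<open>auto intro!: exI\<close>)
  then have "exp (- f s) \<le> 1" using f(2) by simp
  then have "0 \<le> exp s * (1 - exp (- f s)) / flat_bump s" using b by simp
  then show ?thesis using zigzag_ge[of s] unfolding branch_def by linarith
qed

text \<open>
  The left side is the velocity of the phase \<open>s = x + z\<close> along the flow. Since
  \<open>dz/dy = - z\<^sup>2 sin y\<close>, everything cancels except \<open>e\<^sup>x dz/dy\<close> times the derivative of \<open>K\<close> with
  respect to \<open>z\<close> at fixed \<open>s\<close>.
\<close>
lemma Ham_partials:
  assumes H: "partials_on UNIV Ham H1 H2" and y: "cos y \<noteq> 1"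
  shows "H2 x y - sin y * (blowup y)\<^sup>2 * (Ham x y - H1 x y) = - (sin y * (blowup y)\<^sup>2 * exp (- blowup y) * flat_bump (x + blowup y))"
proof -
  obtain A' where A': "\<And>x. (profile has_real_derivative A' x) (at x)"
    by (rule smooth_periodic_deriv[OF smooth_periodic_profile]) (rule that)
  obtain b' where b': "\<And>x. (flat_bump has_real_derivative b' x) (at x)"
    by (rule smooth_periodic_deriv[OF smooth_periodic_flat_bump]) (rule that)
  let ?z = "blowup y"
  let ?s = "x + ?z"
  have "((\<lambda>x. Ham x y) has_real_derivative exp (- ?z) * (A' ?s + ?z * b' ?s)) (at x)"
    unfolding Ham_eq[OF y]
    by (intro DERIV_cmult DERIV_add DERIV_chain2[OF A', where Db = 1, simplified] DERIV_chain2[OF b', where Db = 1, simplified])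
       (auto intro!: derivative_eq_intros)
  moreover have "((\<lambda>t. Ham t y) has_real_derivative H1 x y) (at x)" using H by (simp add: partials_on_def)
  ultimately have 1: "H1 x y = exp (- ?z) * (A' ?s + ?z * b' ?s)" by (metis DERIV_unique)
  let ?d = "- (sin y * ?z\<^sup>2)"
  have dz: "(blowup has_real_derivative ?d) (at y)"
    by (rule blowup_deriv[OF y])
  have ds: "((\<lambda>y. x + blowup y) has_real_derivative ?d) (at y)"
    using DERIV_add[OF DERIV_const dz] by simp
  have "((\<lambda>y. exp (- blowup y) * (profile (x + blowup y) + blowup y * flat_bump (x + blowup y))) has_real_derivative
     exp (- ?z) * (A' ?s * ?d + (?z * (b' ?s * ?d) + ?d * flat_bump ?s)) + exp (- ?z) * (- ?d) * (profile ?s + ?z * flat_bump ?s)) (at y)"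
    by (intro DERIV_mult' DERIV_add DERIV_chain2[OF A' ds] DERIV_chain2[OF b' ds] dz DERIV_chain2[OF DERIV_exp DERIV_minus[OF dz]])
  then have "((\<lambda>y. Ham x y) has_real_derivative
     exp (- ?z) * (A' ?s * ?d + (?z * (b' ?s * ?d) + ?d * flat_bump ?s)) + exp (- ?z) * (- ?d) * (profile ?s + ?z * flat_bump ?s)) (at y)"
  proof (rule has_field_derivative_transform_within_open)
    show "open {y. cos y \<noteq> (1::real)}" by (intro open_Collect_neq continuous_intros)
  qed (use y Ham_eq in auto)
  moreover have "((\<lambda>t. Ham x t) has_real_derivative H2 x y) (at y)" using H by (simp add: partials_on_def)
  ultimately have 2: "H2 x y =
     exp (- ?z) * (A' ?s * ?d + (?z * (b' ?s * ?d) + ?d * flat_bump ?s)) + exp (- ?z) * (- ?d) * (profile ?s + ?z * flat_bump ?s)"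
    using DERIV_unique by blast
  show ?thesis unfolding 1 2 Ham_eq[OF y] by algebra
qed

end

section \<open>The orbit that follows the zigzag\<close>

lemma first_exit:
  fixes h :: "real \<Rightarrow> real"
  assumes h: "\<And>t. isCont h t" and "h 0 > 0" and t1: "0 \<le> t1" "h t1 \<le> 0"
  obtains T where "0 < T" "h T \<le> 0" "\<And>t. 0 \<le> t \<Longrightarrow> t < T \<Longrightarrow> h t > 0"
proof -
  let ?S = "{0..t1} \<inter> {t. h t \<le> 0}"
  have "continuous_on UNIV h" using h by (simp add: continuous_at_imp_continuous_on)
  then have "closed {t. h t \<le> 0}" by (intro closed_Collect_le continuous_on_const)
  then have "compact ?S" by (intro compact_Int_closed) auto
  moreover have "t1 \<in> ?S" using t1 by simp
  ultimately obtain T where T: "T \<in> ?S" "\<And>t. t \<in> ?S \<Longrightarrow> T \<le> t"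
    using compact_attains_inf[of ?S] by blast
  have "T \<noteq> 0" using T(1) \<open>h 0 > 0\<close> by auto
  moreover have "h t > 0" if "0 \<le> t" "t < T" for t
  proof (rule ccontr)
    assume "\<not> h t > 0"
    then have "t \<in> ?S" using that T(1) by auto
    then show False using T(2)[of t] that by simp
  qed
  ultimately show ?thesis using T(1) by (intro that[of T]) auto
qed

text \<open>
  \<open>sin\<^sup>2 y = (1 / z) (2 - 1 / z) \<ge> 1 / z\<^sup>2\<close>.
\<close>
lemma sin_lower:
  assumes y: "0 < y" "y < pi" and z: "1 \<le> blowup y"
  shows "1 \<le> sin y * blowup y"
proof -
  have c: "1 - cos y = inverse (blowup y)" by (simp add: blowup_def)
  have "(sin y)\<^sup>2 = (1 - cos y) * (2 - (1 - cos y))"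
    using sin_cos_squared_add[of y] by (simp add: power2_eq_square algebra_simps)
  also have "\<dots> = inverse (blowup y) * (2 - inverse (blowup y))" unfolding c ..
  also have "\<dots> \<ge> inverse (blowup y) * inverse (blowup y)"
    using z inverse_le_1_iff[of "blowup y"] by (intro mult_left_mono) auto
  finally have "(inverse (blowup y))\<^sup>2 \<le> (sin y)\<^sup>2" by (simp add: power2_eq_square)
  then have "inverse (blowup y) \<le> sin y"
    by (rule power2_le_imp_le) (use sin_gt_zero[OF y] in simp)
  then show ?thesis using z by (simp add: inverse_eq_divide divide_le_eq)
qed

lemma blowup_attained:
  assumes "1 \<le> W"
  obtains s where "0 < s" "s \<le> pi / 2" "blowup s = W"
proof -
  let ?s = "arccos (1 - inverse W)"
  have i: "0 < inverse W" "inverse W \<le> 1" using assms by (auto simp: inverse_le_1_iff)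
  then have c: "cos ?s = 1 - inverse W" by (intro cos_arccos) auto
  then have "blowup ?s = W" by (simp add: blowup_def)
  moreover have "?s \<le> pi / 2" using i by (intro arccos_le_pi2) auto
  moreover have "?s \<noteq> 0"
  proof
    assume "?s = 0"
    then have "cos ?s = 1" by (simp only: cos_zero)
    then show False using c i by simp
  qed
  moreover have "0 \<le> ?s" using i by (intro arccos_lbound) auto
  ultimately show ?thesis by (intro that[of ?s]) auto
qed

text \<open>
  An integral curve in the plane that starts on the level curve \<open>K = 1\<close> with phase \<open>\<pi> / 2\<close>. This
  phase is convenient because all \<open>w \<ge> 1\<close> occur as \<open>1 / (1 - cos s)\<close> with
  \<open>0 < s \<le> \<pi> / 2\<close>.
\<close>
locale flat_circle_orbit = flat_circle +
  fixes H1 H2 :: "real \<Rightarrow> real \<Rightarrow> real" and \<gamma> :: "real \<Rightarrow> real \<times> real"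
  assumes partials: "partials_on UNIV Ham H1 H2"
    and ode: "\<And>t. (\<gamma> has_vector_derivative (H2 (fst (\<gamma> t)) (snd (\<gamma> t)),
        Ham (fst (\<gamma> t)) (snd (\<gamma> t)) - H1 (fst (\<gamma> t)) (snd (\<gamma> t)))) (at t)"
    and init: "fst (\<gamma> 0) + blowup (snd (\<gamma> 0)) = pi / 2" "0 < snd (\<gamma> 0)" "snd (\<gamma> 0) < pi"
      "blowup (snd (\<gamma> 0)) = branch (pi / 2)"
begin

definition "\<theta> t = fst (\<gamma> t)"
definition "y t = snd (\<gamma> t)"
definition "s t = \<theta> t + blowup (y t)"

lemma angle_ode: "(\<theta> has_real_derivative H2 (\<theta> t) (y t)) (at t)"
  using smooth2_chain[OF smooth2_on_fst _ ode[of t], of "\<lambda>x y. 1" "\<lambda>x y. 0"]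
  by (simp add: partials_on_def \<theta>_def[abs_def] y_def)

lemma height_ode: "(y has_real_derivative Ham (\<theta> t) (y t) - H1 (\<theta> t) (y t)) (at t)"
  using smooth2_chain[OF smooth2_on_snd _ ode[of t], of "\<lambda>x y. 0" "\<lambda>x y. 1"]
  by (simp add: partials_on_def \<theta>_def y_def[abs_def])

lemma cos_initial: "cos (y 0) \<noteq> 1"
  using cos_neq_1[of "y 0"] init by (simp add: y_def)

text \<open>
  Conservation of \<open>K = e\<^bsup>-\<theta>\<^esup> H\<close>, whose value on this orbit is 1.
\<close>
lemma conserved: "Ham (\<theta> t) (y t) = exp (\<theta> t)"
proof -
  have d: "((\<lambda>t. Ham (\<theta> t) (y t)) has_real_derivative H2 (\<theta> t) (y t) * Ham (\<theta> t) (y t)) (at t)" for t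
    using smooth2_chain[OF Ham_smooth partials ode[of t]] by (simp add: \<theta>_def y_def algebra_simps)
  have "((\<lambda>t. Ham (\<theta> t) (y t) * exp (- \<theta> t)) has_real_derivative
      Ham (\<theta> t) (y t) * (exp (- \<theta> t) * - H2 (\<theta> t) (y t)) + H2 (\<theta> t) (y t) * Ham (\<theta> t) (y t) * exp (- \<theta> t)) (at t)" for t
    by (intro DERIV_mult' d DERIV_chain2[OF DERIV_exp DERIV_minus[OF angle_ode]])
  then have "((\<lambda>t. Ham (\<theta> t) (y t) * exp (- \<theta> t)) has_real_derivative 0) (at t)" for t
    by (simp add: algebra_simps)
  then have "Ham (\<theta> t) (y t) * exp (- \<theta> t) = Ham (\<theta> 0) (y 0) * exp (- \<theta> 0)"
    using DERIV_isconst_all by blast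
  moreover have "Ham (\<theta> 0) (y 0) = exp (\<theta> 0)"
  proof -
    have e: "\<theta> 0 + blowup (y 0) = pi / 2" using init(1) by (simp add: \<theta>_def y_def)
    show ?thesis
      using level_set[OF cos_initial, of "\<theta> 0"] init(4) unfolding e by (simp add: y_def)
  qed
  ultimately show ?thesis by (simp add: exp_minus field_simps)
qed

text \<open>
  The Hamiltonian vanishes on the circle \<open>cos y = 1\<close>, so the orbit never meets it.
\<close>
lemma cos_y: "cos (y t) \<noteq> 1"
  using conserved[of t] Ham_zero[of "y t" "\<theta> t"] by auto

lemma phase_ode: "(s has_real_derivative - (sin (y t) * (blowup (y t))\<^sup>2 * exp (- blowup (y t)) * flat_bump (s t))) (at t)"
proof -
  have "((\<lambda>t. \<theta> t + blowup (y t)) has_real_derivative H2 (\<theta> t) (y t)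
      + - (sin (y t) * (blowup (y t))\<^sup>2) * (Ham (\<theta> t) (y t) - H1 (\<theta> t) (y t))) (at t)"
    by (intro DERIV_add angle_ode DERIV_chain2[OF blowup_deriv[OF cos_y] height_ode])
  then show ?thesis
    using Ham_partials[OF partials cos_y[of t], of "\<theta> t"] by (simp add: s_def[abs_def])
qed

lemma on_curve: "0 < s t \<Longrightarrow> s t < 2 * pi \<Longrightarrow> blowup (y t) = branch (s t)"
  using level_set[OF cos_y[of t], of "\<theta> t"] conserved[of t] by (simp add: s_def)

lemma initial_phase: "s 0 = pi / 2"
  using init by (simp add: s_def \<theta>_def y_def)

text \<open>
  While \<open>s \<ge> 0\<close> and \<open>0 \<le> y \<le> \<pi>\<close> the phase decreases, but no faster than exponentially.
\<close>
lemma confined_step: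
  assumes T: "0 \<le> T" and region: "\<And>t. 0 \<le> t \<Longrightarrow> t \<le> T \<Longrightarrow> 0 \<le> s t \<and> 0 \<le> y t \<and> y t \<le> pi"
  shows "0 < s T" "s T \<le> pi / 2"
proof -
  obtain L where L: "L > 0" "\<And>s. 0 \<le> s \<Longrightarrow> flat_bump s \<le> L * s"
    by (rule flat_bump_le_linear) (rule that)
  have g: "0 \<le> sin (y t) * (blowup (y t))\<^sup>2 * exp (- blowup (y t))" "sin (y t) * (blowup (y t))\<^sup>2 * exp (- blowup (y t)) \<le> 2"
    if t: "0 \<le> t" "t \<le> T" for t
  proof -
    have sin: "0 \<le> sin (y t)" using region[OF t] by (intro sin_ge_zero) auto
    then show "0 \<le> sin (y t) * (blowup (y t))\<^sup>2 * exp (- blowup (y t))" by simp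
    have "(blowup (y t))\<^sup>2 * exp (- blowup (y t)) \<le> 2"
      using power_le_fact_exp[OF blowup_nonneg, of "y t" 2] by (simp add: exp_minus field_simps)
    then have "sin (y t) * ((blowup (y t))\<^sup>2 * exp (- blowup (y t))) \<le> 1 * 2"
      using sin by (intro mult_mono) auto
    then show "sin (y t) * (blowup (y t))\<^sup>2 * exp (- blowup (y t)) \<le> 2" by (simp add: mult.assoc)
  qed
  have "s T \<le> s 0"
  proof (rule DERIV_nonpos_imp_nonincreasing[OF T])
    fix t assume t: "0 \<le> t" "t \<le> T"
    show "\<exists>d. (s has_real_derivative d) (at t) \<and> d \<le> 0"
      using phase_ode[of t] g(1)[OF t] flat_bump_nonneg[of "s t"] by (intro exI conjI) auto
  qed
  then show "s T \<le> pi / 2" by (simp add: initial_phase)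
  \<comment> \<open>From \<open>b(s) \<le> L s\<close> and \<open>z\<^sup>2 e\<^bsup>-z\<^esup> \<le> 2\<close> one gets \<open>s' \<ge> - 2 L s\<close>.\<close>
  have "s 0 * exp (2 * L * 0) \<le> s T * exp (2 * L * T)"
  proof (rule DERIV_nonneg_imp_nondecreasing[OF T])
    fix t assume t: "0 \<le> t" "t \<le> T"
    let ?g = "sin (y t) * (blowup (y t))\<^sup>2 * exp (- blowup (y t))"
    have "((\<lambda>t. exp (2 * L * t)) has_real_derivative exp (2 * L * t) * (2 * L)) (at t)"
      by (auto intro!: derivative_eq_intros)
    from DERIV_mult'[OF phase_ode this]
    have "((\<lambda>t. s t * exp (2 * L * t)) has_real_derivative
        s t * (exp (2 * L * t) * (2 * L)) + - (?g * flat_bump (s t)) * exp (2 * L * t)) (at t)" .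
    moreover have "?g * flat_bump (s t) \<le> 2 * (L * s t)"
      using g[OF t] L(2)[of "s t"] region[OF t] flat_bump_nonneg[of "s t"] by (intro mult_mono) auto
    then have "0 \<le> (2 * (L * s t) - ?g * flat_bump (s t)) * exp (2 * L * t)"
      by (intro mult_nonneg_nonneg) auto
    then have "0 \<le> s t * (exp (2 * L * t) * (2 * L)) + - (?g * flat_bump (s t)) * exp (2 * L * t)"
      by (simp add: algebra_simps)
    ultimately show "\<exists>d. ((\<lambda>t. s t * exp (2 * L * t)) has_real_derivative d) (at t) \<and> 0 \<le> d" by blast
  qed
  moreover have "0 < s 0" using initial_phase pi_gt_zero by linarith
  then have "0 < s 0 * exp (2 * L * 0)" by simp
  ultimately have "0 < s T * exp (2 * L * T)" by linarith
  then show "0 < s T" by (simp add: zero_less_mult_iff)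
qed

text \<open>
  At a first exit time \<open>T\<close> the phase is still in \<open>(0, \<pi> / 2]\<close> by \<open>confined_step\<close>. Then \<open>z \<ge> 2\<close>
  on the level curve, whereas \<open>z = 1 / 2\<close> for \<open>y = \<pi>\<close>; and \<open>y = 0\<close> is excluded by \<open>cos_y\<close>.
\<close>
lemma confined:
  assumes "0 \<le> t"
  shows "0 < s t" "s t \<le> pi / 2" "0 < y t" "y t < pi"
proof -
  \<comment> \<open>Positive exactly in the region to which the orbit is to be confined.\<close>
  define h where "h t = min (s t) (min (y t) (pi - y t))" for t
  have cont: "isCont s t" "isCont y t" for t using phase_ode height_ode DERIV_isCont by blast+
  have hc: "isCont h t" for t unfolding h_def using cont by (intro continuous_intros)
  have h0: "h 0 > 0" using initial_phase init by (simp add: h_def y_def)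
  have "h t > 0" if t: "0 \<le> t" for t
  proof (rule ccontr)
    assume "\<not> h t > 0"
    then have le: "h t \<le> 0" by simp
    obtain T where T: "0 < T" "h T \<le> 0" "\<And>t. 0 \<le> t \<Longrightarrow> t < T \<Longrightarrow> h t > 0"
      by (rule first_exit[OF hc h0 t le]) (rule that)
    have hT: "h T \<ge> 0"
    proof (rule ccontr)
      assume "\<not> 0 \<le> h T"
      then have "\<exists>x. 0 \<le> x \<and> x \<le> T \<and> h x = h T / 2"
        using h0 T(1) hc by (intro IVT2) auto
      then obtain x where x: "0 \<le> x" "x \<le> T" "h x = h T / 2" by blast
      then show False using T(3)[of x] \<open>\<not> 0 \<le> h T\<close> by (cases "x = T") auto
    qed
    have "0 \<le> h t" if "0 \<le> t" "t \<le> T" for t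
      using T(3)[of t] hT that by (cases "t = T") auto
    then have r: "0 \<le> s t \<and> 0 \<le> y t \<and> y t \<le> pi" if "0 \<le> t" "t \<le> T" for t
      using that by (fastforce simp: h_def)
    have sT: "0 < s T" "s T \<le> pi / 2" using confined_step[of T] r T(1) by auto
    have "2 \<le> blowup (y T)" using on_curve[of T] branch_ge[of "s T"] sT pi_gt_zero by simp
    then have "y T \<noteq> pi" by (auto simp: blowup_def)
    moreover have "y T \<noteq> 0" using cos_y[of T] by auto
    ultimately have "0 < y T" "y T < pi" using r[of T] T(1) by auto
    then show False using sT T(2) by (simp add: h_def)
  qed
  then have r: "0 < s t \<and> 0 < y t \<and> y t < pi" if "0 \<le> t" for t
    using that by (fastforce simp: h_def)
  show "0 < s t" "0 < y t" "y t < pi" using r[OF assms] by auto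
  show "s t \<le> pi / 2" by (rule confined_step(2)[OF assms]) (use r in force)
qed

lemma blowup_on_orbit: "0 \<le> t \<Longrightarrow> blowup (y t) = branch (s t)"
  using on_curve confined[of t] pi_gt_zero by simp

text \<open>
  Otherwise the orbit would stay in a compact part of the level curve, where the phase decreases at a
  rate bounded away from 0.
\<close>
lemma s_arbitrarily_small:
  assumes e: "0 < e"
  shows "\<exists>t\<ge>0. s t < e"
proof (rule ccontr)
  assume "\<not> ?thesis"
  then have ge: "e \<le> s t" if "0 \<le> t" for t using that by force
  have e2: "e \<le> pi / 2" using ge[of 0] initial_phase by simp
  \<comment> \<open>A bound for \<open>z\<close> on the part of the level curve with phase in \<open>[e, \<pi> / 2]\<close>.\<close>
  define Z where "Z = 2 + blowup e * 2 + exp pi * c * pi"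
  define \<delta> where "\<delta> = exp (- Z) * flat_bump e"
  have be: "flat_bump e > 0" by (rule flat_bump_pos) (use e e2 pi_gt_zero in linarith)+
  then have \<delta>: "\<delta> > 0" by (simp add: \<delta>_def)
  have rate: "\<delta> \<le> sin (y t) * (blowup (y t))\<^sup>2 * exp (- blowup (y t)) * flat_bump (s t)" if t: "0 \<le> t" for t
  proof -
    note co = confined[OF t]
    have zs: "blowup (s t) \<le> blowup e" using ge[OF t] e co pi_gt_zero by (intro blowup_antimono) linarith+
    have z1: "1 \<le> blowup (y t)"
      using branch_ge[of "s t"] co pi_gt_zero by (simp add: blowup_on_orbit[OF t])
    have "blowup (s t) * (1 + sin (blowup (s t))) \<le> blowup e * 2"
    proof (intro mult_mono)
      show "0 \<le> 1 + sin (blowup (s t))" using sin_ge_minus_one[of "blowup (s t)"] by linarith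
    qed (use zs blowup_nonneg in auto)
    then have "blowup (y t) \<le> Z"
      using branch_bounds(2)[of "s t"] co pi_gt_zero unfolding blowup_on_orbit[OF t] Z_def zigzag_def by simp
    then have "exp (- Z) \<le> exp (- blowup (y t))" by simp
    moreover have "1 \<le> sin (y t) * blowup (y t)" by (rule sin_lower[OF co(3,4) z1])
    then have "1 * 1 \<le> (sin (y t) * blowup (y t)) * blowup (y t)" using z1 by (intro mult_mono) auto
    then have "1 \<le> sin (y t) * (blowup (y t))\<^sup>2" by (simp add: power2_eq_square mult.assoc)
    ultimately have "1 * exp (- Z) \<le> sin (y t) * (blowup (y t))\<^sup>2 * exp (- blowup (y t))"
      by (intro mult_mono) auto
    moreover have "flat_bump e \<le> flat_bump (s t)" using ge[OF t] e co pi_gt_zero by (intro flat_bump_mono) linarith+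
    ultimately show ?thesis unfolding \<delta>_def using be
      by (intro mult_mono) (auto intro: order_trans[OF exp_ge_zero])
  qed
  \<comment> \<open>By this time the phase would have decreased from \<open>\<pi> / 2\<close> to at most \<open>- \<pi> / 2\<close>.\<close>
  let ?T = "pi / \<delta>"
  have T: "0 \<le> ?T" using \<delta> by simp
  have "s ?T + \<delta> * ?T \<le> s 0 + \<delta> * 0"
  proof (rule DERIV_nonpos_imp_nonincreasing[OF T])
    fix t assume t: "0 \<le> t" "t \<le> ?T"
    have "((\<lambda>t. s t + \<delta> * t) has_real_derivative
        - (sin (y t) * (blowup (y t))\<^sup>2 * exp (- blowup (y t)) * flat_bump (s t)) + \<delta> * 1) (at t)"
      by (intro DERIV_add phase_ode DERIV_cmult DERIV_ident)
    then show "\<exists>d. ((\<lambda>t. s t + \<delta> * t) has_real_derivative d) (at t) \<and> d \<le> 0"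
      using rate[OF t(1)] by (intro exI conjI) auto
  qed
  then have "s ?T \<le> - pi / 2" using \<delta> initial_phase by simp
  then show False using confined(1)[OF T] pi_gt_zero by simp
qed

text \<open>
  By continuity the phase runs through all small values, and it does so late because it is decreasing.
\<close>
lemma every_late_phase:
  assumes "0 \<le> N"
  obtains W0 where "\<And>W. W \<ge> W0 \<Longrightarrow> \<exists>t\<ge>N. 0 < s t \<and> s t \<le> pi / 2 \<and> blowup (s t) = W"
proof -
  have "\<exists>t\<ge>N. 0 < s t \<and> s t \<le> pi / 2 \<and> blowup (s t) = W" if W: "W \<ge> max 1 (blowup (s N) + 1)" for W
  proof -
    obtain r where r: "0 < r" "r \<le> pi / 2" "blowup r = W" using blowup_attained[of W] W by auto
    have "r < s N"
    proof (rule ccontr)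
      assume "\<not> r < s N"
      then have "blowup r \<le> blowup (s N)" using confined[OF assms] r pi_gt_zero by (intro blowup_antimono) linarith+
      then show False using r W by simp
    qed
    obtain t1 where t1: "0 \<le> t1" "s t1 < r" using s_arbitrarily_small[OF r(1)] by blast
    have "N \<le> t1"
    proof (rule ccontr)
      assume "\<not> N \<le> t1"
      then have "t1 \<le> N" by simp
      then have "s N \<le> s t1"
      proof (rule DERIV_nonpos_imp_nonincreasing)
        fix t assume "t1 \<le> t" "t \<le> N"
        then have t: "0 \<le> t" using t1 by simp
        have "0 \<le> sin (y t)" using confined[OF t] by (intro sin_ge_zero) auto
        then show "\<exists>d. (s has_real_derivative d) (at t) \<and> d \<le> 0"
          using phase_ode[of t] flat_bump_nonneg[of "s t"] by (intro exI conjI) auto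
      qed
      then show False using t1 \<open>r < s N\<close> by simp
    qed
    then have "\<exists>t. N \<le> t \<and> t \<le> t1 \<and> s t = r"
      using t1 \<open>r < s N\<close> DERIV_isCont[OF phase_ode] by (intro IVT2) auto
    then show ?thesis using r by auto
  qed
  then show ?thesis by (rule that)
qed

lemma returns: "\<exists>t\<ge>N. \<theta> t \<ge> - 2 - exp pi * c * pi" if N: "0 \<le> N"
proof -
  obtain W0 where W0: "\<And>W. W \<ge> W0 \<Longrightarrow> \<exists>t\<ge>N. 0 < s t \<and> s t \<le> pi / 2 \<and> blowup (s t) = W"
    by (rule every_late_phase[OF N]) (rule that)
  obtain n :: nat where n: "real n > W0" using reals_Archimedean2 by blast
  \<comment> \<open>Here \<open>sin W = -1\<close> and the zigzag has its minimum 2.\<close>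
  let ?W = "3 / 2 * pi + 2 * real n * pi"
  have "real n * 1 \<le> real n * (2 * pi)" using pi_gt3 by (intro mult_left_mono) auto
  moreover have "2 * real n * pi = real n * (2 * pi)" by simp
  ultimately have "W0 \<le> ?W" using n pi_gt_zero by linarith
  then obtain t where t: "N \<le> t" "0 < s t" "s t \<le> pi / 2" "blowup (s t) = ?W" using W0 by blast
  have "sin ?W = - 1"
    using sin_3over2_pi sin.plus_of_nat[of "3 / 2 * pi" n] by (simp add: mult.commute mult.left_commute)
  then have "zigzag (s t) = 2" by (simp add: zigzag_def t(4))
  then have "blowup (y t) \<le> 2 + exp pi * c * pi"
    using branch_bounds(2)[of "s t"] t N pi_gt_zero blowup_on_orbit[of t] by simp
  then have "\<theta> t \<ge> - 2 - exp pi * c * pi" using t(2) by (simp add: s_def)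
  then show ?thesis using t(1) by blast
qed

lemma escapes: "\<exists>t\<ge>N. \<theta> t \<le> R" if N: "0 \<le> N"
proof -
  obtain W0 where W0: "\<And>W. W \<ge> W0 \<Longrightarrow> \<exists>t\<ge>N. 0 < s t \<and> s t \<le> pi / 2 \<and> blowup (s t) = W"
    by (rule every_late_phase[OF N]) (rule that)
  obtain n :: nat where n: "real n > max W0 (pi - R)" using reals_Archimedean2 by blast
  \<comment> \<open>Here \<open>sin W = 1\<close> and the zigzag has the value \<open>2 + 2W\<close>.\<close>
  define W where "W = pi / 2 + 2 * real n * pi"
  have "real n * 1 \<le> real n * (2 * pi)" using pi_gt3 by (intro mult_left_mono) auto
  moreover have "2 * real n * pi = real n * (2 * pi)" by simp
  moreover have "W0 < real n" "pi - R < real n" using n by auto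
  moreover have "0 \<le> real n * (2 * pi)" by simp
  ultimately have W: "W0 \<le> W" "pi - R \<le> W" "0 \<le> W" using pi_gt_zero unfolding W_def by linarith+
  then obtain t where t: "N \<le> t" "0 < s t" "s t \<le> pi / 2" "blowup (s t) = W" using W0 by blast
  have "sin W = 1"
    unfolding W_def using sin_pi_half sin.plus_of_nat[of "pi / 2" n] by (simp add: mult.commute mult.left_commute)
  then have "zigzag (s t) = 2 + W * 2" by (simp add: zigzag_def t(4))
  then have "2 + W * 2 \<le> blowup (y t)"
    using branch_bounds(1)[of "s t"] t N pi_gt_zero blowup_on_orbit[of t] by simp
  moreover have "\<theta> t = s t - blowup (y t)" by (simp add: s_def)
  ultimately have "\<theta> t \<le> R" using t(3) W pi_gt_zero by linarith
  then show ?thesis using t(1) by blast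
qed

end

section \<open>Oscillating winding\<close>

theorem proposition13:
  shows "\<exists>(M :: (nat \<Rightarrow> real) mfd) \<eta> \<omega> H X \<phi> x.
    closed_manifold M \<and>
    conformal_symplectic_manifold M \<eta> \<omega> \<and>
    smooth_fun M H \<and>
    hamiltonian_vector_field M \<eta> \<omega> H X \<and>
    is_flow M X \<phi> \<and>
    x \<in> points M \<and> H x \<noteq> 0 \<and>
    Limsup at_top (\<lambda>t. ereal (winding \<eta> X \<phi> t x)) > Liminf at_top (\<lambda>t. ereal (winding \<eta> X \<phi> t x)) \<and>
    Liminf at_top (\<lambda>t. ereal (winding \<eta> X \<phi> t x)) = -\<infinity>"
proof -
  obtain f c where "c > 0" "\<And>s. (f has_real_derivative c * flat_bump s) (at s)" "f 0 = 0"
    "\<And>s. f (s + 2 * pi) = f s + 2 * pi"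
    by (rule flat_circle_map) (rule that)
  then interpret flat_circle f c by unfold_locales
  obtain H1 H2 where P: "partials_on UNIV Ham H1 H2"
    using Ham_smooth by (rule smooth2_on_partials)
  obtain X \<phi> \<Gamma> where ham: "hamiltonian_vector_field torus (angle_form 0) area_form (\<lambda>p. Ham (p 0) (p 1)) X"
    and flow: "is_flow torus X \<phi>"
    and \<Gamma>0: "\<And>p. \<Gamma> p 0 = (p 0, p 1)"
    and \<Gamma>: "\<And>p t. (\<Gamma> p has_vector_derivative (H2 (fst (\<Gamma> p t)) (snd (\<Gamma> p t)),
        Ham (fst (\<Gamma> p t)) (snd (\<Gamma> p t)) - H1 (fst (\<Gamma> p t)) (snd (\<Gamma> p t)))) (at t)"
    and wind: "\<And>p t. winding (angle_form 0) X \<phi> t p = fst (\<Gamma> p t) - fst (\<Gamma> p 0)"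
    by (rule hamiltonian_flow_torus[OF Ham_smooth Ham_biperiodic P]) (rule that)
  define Z where "Z = branch (pi / 2)"
  have "2 \<le> Z" unfolding Z_def by (rule branch_ge) (use pi_gt_zero in auto)
  then obtain y0 where y0: "0 < y0" "y0 \<le> pi / 2" "blowup y0 = Z" using blowup_attained[of Z] by auto
  define x where "x = tproj (pi / 2 - Z, y0)"
  obtain k :: int where k: "pi / 2 - Z = mod2pi (pi / 2 - Z) + 2 * pi * of_int k"
    using mod2pi_eq_iff[of "mod2pi (pi / 2 - Z)" "pi / 2 - Z"] by auto
  \<comment> \<open>The lifted orbit starts in the fundamental domain; the orbit that starts at
    \<open>(\<pi> / 2 - Z, y0)\<close> is its translate.\<close>
  define \<gamma> where "\<gamma> = (\<lambda>t. \<Gamma> x t + (2 * pi * of_int k, 0))"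
  have fs: "fst (\<gamma> t) = fst (\<Gamma> x t) + 2 * pi * of_int k" "snd (\<gamma> t) = snd (\<Gamma> x t)" for t
    by (simp_all add: \<gamma>_def)
  have per: "F (u + 2 * pi * of_int k) v = F u v" if "biperiodic F" for F u v
    using that periodic_int[of "\<lambda>u. F u v" u k] by (simp add: biperiodic_def)
  note pers = per[OF Ham_biperiodic] per[OF biperiodic_partials(1)[OF Ham_biperiodic P]] per[OF biperiodic_partials(2)[OF Ham_biperiodic P]]
  have y0_mod2pi: "mod2pi y0 = y0" by (rule mod2pi_eq) (use y0 pi_gt_zero in linarith)+
  have \<gamma>0: "\<gamma> 0 = (pi / 2 - Z, y0)"
    using k y0_mod2pi by (simp add: \<gamma>_def \<Gamma>0 x_def)
  interpret flat_circle_orbit f c H1 H2 \<gamma>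
  proof
    fix t
    show "(\<gamma> has_vector_derivative (H2 (fst (\<gamma> t)) (snd (\<gamma> t)),
        Ham (fst (\<gamma> t)) (snd (\<gamma> t)) - H1 (fst (\<gamma> t)) (snd (\<gamma> t)))) (at t)"
      unfolding fs pers unfolding \<gamma>_def
      by (rule has_vector_derivative_add_const[THEN iffD2, OF \<Gamma>])
  qed (use P y0 pi_gt_zero in \<open>auto simp: \<gamma>0 Z_def\<close>)
  have w: "winding (angle_form 0) X \<phi> t x = \<theta> t - \<theta> 0" for t
    unfolding wind \<theta>_def fs by simp
  let ?w = "\<lambda>t. ereal (winding (angle_form 0) X \<phi> t x)"
  let ?C = "- 3 - exp pi * c * pi - \<theta> 0"
  have inf: "Liminf at_top ?w = - \<infinity>"
  proof (rule ccontr)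
    assume "Liminf at_top ?w \<noteq> - \<infinity>"
    then obtain R :: real where "ereal R < Liminf at_top ?w"
      using ereal_dense2[of "- \<infinity>" "Liminf at_top ?w"] by auto
    then have "\<forall>\<^sub>F t in at_top. ereal R < ?w t" by (rule less_LiminfD)
    then obtain N where N: "\<And>t. t \<ge> N \<Longrightarrow> R < \<theta> t - \<theta> 0"
      by (auto simp: w eventually_at_top_linorder)
    obtain t where "t \<ge> max 0 N" "\<theta> t \<le> R + \<theta> 0" using escapes[of "max 0 N" "R + \<theta> 0"] by auto
    then show False using N[of t] by simp
  qed
  have sup: "ereal ?C \<le> Limsup at_top ?w"
  proof (rule ccontr)
    assume "\<not> ereal ?C \<le> Limsup at_top ?w"
    then have "Limsup at_top ?w < ereal ?C" by simp
    then have "\<forall>\<^sub>F t in at_top. ?w t < ereal ?C" by (rule Limsup_lessD)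
    then obtain N where N: "\<And>t. t \<ge> N \<Longrightarrow> \<theta> t - \<theta> 0 < ?C"
      by (auto simp: w eventually_at_top_linorder)
    obtain t where "t \<ge> max 0 N" "\<theta> t \<ge> - 2 - exp pi * c * pi" using returns[of "max 0 N"] by auto
    then show False using N[of t] by simp
  qed
  have "Ham (x 0) (x 1) = exp (\<theta> 0)"
    using conserved[of 0] pers(1)[of "fst (\<Gamma> x 0)" "snd (\<Gamma> x 0)"] by (simp add: \<theta>_def y_def fs \<Gamma>0)
  then have "Ham (x 0) (x 1) \<noteq> 0" by simp
  moreover have "- \<infinity> < Limsup at_top ?w"
    using sup by (rule less_le_trans[rotated]) simp
  ultimately show ?thesis
    using closed_manifold_torus conformal_symplectic_torus torus_smooth_of_biperiodic[OF Ham_biperiodic Ham_smooth] ham flow inf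
    by (intro exI[of _ torus] exI[of _ "angle_form 0"] exI[of _ area_form] exI[of _ "\<lambda>p. Ham (p 0) (p 1)"]
        exI[of _ X] exI[of _ \<phi>] exI[of _ x]) (auto simp: x_def)
qed

end
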